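(* Fix $\xi\in(\mathbb{Z}/2\mathbb{Z})^2$, $\eta\in\mathbb{Z}/2\mathbb{Z}$ and $\lambda\in\mathbb{C}^2$. For every $R>0$ and $N\in\mathbb{N}$ there exists a continuous seminorm $q$ on $\pi_{\xi,\lambda}$ such that $$\|B_{\xi,\lambda}^{\eta,\nu}f\|_{L^\infty(O(2n-1))}\le q(f)\,(1+|\operatorname{Im}\nu|)^{-N}$$ for all $f\in\pi_{\xi,\lambda}$ and all $\nu\in\mathbb{C}$ with $|\operatorname{Re}\nu|\le R$ and $|\operatorname{Im}\nu|$ sufficiently large.
   Context: For $\varepsilon\in\mathbb{Z}/2\mathbb{Z}$, $\mu\in\mathbb{C}$, $x\in\mathbb{R}^\times$ put $|x|_\varepsilon^\mu=\operatorname{sgn}(x)^\varepsilon|x|^\mu$; $E_{i,j}$ is the elementary matrix. Let $G=\mathrm{GL}(2n,\mathbb{R})$, $H=\mathrm{GL}(2n-1,\mathbb{R})\subseteq G$ (upper left corner), and let $O(2n-1)\subseteq H$ be the maximal compact subgroup (denoted $K_{2n-1}$ in the paper). $\pi_{\xi,\lambda}$ is the left regular representation of $G$ on the Fréchet space of $f\in C^\infty(G)$ with $f\big(g\begin{pmatrix}g_1&*\\0&g_2\end{pmatrix}\big)=|\det g_1|_{\xi_1}^{-\lambda_1-\frac n2}|\det g_2|_{\xi_2}^{-\lambda_2+\frac n2}f(g)$, $g_1,g_2\in\mathrm{GL}(n,\mathbb{R})$. $B_{\xi,\lambda}^{\eta,\nu}$ is the (unnormalized) family of operators $$B_{\xi,\lambda}^{\eta,\nu}f(h)=\int_{\mathbb{R}^\times}|t|_{\xi_1+\eta}^{\lambda_1-\nu+\frac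 n2}f\big(h(I_{2n}+tE_{2n,n})\big)\frac{dt}{|t|}\qquad(f\in\pi_{\xi,\lambda},\ h\in H),$$ convergent for $\operatorname{Re}(\lambda_1-\nu)>-\frac n2$, $\operatorname{Re}(\nu-\lambda_2)>-\frac n2$ and extended meromorphically to $(\lambda,\nu)\in\mathbb{C}^2\times\mathbb{C}$ (in the compact picture, i.e. for fixed restriction of $f$ to $O(2n)$); for fixed $\lambda$ it has no poles in $\nu$ when $|\operatorname{Im}\nu|$ is sufficiently large. "Sufficiently large" means larger than a bound independent of $f$. *)

theory Defs
  imports "HOL-Analysis.Analysis" "HOL-Library.Z2"
begin

fun iter_deriv :: "'a::real_normed_vector list \<Rightarrow> ('a \<Rightarrow> 'b::real_normed_vector) \<Rightarrow> 'a \<Rightarrow> 'b" where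
  "iter_deriv [] f = f"
| "iter_deriv (v # vs) f = (\<lambda>x. frechet_derivative (iter_deriv vs f) (at x) v)"

text \<open>The set \<open>S\<close> is meant to be open. A smooth function on \<open>S\<close> is represented by its extension
  by zero to the ambient space, so that equality of functions on \<open>S\<close> is equality in HOL;
  derivatives are only ever inspected at points of \<open>S\<close>.\<close>

definition Cinf :: "'a::real_normed_vector set \<Rightarrow> ('a \<Rightarrow> complex) set" where
  "Cinf S = {f. (\<forall>vs. \<forall>x\<in>S. iter_deriv vs f differentiable (at x)) \<and> (\<forall>x. x \<notin> S \<longrightarrow> f x = 0)}"

text \<open>Uniform convergence of all derivatives on compact subsets of \<open>S\<close>.\<close>

definition Cinf_topology :: "'a::real_normed_vector set \<Rightarrow> ('a \<Rightarrow> complex) topology" where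
  "Cinf_topology S = topology_generated_by
     {{g \<in> Cinf S. \<forall>x\<in>K. norm (iter_deriv vs (\<lambda>y. g y - f y) x) < e} | f K vs e.
        f \<in> Cinf S \<and> compact K \<and> K \<subseteq> S \<and> e > (0::real)}"

definition seminorm_on :: "('a \<Rightarrow> complex) set \<Rightarrow> (('a \<Rightarrow> complex) \<Rightarrow> real) \<Rightarrow> bool" where
  "seminorm_on V q \<longleftrightarrow>
     (\<forall>f\<in>V. 0 \<le> q f) \<and>
     (\<forall>f\<in>V. \<forall>g\<in>V. q (\<lambda>x. f x + g x) \<le> q f + q g) \<and>
     (\<forall>f\<in>V. \<forall>c. q (\<lambda>x. c * f x) = norm c * q f)"

definition holomorphic_several_on :: "(complex ^ 'm \<Rightarrow> complex) \<Rightarrow> (complex ^ 'm) set \<Rightarrow> bool" where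
  "holomorphic_several_on F S \<longleftrightarrow>
     (\<forall>z\<in>S. \<exists>L. Vector_Spaces.linear (*s) (*) L \<and> (F has_derivative L) (at z))"

text \<open>Meromorphic on all of \<open>\<complex>\<^sup>m\<close>: locally a quotient of holomorphic functions. The values at zeros
  of the denominator are unconstrained.\<close>

definition meromorphic_several :: "(complex ^ 'm \<Rightarrow> complex) \<Rightarrow> bool" where
  "meromorphic_several F \<longleftrightarrow>
     (\<forall>a. \<exists>U p q. open U \<and> connected U \<and> a \<in> U \<and>
        holomorphic_several_on p U \<and> holomorphic_several_on q U \<and> (\<exists>z\<in>U. q z \<noteq> 0) \<and>
        (\<forall>z\<in>U. q z \<noteq> 0 \<longrightarrow> F z = p z / q z))"

text \<open>\<open>F\<close> is a meromorphic continuation of \<open>F\<^sub>0\<close> from the set \<open>D\<close> (nonempty, open) that has no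
  pole at \<open>a\<close>, normalised so that it is holomorphic near \<open>a\<close>. By the identity theorem \<open>F a\<close>
  is then independent of the choice of \<open>F\<close>.\<close>

definition mero_continuation_at ::
    "(complex ^ 'm) set \<Rightarrow> (complex ^ 'm \<Rightarrow> complex) \<Rightarrow> complex ^ 'm \<Rightarrow> (complex ^ 'm \<Rightarrow> complex) \<Rightarrow> bool" where
  "mero_continuation_at D F\<^sub>0 a F \<longleftrightarrow>
     meromorphic_several F \<and> (\<forall>z\<in>D. F z = F\<^sub>0 z) \<and>
     (\<exists>U. open U \<and> a \<in> U \<and> holomorphic_several_on F U)"

definition continuation_regular ::
    "(complex ^ 'm) set \<Rightarrow> (complex ^ 'm \<Rightarrow> complex) \<Rightarrow> complex ^ 'm \<Rightarrow> bool" where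
  "continuation_regular D F\<^sub>0 a \<longleftrightarrow> (\<exists>F. mero_continuation_at D F\<^sub>0 a F)"

definition continuation_value ::
    "(complex ^ 'm) set \<Rightarrow> (complex ^ 'm \<Rightarrow> complex) \<Rightarrow> complex ^ 'm \<Rightarrow> complex" where
  "continuation_value D F\<^sub>0 a = (THE w. \<exists>F. mero_continuation_at D F\<^sub>0 a F \<and> w = F a)"

text \<open>Matrices of size \<open>2n\<close> are indexed by \<open>'n + 'n\<close> with \<open>n = CARD('n)\<close>: \<open>Inl\<close> gives the indices
  \<open>1, \<dots>, n\<close> and \<open>Inr\<close> the indices \<open>n + 1, \<dots>, 2n\<close>.\<close>

type_synonym 'n mat2 = "real ^ ('n + 'n) ^ ('n + 'n)"

definition idx_n :: "'n::{finite,linorder} + 'n" where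
  "idx_n = Inl (Max UNIV)"

definition idx_2n :: "'n::{finite,linorder} + 'n" where
  "idx_2n = Inr (Max UNIV)"

definition elem_mat :: "'m::finite \<Rightarrow> 'm \<Rightarrow> real ^ 'm ^ 'm" where
  "elem_mat i j = (\<chi> k l. if k = i \<and> l = j then 1 else 0)"

definition upper_block :: "real ^ 'n ^ 'n \<Rightarrow> real ^ 'n ^ 'n \<Rightarrow> real ^ 'n ^ 'n \<Rightarrow> ('n::finite) mat2" where
  "upper_block g\<^sub>1 b g\<^sub>2 = (\<chi> i j. case i of
       Inl k \<Rightarrow> (case j of Inl l \<Rightarrow> g\<^sub>1 $ k $ l | Inr l \<Rightarrow> b $ k $ l)
     | Inr k \<Rightarrow> (case j of Inl l \<Rightarrow> 0 | Inr l \<Rightarrow> g\<^sub>2 $ k $ l))"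

definition GL :: "(real ^ 'm ^ 'm::finite) set" where
  "GL = {g. invertible g}"

text \<open>\<open>GL(2n - 1)\<close> as the upper left corner of \<open>GL(2n)\<close>.\<close>

definition GL_corner :: "('n::{finite,linorder}) mat2 set" where
  "GL_corner = {h \<in> GL. h $ idx_2n $ idx_2n = 1 \<and>
     (\<forall>i. i \<noteq> idx_2n \<longrightarrow> h $ i $ idx_2n = 0 \<and> h $ idx_2n $ i = 0)}"

definition O_corner :: "('n::{finite,linorder}) mat2 set" where
  "O_corner = {h \<in> GL_corner. orthogonal_matrix h}"

definition signed_power :: "bit \<Rightarrow> complex \<Rightarrow> real \<Rightarrow> complex" where
  "signed_power \<epsilon> \<mu> x = (if \<epsilon> = 0 then 1 else of_real (sgn x)) * of_real \<bar>x\<bar> powr \<mu>"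

definition prin :: "bit \<Rightarrow> bit \<Rightarrow> complex \<Rightarrow> complex \<Rightarrow> (('n::finite) mat2 \<Rightarrow> complex) set" where
  "prin \<xi>\<^sub>1 \<xi>\<^sub>2 \<mu>\<^sub>1 \<mu>\<^sub>2 = {f \<in> Cinf GL. \<forall>g\<in>GL. \<forall>g\<^sub>1\<in>GL. \<forall>g\<^sub>2\<in>GL. \<forall>b.
     f (g ** upper_block g\<^sub>1 b g\<^sub>2) =
       signed_power \<xi>\<^sub>1 (- \<mu>\<^sub>1 - of_nat CARD('n) / 2) (det g\<^sub>1) *
       signed_power \<xi>\<^sub>2 (- \<mu>\<^sub>2 + of_nat CARD('n) / 2) (det g\<^sub>2) * f g}"

definition prin_topology ::
    "bit \<Rightarrow> bit \<Rightarrow> complex \<Rightarrow> complex \<Rightarrow> (('n::finite) mat2 \<Rightarrow> complex) topology" where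
  "prin_topology \<xi>\<^sub>1 \<xi>\<^sub>2 \<mu>\<^sub>1 \<mu>\<^sub>2 = subtopology (Cinf_topology GL) (prin \<xi>\<^sub>1 \<xi>\<^sub>2 \<mu>\<^sub>1 \<mu>\<^sub>2)"

text \<open>The compact picture: the unique element of \<open>prin \<xi>\<^sub>1 \<xi>\<^sub>2 \<mu>\<^sub>1 \<mu>\<^sub>2\<close> with the same
  restriction to \<open>O(2n)\<close> as \<open>f\<close>.\<close>

definition compact_section ::
    "bit \<Rightarrow> bit \<Rightarrow> complex \<Rightarrow> complex \<Rightarrow> (('n::finite) mat2 \<Rightarrow> complex) \<Rightarrow> 'n mat2 \<Rightarrow> complex" where
  "compact_section \<xi>\<^sub>1 \<xi>\<^sub>2 \<mu>\<^sub>1 \<mu>\<^sub>2 f =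
     (THE f'. f' \<in> prin \<xi>\<^sub>1 \<xi>\<^sub>2 \<mu>\<^sub>1 \<mu>\<^sub>2 \<and> (\<forall>k. orthogonal_matrix k \<longrightarrow> f' k = f k))"

definition B_integral ::
    "bit \<Rightarrow> bit \<Rightarrow> complex \<Rightarrow> complex \<Rightarrow> (('n::{finite,linorder}) mat2 \<Rightarrow> complex) \<Rightarrow> 'n mat2 \<Rightarrow> complex" where
  "B_integral \<xi>\<^sub>1 \<eta> \<mu>\<^sub>1 \<nu> f h =
     (LINT t : - {0} | lborel.
        signed_power (\<xi>\<^sub>1 + \<eta>) (\<mu>\<^sub>1 - \<nu> + of_nat CARD('n) / 2) t *
        f (h ** (mat 1 + t *\<^sub>R elem_mat idx_2n idx_n)) / of_real \<bar>t\<bar>)"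

text \<open>Points of \<open>\<complex>\<^sup>2 \<times> \<complex>\<close> are written as \<open>z = (\<lambda>\<^sub>1, \<lambda>\<^sub>2, \<nu>) \<in> \<complex>\<^sup>3\<close>.\<close>

definition conv_domain :: "'n itself \<Rightarrow> (complex ^ 3) set" where
  "conv_domain _ = {z. Re (z $ 1 - z $ 3) > - real CARD('n) / 2 \<and> Re (z $ 3 - z $ 2) > - real CARD('n) / 2}"

definition B_family ::
    "bit \<Rightarrow> bit \<Rightarrow> bit \<Rightarrow> (('n::{finite,linorder}) mat2 \<Rightarrow> complex) \<Rightarrow> 'n mat2 \<Rightarrow> complex ^ 3 \<Rightarrow> complex" where
  "B_family \<xi>\<^sub>1 \<xi>\<^sub>2 \<eta> f h z =
     B_integral \<xi>\<^sub>1 \<eta> (z $ 1) (z $ 3) (compact_section \<xi>\<^sub>1 \<xi>\<^sub>2 (z $ 1) (z $ 2) f) h"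

text \<open>The meromorphically continued operator, applied to \<open>f \<in> prin \<xi>\<^sub>1 \<xi>\<^sub>2 \<mu>\<^sub>1 \<mu>\<^sub>2\<close>. The
  continuation is joint in \<open>(\<lambda>, \<nu>)\<close>, because for given \<open>\<lambda>\<close> there may be no \<open>\<nu>\<close> for which the
  integral converges.\<close>

definition B_op ::
    "bit \<Rightarrow> bit \<Rightarrow> bit \<Rightarrow> complex \<Rightarrow> complex \<Rightarrow> complex \<Rightarrow>
     (('n::{finite,linorder}) mat2 \<Rightarrow> complex) \<Rightarrow> 'n mat2 \<Rightarrow> complex" where
  "B_op \<xi>\<^sub>1 \<xi>\<^sub>2 \<eta> \<mu>\<^sub>1 \<mu>\<^sub>2 \<nu> f h =
     continuation_value (conv_domain TYPE('n)) (B_family \<xi>\<^sub>1 \<xi>\<^sub>2 \<eta> f h) (vector [\<mu>\<^sub>1, \<mu>\<^sub>2, \<nu>])"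

definition B_no_pole ::
    "bit \<Rightarrow> bit \<Rightarrow> bit \<Rightarrow> complex \<Rightarrow> complex \<Rightarrow> complex \<Rightarrow> (('n::{finite,linorder}) mat2 \<Rightarrow> complex) \<Rightarrow> bool" where
  "B_no_pole \<xi>\<^sub>1 \<xi>\<^sub>2 \<eta> \<mu>\<^sub>1 \<mu>\<^sub>2 \<nu> f \<longleftrightarrow>
     (\<forall>h\<in>GL_corner.
        continuation_regular (conv_domain TYPE('n)) (B_family \<xi>\<^sub>1 \<xi>\<^sub>2 \<eta> f h) (vector [\<mu>\<^sub>1, \<mu>\<^sub>2, \<nu>]))"

text \<open>For continuous functions on a compact group the \<open>L\<^sup>\<infinity>\<close> norm is the supremum norm, here
  with value \<open>\<infinity>\<close> for unbounded functions.\<close>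

definition Linf_norm :: "'a set \<Rightarrow> ('a \<Rightarrow> complex) \<Rightarrow> ereal" where
  "Linf_norm A u = (SUP x\<in>A. ereal (norm (u x)))"

end

theory Submission
  imports Defs "HOL-Complex_Analysis.Conformal_Mappings" "HOL-Real_Asymp.Real_Asymp"
begin

text \<open>
  Write \<open>n = CARD('n)\<close>, \<open>a = \<lambda>\<^sub>1 - \<nu> + n/2\<close>, \<open>b = \<nu> - \<lambda>\<^sub>2 + n/2\<close>, and let \<open>k\<^sub>\<theta>\<close> be the rotation by
  \<open>\<theta>\<close> in the plane of the \<open>n\<close>-th and the \<open>2n\<close>-th coordinate. In that plane
  \<open>I + t E\<^sub>2\<^sub>n\<^sub>,\<^sub>n = k\<^sub>\<theta> p\<close> with \<open>t = tan \<theta>\<close> and \<open>p\<close> upper triangular with diagonal entries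
  \<open>1 / cos \<theta>\<close> and \<open>cos \<theta>\<close>. Equivariance under block upper triangular matrices therefore turns
  the defining integral, for orthogonal \<open>h\<close>, into an integral of \<open>\<Phi>(\<theta>) = f(h k\<^sub>\<theta>)\<close> against
  \<open>\<bar>sin \<theta>\<bar>\<close> to the power \<open>a - 1\<close> times \<open>cos \<theta>\<close> to the power \<open>b - 1\<close>, with a sign on the
  negative half (\<open>prin_shear\<close>, \<open>B_family_adapted\<close>). In the compact picture \<open>\<Phi>\<close> does not depend
  on \<open>\<lambda>\<close> and \<open>\<nu>\<close>, so only the beta-type weight carries the parameters.

  Continuation and decay come from one recursion. For \<open>I(a,b)[\<Phi>]\<close>, the integral over the
  positive half, the identity \<open>sin\<^sup>2 + cos\<^sup>2 = 1\<close> and an integration by parts give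
  \<open>a I(a,b)[\<Phi>] = (a+b) I(a+2,b)[\<Phi>] - I(a+1,b+1)[\<Phi>']\<close>, together with its mirror image in \<open>b\<close>
  (\<open>angular_transform_sin_cos\<close>, \<open>angular_transform_by_parts\<close>, \<open>angular_transform_recursion\<close>). The
  arguments on the right are shifted towards the domain of convergence, which continues \<open>I\<close> to
  \<open>\<complex>\<^sup>2\<close> with poles only where \<open>a\<close> or \<open>b\<close> is a nonpositive integer; these are avoided as soon as
  \<open>\<bar>Im \<nu>\<bar>\<close> exceeds \<open>\<bar>Im \<lambda>\<^sub>1\<bar>\<close> and \<open>\<bar>Im \<lambda>\<^sub>2\<bar>\<close>. Since \<open>a + b\<close> does not involve \<open>\<nu>\<close>, every use
  of the recursion also gains a factor \<open>1 / \<bar>Im \<nu>\<bar>\<close>, at the price of one derivative of \<open>\<Phi>\<close>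
  (\<open>angular_continuation_decay\<close>). These derivatives are combinations, with coefficients that are
  polynomial in the matrix entries, of iterated derivatives of \<open>f\<close> on the compact group \<open>O(2n)\<close>,
  hence bounded by a continuous seminorm of \<open>f\<close> (\<open>angular_operator_sequence\<close>,
  \<open>angular_operator_bound\<close>).

  Three further points are needed. The section with prescribed restriction to \<open>O(2n)\<close> has the
  closed form \<open>compact_section_eq\<close>, a product of \<open>f\<close> and complex powers of two positive
  polynomials in the matrix entries. For \<open>h\<close> in \<open>GL(2n-1)\<close> that need not be orthogonal, a column operation
  on \<open>h\<close> makes the extra factor constant along \<open>k\<^sub>\<theta>\<close> (\<open>B_family_reduce_to_adapted\<close>,
  \<open>section_factor_rotation\<close>). Finally, the value of the continued operator is determined by any one
  continuation, by an identity theorem for meromorphic functions of several variables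
  (\<open>continuation_value_eq\<close>).
\<close>

section \<open>Functions of several complex variables\<close>

lemma clinear_cart_iff:
  fixes L :: "complex ^ 'm::finite \<Rightarrow> complex"
  shows "Vector_Spaces.linear (*s) (*) L \<longleftrightarrow>
           (\<forall>x y. L (x + y) = L x + L y) \<and> (\<forall>c x. L (c *s x) = c * L x)"
  using vec.vector_space_axioms vector_space_over_itself.vector_space_axioms
  unfolding Vector_Spaces.linear_iff by blast

lemma scaleC_cart_has_derivative:
  fixes w :: "complex ^ 'm::finite"
  shows "((\<lambda>\<zeta>. v + \<zeta> *s w) has_derivative (\<lambda>h. h *s w)) (at x)"
proof -
  have "bounded_linear (\<lambda>\<zeta>::complex. \<zeta> *s w)"
  proof (rule linear_conv_bounded_linear[THEN iffD1], rule linearI)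
    show "(b1 + b2) *s w = b1 *s w + b2 *s w" for b1 b2 by (rule vector_sadd_rdistrib)
    show "(r *\<^sub>R b) *s w = r *\<^sub>R (b *s w)" for r b by (simp add: vec_eq_iff)
  qed
  then have "((\<lambda>\<zeta>. \<zeta> *s w) has_derivative (\<lambda>h. h *s w)) (at x)"
    by (rule bounded_linear_imp_has_derivative)
  then show ?thesis by (auto intro!: derivative_eq_intros)
qed

lemma holomorphic_several_on_subset:
  "holomorphic_several_on F S \<Longrightarrow> T \<subseteq> S \<Longrightarrow> holomorphic_several_on F T"
  unfolding holomorphic_several_on_def by blast

lemma holomorphic_several_on_cong:
  assumes "holomorphic_several_on F S" "open S" "\<And>z. z \<in> S \<Longrightarrow> G z = F z"
  shows "holomorphic_several_on G S"
  unfolding holomorphic_several_on_def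
proof
  fix z assume z: "z \<in> S"
  then obtain L where L: "Vector_Spaces.linear (*s) (*) L" "(F has_derivative L) (at z)"
    using assms(1) unfolding holomorphic_several_on_def by blast
  have "(G has_derivative L) (at z)"
    using L(2) assms(2) z by (rule has_derivative_transform_within_open) (simp add: assms(3))
  with L(1) show "\<exists>L. Vector_Spaces.linear (*s) (*) L \<and> (G has_derivative L) (at z)" by blast
qed

lemma holomorphic_several_on_const [intro]: "holomorphic_several_on (\<lambda>z. c) S"
  unfolding holomorphic_several_on_def clinear_cart_iff
  by (auto intro!: exI[of _ "\<lambda>_. 0"])

lemma holomorphic_several_on_nth [intro]: "holomorphic_several_on (\<lambda>z. z $ i) S"
  unfolding holomorphic_several_on_def clinear_cart_iff
  by (auto intro!: exI[of _ "\<lambda>z. z $ i"] bounded_linear_imp_has_derivative bounded_linear_vec_nth)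

lemma holomorphic_several_on_add [intro]:
  assumes "holomorphic_several_on F S" "holomorphic_several_on G S"
  shows "holomorphic_several_on (\<lambda>z. F z + G z) S"
  unfolding holomorphic_several_on_def
proof
  fix z assume z: "z \<in> S"
  obtain L where L: "Vector_Spaces.linear (*s) (*) L" "(F has_derivative L) (at z)"
    using assms(1) z unfolding holomorphic_several_on_def by blast
  obtain M where M: "Vector_Spaces.linear (*s) (*) M" "(G has_derivative M) (at z)"
    using assms(2) z unfolding holomorphic_several_on_def by blast
  show "\<exists>L. Vector_Spaces.linear (*s) (*) L \<and> ((\<lambda>z. F z + G z) has_derivative L) (at z)"
    using L M unfolding clinear_cart_iff
    by (intro exI[of _ "\<lambda>h. L h + M h"]) (auto intro!: has_derivative_add simp: algebra_simps)
qed

lemma holomorphic_several_on_mult [intro]: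
  assumes "holomorphic_several_on F S" "holomorphic_several_on G S"
  shows "holomorphic_several_on (\<lambda>z. F z * G z) S"
  unfolding holomorphic_several_on_def
proof
  fix z assume z: "z \<in> S"
  obtain L where L: "Vector_Spaces.linear (*s) (*) L" "(F has_derivative L) (at z)"
    using assms(1) z unfolding holomorphic_several_on_def by blast
  obtain M where M: "Vector_Spaces.linear (*s) (*) M" "(G has_derivative M) (at z)"
    using assms(2) z unfolding holomorphic_several_on_def by blast
  show "\<exists>L. Vector_Spaces.linear (*s) (*) L \<and> ((\<lambda>z. F z * G z) has_derivative L) (at z)"
    using L M unfolding clinear_cart_iff
    by (intro exI[of _ "\<lambda>h. F z * M h + L h * G z"]) (auto intro: has_derivative_mult, auto simp: algebra_simps)
qed

lemma holomorphic_several_on_diff [intro]: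
  assumes "holomorphic_several_on F S" "holomorphic_several_on G S"
  shows "holomorphic_several_on (\<lambda>z. F z - G z) S"
  using holomorphic_several_on_add[OF assms(1) holomorphic_several_on_mult[OF holomorphic_several_on_const[of "-1"] assms(2)]]
  by simp

lemma holomorphic_several_on_compose:
  assumes "holomorphic_several_on F S" "g holomorphic_on T" "open T" "\<And>z. z \<in> S \<Longrightarrow> F z \<in> T"
  shows "holomorphic_several_on (\<lambda>z. g (F z)) S"
  unfolding holomorphic_several_on_def
proof
  fix z assume z: "z \<in> S"
  obtain L where L: "Vector_Spaces.linear (*s) (*) L" "(F has_derivative L) (at z)"
    using assms(1) z unfolding holomorphic_several_on_def by blast
  have "(g has_field_derivative deriv g (F z)) (at (F z))"
    using assms z holomorphic_derivI by blast
  then have "(g has_derivative (*) (deriv g (F z))) (at (F z))"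
    by (simp add: has_field_derivative_def)
  from has_derivative_compose[OF L(2) this]
  have "((\<lambda>z. g (F z)) has_derivative (\<lambda>h. deriv g (F z) * L h)) (at z)" .
  with L(1) show "\<exists>L. Vector_Spaces.linear (*s) (*) L \<and> ((\<lambda>z. g (F z)) has_derivative L) (at z)"
    unfolding clinear_cart_iff by (intro exI[of _ "\<lambda>h. deriv g (F z) * L h"]) (auto simp: algebra_simps)
qed

lemma holomorphic_several_on_exp [intro]:
  "holomorphic_several_on F S \<Longrightarrow> holomorphic_several_on (\<lambda>z. exp (F z)) S"
  by (rule holomorphic_several_on_compose[where T = UNIV]) (auto intro: holomorphic_intros)

lemmas holomorphic_several_intros =
  holomorphic_several_on_const holomorphic_several_on_nth holomorphic_several_on_add
  holomorphic_several_on_diff holomorphic_several_on_mult holomorphic_several_on_exp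

lemma holomorphic_several_on_divide:
  assumes "holomorphic_several_on F S" "holomorphic_several_on G S" "\<And>z. z \<in> S \<Longrightarrow> G z \<noteq> 0"
  shows "holomorphic_several_on (\<lambda>z. F z / G z) S"
proof -
  have "holomorphic_several_on (\<lambda>z. inverse (G z)) S"
    by (rule holomorphic_several_on_compose[OF assms(2), where T = "-{0}"])
       (use assms(3) in \<open>auto intro!: holomorphic_intros\<close>)
  from holomorphic_several_on_mult[OF assms(1) this] show ?thesis by (simp add: divide_inverse)
qed

lemma holomorphic_several_on_continuous:
  "holomorphic_several_on F S \<Longrightarrow> z \<in> S \<Longrightarrow> isCont F z"
  unfolding holomorphic_several_on_def using has_derivative_continuous by blast

lemma holomorphic_several_on_line:
  assumes "holomorphic_several_on F S"
  shows "(\<lambda>\<zeta>. F (v + \<zeta> *s w)) holomorphic_on {\<zeta>. v + \<zeta> *s w \<in> S}"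
  unfolding holomorphic_on_def
proof
  fix \<zeta> assume "\<zeta> \<in> {\<zeta>. v + \<zeta> *s w \<in> S}"
  then obtain L where L: "Vector_Spaces.linear (*s) (*) L" "(F has_derivative L) (at (v + \<zeta> *s w))"
    using assms unfolding holomorphic_several_on_def by blast
  from has_derivative_compose[OF scaleC_cart_has_derivative L(2)]
  have "((\<lambda>\<zeta>. F (v + \<zeta> *s w)) has_derivative (\<lambda>h. L (h *s w))) (at \<zeta>)" .
  moreover have "(\<lambda>h. L (h *s w)) = (*) (L w)"
    using L(1) unfolding clinear_cart_iff by (auto simp: mult.commute)
  ultimately have "((\<lambda>\<zeta>. F (v + \<zeta> *s w)) has_field_derivative L w) (at \<zeta>)"
    by (simp add: has_field_derivative_def)
  then show "(\<lambda>\<zeta>. F (v + \<zeta> *s w)) field_differentiable at \<zeta> within {\<zeta>. v + \<zeta> *s w \<in> S}"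
    using field_differentiable_at_within field_differentiable_def by blast
qed

lemma open_line_preimage:
  fixes v w :: "complex ^ 'm::finite"
  assumes "open S" shows "open {\<zeta>. v + \<zeta> *s w \<in> S}"
proof -
  have "continuous_on UNIV (\<lambda>\<zeta>. v + \<zeta> *s w)"
    by (intro continuous_at_imp_continuous_on ballI has_derivative_continuous[OF scaleC_cart_has_derivative])
  from open_vimage[OF assms this] show ?thesis by (simp add: vimage_def)
qed

text \<open>Every point of \<open>B\<close> lies on a complex line through a point of \<open>W\<close>. The slice of \<open>B\<close> by this
  line is convex, so the identity theorem in one variable applies to it.\<close>

lemma holomorphic_several_zero_on_convex:
  fixes F :: "complex ^ 'm::finite \<Rightarrow> complex"
  assumes F: "holomorphic_several_on F B" and B: "open B" "convex B"
    and W: "open W" "W \<noteq> {}" "W \<subseteq> B" "\<And>z. z \<in> W \<Longrightarrow> F z = 0"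
    and z: "z \<in> B"
  shows "F z = 0"
proof -
  obtain v where v: "v \<in> W" using W(2) by blast
  define w where "w = z - v"
  define A where "A = {\<zeta>. v + \<zeta> *s w \<in> B}"
  define A0 where "A0 = {\<zeta>. v + \<zeta> *s w \<in> W}"
  have open_A: "open A" "open A0" unfolding A_def A0_def using open_line_preimage B W by auto
  have "convex A"
  proof (rule convexI)
    fix x y :: complex and s t :: real
    assume *: "x \<in> A" "y \<in> A" "0 \<le> s" "0 \<le> t" "s + t = 1"
    have "v + (s *\<^sub>R x + t *\<^sub>R y) *s w = s *\<^sub>R (v + x *s w) + t *\<^sub>R (v + y *s w)"
      using \<open>s + t = 1\<close> by (simp add: vec_eq_iff algebra_simps flip: scaleR_add_left)
    also have "\<dots> \<in> B" using * B(2) unfolding A_def by (auto intro: convexD)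
    finally show "s *\<^sub>R x + t *\<^sub>R y \<in> A" by (simp add: A_def)
  qed
  then have conn: "connected A" by (rule convex_connected)
  have 0: "0 \<in> A0" "A0 \<subseteq> A" and 1: "1 \<in> A" using v z W(3) by (auto simp: A_def A0_def w_def)
  have "(0::complex) islimpt A0"
    using open_A(2) 0(1) interior_limit_point[of 0 A0] by (simp add: interior_open)
  have hol: "(\<lambda>\<zeta>. F (v + \<zeta> *s w)) holomorphic_on A"
    unfolding A_def by (rule holomorphic_several_on_line[OF F])
  have zero: "F (v + \<zeta> *s w) = 0" if "\<zeta> \<in> A0" for \<zeta> using that W(4) by (simp add: A0_def)
  have "F (v + 1 *s w) = 0"
    using analytic_continuation[OF hol open_A(1) conn 0(2) subsetD[OF 0(2,1)] \<open>0 islimpt A0\<close> zero 1] .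
  then show ?thesis by (simp add: w_def)
qed

lemma holomorphic_several_zero_on_connected:
  fixes F :: "complex ^ 'm::finite \<Rightarrow> complex"
  assumes F: "holomorphic_several_on F U" and U: "open U" "connected U"
    and W: "open W" "W \<noteq> {}" "W \<subseteq> U" "\<And>z. z \<in> W \<Longrightarrow> F z = 0"
    and z: "z \<in> U"
  shows "F z = 0"
proof -
  define Z where "Z = interior {z \<in> U. F z = 0}"
  have "W \<subseteq> Z" unfolding Z_def by (rule interior_maximal) (use W in auto)
  have "x \<in> Z" if x: "x \<in> U" "x \<in> closure Z" for x
  proof -
    obtain r where r: "r > 0" "ball x r \<subseteq> U" using U(1) x(1) openE by blast
    have op: "open (ball x r \<inter> Z)" unfolding Z_def by (intro open_Int open_ball open_interior)
    have "x \<in> ball x r \<inter> closure Z" using x(2) r(1) by simp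
    then have ne: "ball x r \<inter> Z \<noteq> {}" using open_Int_closure_eq_empty[OF open_ball, of x r Z] by blast
    have Z0: "F y = 0" if "y \<in> Z" for y using that interior_subset[of "{z \<in> U. F z = 0}"] by (auto simp: Z_def)
    have "F y = 0" if "y \<in> ball x r" for y
      by (rule holomorphic_several_zero_on_convex[OF holomorphic_several_on_subset[OF F r(2)]
            open_ball convex_ball op ne _ _ that]) (use Z0 in auto)
    then have "ball x r \<subseteq> {z \<in> U. F z = 0}" using r(2) by blast
    then have "ball x r \<subseteq> Z" unfolding Z_def by (rule interior_maximal) simp
    then show ?thesis using r(1) by auto
  qed
  then have "closedin (top_of_set U) (U \<inter> Z)"
    by (intro closedin_closed[THEN iffD2] exI[of _ "closure Z"]) (use closure_subset in auto)
  moreover have "openin (top_of_set U) (U \<inter> Z)" unfolding Z_def by (auto intro: openin_open_Int)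
  ultimately have "U \<inter> Z = {} \<or> U \<inter> Z = U" using U(2) unfolding connected_clopen by blast
  moreover have "U \<inter> Z \<noteq> {}" using W \<open>W \<subseteq> Z\<close> by blast
  ultimately have "z \<in> Z" using z by blast
  then show ?thesis unfolding Z_def using interior_subset by blast
qed

text \<open>The zero set of a denominator is nowhere dense, in the form in which this is applied below.\<close>

lemma holomorphic_several_nonzero_dense:
  fixes q :: "complex ^ 'm::finite \<Rightarrow> complex"
  assumes "holomorphic_several_on q U" "open U" "connected U" "\<exists>z\<in>U. q z \<noteq> 0"
    and "open W" "W \<noteq> {}" "W \<subseteq> U"
  obtains V where "open V" "V \<noteq> {}" "V \<subseteq> W" "\<And>z. z \<in> V \<Longrightarrow> q z \<noteq> 0"
proof -
  obtain w where w: "w \<in> W" "q w \<noteq> 0"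
    using holomorphic_several_zero_on_connected[OF assms(1-3,5-7)] assms(4) by blast
  have "isCont q w" using assms(1,7) w(1) holomorphic_several_on_continuous by blast
  then obtain e where e: "e > 0" "\<And>y. dist w y < e \<Longrightarrow> q y \<noteq> 0"
    using continuous_at_avoid[of w q 0] w(2) by metis
  show ?thesis
    by (rule that[of "W \<inter> ball w e"]) (use w e assms(5) in auto)
qed

text \<open>The conclusion is agreement on open sets arbitrarily close to any point, rather than agreement
  everywhere, because the values on polar sets are unconstrained. The closure of the interior of
  the coincidence set is shown to be open: locally the two functions are quotients \<open>p\<^sub>1 / q\<^sub>1\<close> and
  \<open>p\<^sub>2 / q\<^sub>2\<close>, and the holomorphic function \<open>p\<^sub>1 q\<^sub>2 - p\<^sub>2 q\<^sub>1\<close> vanishes on a whole ball as soon as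
  it vanishes on an open part of it.\<close>

lemma meromorphic_several_agree_near:
  fixes F G :: "complex ^ 'm::finite \<Rightarrow> complex"
  assumes F: "meromorphic_several F" and G: "meromorphic_several G"
    and D: "open D" "D \<noteq> {}" "\<And>z. z \<in> D \<Longrightarrow> F z = G z"
    and U: "open U" "U \<noteq> {}"
  obtains V where "open V" "V \<noteq> {}" "V \<subseteq> U" "\<And>z. z \<in> V \<Longrightarrow> F z = G z"
proof -
  define S where "S = closure (interior {z. F z = G z})"
  have "x \<in> interior S" if x: "x \<in> S" for x
  proof -
    obtain U1 p1 q1 where 1: "open U1" "connected U1" "x \<in> U1" "holomorphic_several_on p1 U1"
        "holomorphic_several_on q1 U1" "\<exists>z\<in>U1. q1 z \<noteq> 0" "\<And>z. z \<in> U1 \<Longrightarrow> q1 z \<noteq> 0 \<Longrightarrow> F z = p1 z / q1 z"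
      using F unfolding meromorphic_several_def by metis
    obtain U2 p2 q2 where 2: "open U2" "connected U2" "x \<in> U2" "holomorphic_several_on p2 U2"
        "holomorphic_several_on q2 U2" "\<exists>z\<in>U2. q2 z \<noteq> 0" "\<And>z. z \<in> U2 \<Longrightarrow> q2 z \<noteq> 0 \<Longrightarrow> G z = p2 z / q2 z"
      using G unfolding meromorphic_several_def by metis
    have "open (U1 \<inter> U2)" "x \<in> U1 \<inter> U2" using 1 2 by auto
    then obtain r where r: "r > 0" "ball x r \<subseteq> U1 \<inter> U2" using openE by blast
    let ?B = "ball x r"
    let ?h = "\<lambda>z. p1 z * q2 z - p2 z * q1 z"
    have both: "\<exists>V. open V \<and> V \<noteq> {} \<and> V \<subseteq> W \<and> (\<forall>z\<in>V. q1 z \<noteq> 0 \<and> q2 z \<noteq> 0)"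
      if W: "open W" "W \<noteq> {}" "W \<subseteq> ?B" for W
    proof -
      obtain V1 where V1: "open V1" "V1 \<noteq> {}" "V1 \<subseteq> W" "\<And>z. z \<in> V1 \<Longrightarrow> q1 z \<noteq> 0"
        using holomorphic_several_nonzero_dense[OF 1(5,1,2,6) W(1,2)] W(3) r(2) by blast
      obtain V2 where V2: "open V2" "V2 \<noteq> {}" "V2 \<subseteq> V1" "\<And>z. z \<in> V2 \<Longrightarrow> q2 z \<noteq> 0"
        using holomorphic_several_nonzero_dense[OF 2(5,1,2,6) V1(1,2)] V1(3) W(3) r(2) by blast
      show ?thesis using V1 V2 by blast
    qed
    have hol: "holomorphic_several_on ?h ?B"
      using 1(4,5) 2(4,5) r(2) by (auto intro!: holomorphic_several_on_diff holomorphic_several_on_mult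
          elim!: holomorphic_several_on_subset)
    have "x \<in> ?B \<inter> closure (interior {z. F z = G z})" using x r(1) by (simp add: S_def)
    then have "?B \<inter> interior {z. F z = G z} \<noteq> {}"
      using open_Int_closure_eq_empty[OF open_ball, of x r "interior {z. F z = G z}"] by blast
    then obtain V where V: "open V" "V \<noteq> {}" "V \<subseteq> ?B \<inter> interior {z. F z = G z}"
        "\<forall>z\<in>V. q1 z \<noteq> 0 \<and> q2 z \<noteq> 0"
      using both[of "?B \<inter> interior {z. F z = G z}"] by auto
    have "?h z = 0" if z: "z \<in> V" for z
    proof -
      have "F z = G z" using z V(3) interior_subset by blast
      moreover have "F z = p1 z / q1 z" "G z = p2 z / q2 z" "q1 z \<noteq> 0" "q2 z \<noteq> 0"
        using 1(7)[of z] 2(7)[of z] V(3,4) z r(2) by auto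
      ultimately show ?thesis by (simp add: field_simps)
    qed
    then have h0: "?h z = 0" if "z \<in> ?B" for z
      by (intro holomorphic_several_zero_on_convex[OF hol open_ball convex_ball V(1,2) _ _ that])
         (use V(3) in auto)
    have "?B \<subseteq> S"
      unfolding S_def
    proof (rule ccontr)
      assume "\<not> ?B \<subseteq> closure (interior {z. F z = G z})"
      then have "open (?B - closure (interior {z. F z = G z}))" "?B - closure (interior {z. F z = G z}) \<noteq> {}"
        by auto
      then obtain V' where V': "open V'" "V' \<noteq> {}" "V' \<subseteq> ?B - closure (interior {z. F z = G z})"
        "\<forall>z\<in>V'. q1 z \<noteq> 0 \<and> q2 z \<noteq> 0" using both[of "?B - closure (interior {z. F z = G z})"] by auto
      have "F z = G z" if "z \<in> V'" for z
      proof -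
        have "z \<in> ?B" "z \<in> U1" "z \<in> U2" "q1 z \<noteq> 0" "q2 z \<noteq> 0" using that V'(3,4) r(2) by auto
        then have "F z = p1 z / q1 z" "G z = p2 z / q2 z" "p1 z * q2 z = p2 z * q1 z"
          using 1(7) 2(7) h0[of z] by simp_all
        then show ?thesis using \<open>q1 z \<noteq> 0\<close> \<open>q2 z \<noteq> 0\<close> by (simp add: frac_eq_eq)
      qed
      then have "V' \<subseteq> interior {z. F z = G z}" using V'(1) by (intro interior_maximal) auto
      then show False using V'(2,3) closure_subset by blast
    qed
    then show ?thesis using r(1) by (meson centre_in_ball interior_maximal open_ball subsetD)
  qed
  then have "interior S = S" using interior_subset[of S] by blast
  then have "open S" using open_interior[of S] by simp
  moreover have "closed S" unfolding S_def by simp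
  moreover have "D \<subseteq> interior {z. F z = G z}" using D by (intro interior_maximal) auto
  then have "S \<noteq> {}" using D(2) closure_subset unfolding S_def by blast
  ultimately have "S = UNIV" using clopen by blast
  then have "U \<inter> interior {z. F z = G z} \<noteq> {}"
    using open_Int_closure_eq_empty[OF U(1), of "interior {z. F z = G z}"] U(2) unfolding S_def by auto
  moreover have "F z = G z" if "z \<in> interior {z. F z = G z}" for z
    using that interior_subset by blast
  ultimately show ?thesis
    using U(1) by (intro that[of "U \<inter> interior {z. F z = G z}"]) (simp_all add: open_Int)
qed

lemma mero_continuation_at_unique:
  fixes F G :: "complex ^ 'm::finite \<Rightarrow> complex"
  assumes D: "open D" "D \<noteq> {}"
    and F: "mero_continuation_at D F\<^sub>0 a F" and G: "mero_continuation_at D F\<^sub>0 a G"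
  shows "F a = G a"
proof (rule ccontr)
  assume ne: "F a \<noteq> G a"
  have F': "meromorphic_several F" and G': "meromorphic_several G" and FG: "\<And>z. z \<in> D \<Longrightarrow> F z = G z"
    using F G unfolding mero_continuation_at_def by auto
  obtain U1 U2 where "a \<in> U1" "holomorphic_several_on F U1" "a \<in> U2" "holomorphic_several_on G U2"
    using F G unfolding mero_continuation_at_def by auto
  then have "isCont F a" "isCont G a" by (simp_all add: holomorphic_several_on_continuous)
  then have "isCont (\<lambda>z. F z - G z) a" by (rule isCont_diff)
  then obtain e where e: "e > 0" "\<And>y. dist a y < e \<Longrightarrow> F y - G y \<noteq> 0"
    using continuous_at_avoid[of a "\<lambda>z. F z - G z" 0] ne by auto
  obtain V where "V \<noteq> {}" "V \<subseteq> ball a e" "\<And>z. z \<in> V \<Longrightarrow> F z = G z"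
    using meromorphic_several_agree_near[OF F' G' D FG open_ball, of a e] e(1)
    by (metis ball_eq_empty not_le)
  then obtain y where "y \<in> V" "y \<in> ball a e" "F y = G y" by blast
  then show False using e(2)[of y] by simp
qed

lemma continuation_value_eq:
  fixes F :: "complex ^ 'm::finite \<Rightarrow> complex"
  assumes "open D" "D \<noteq> {}" and F: "mero_continuation_at D F\<^sub>0 a F"
  shows "continuation_value D F\<^sub>0 a = F a"
  unfolding continuation_value_def
proof (rule the_equality)
  show "\<exists>G. mero_continuation_at D F\<^sub>0 a G \<and> F a = G a" using F by blast
  fix w assume "\<exists>G. mero_continuation_at D F\<^sub>0 a G \<and> w = G a"
  then show "w = F a" using mero_continuation_at_unique[OF assms(1,2) _ F] by blast
qed

section \<open>The beta kernel on the half-line\<close>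

text \<open>For \<open>t > 0\<close> and \<open>\<theta> = arctan t\<close> this is \<open>ln (sin \<theta>)\<close>, and \<open>ln_cos_arctan\<close> below is \<open>ln (cos \<theta>)\<close>.
  Working with logarithms keeps all complex powers in exponential form.\<close>

definition ln_sin_arctan :: "real \<Rightarrow> real" where
  "ln_sin_arctan t = ln t - ln (1 + t\<^sup>2) / 2"

definition ln_cos_arctan :: "real \<Rightarrow> real" where
  "ln_cos_arctan t = - ln (1 + t\<^sup>2) / 2"

abbreviation "lsin \<equiv> ln_sin_arctan"
abbreviation "lcos \<equiv> ln_cos_arctan"

text \<open>In the angle \<open>\<theta> = arctan t\<close> the measure \<open>beta_kernel a b t dt\<close> has density \<open>sin \<theta>\<close> to the power
  \<open>a - 1\<close> times \<open>cos \<theta>\<close> to the power \<open>b - 1\<close>; the factor \<open>dt / d\<theta> = (cos \<theta>) powi (- 2)\<close> accounts for the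
  exponent \<open>b + 1\<close>.\<close>

definition beta_kernel :: "complex \<Rightarrow> complex \<Rightarrow> real \<Rightarrow> complex" where
  "beta_kernel a b t = exp ((a - 1) * of_real (lsin t) + (b + 1) * of_real (lcos t))"

definition beta_transform :: "(real \<Rightarrow> complex) \<Rightarrow> complex \<Rightarrow> complex \<Rightarrow> complex" where
  "beta_transform \<phi> a b = (LINT t:{0<..}|lborel. beta_kernel a b t * \<phi> t)"

lemma one_plus_sq_pos: "1 + t\<^sup>2 > (0::real)"
  by (simp add: add_pos_nonneg)

lemma exp_lcos: "exp (2 * lcos t) = 1 / (1 + t\<^sup>2)"
  using one_plus_sq_pos[of t] by (simp add: ln_cos_arctan_def exp_minus inverse_eq_divide)

lemma exp_lsin: "t > 0 \<Longrightarrow> exp (2 * lsin t) = t\<^sup>2 / (1 + t\<^sup>2)"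
  using one_plus_sq_pos[of t]
  by (simp add: ln_sin_arctan_def right_diff_distrib exp_diff exp_double power2_eq_square)

lemma exp_lsin_lcos_sum: "t > 0 \<Longrightarrow> exp (2 * lsin t) + exp (2 * lcos t) = 1"
  using one_plus_sq_pos[of t] by (simp add: exp_lsin exp_lcos flip: add_divide_distrib)

lemma lcos_le_0: "lcos t \<le> 0"
  by (simp add: ln_cos_arctan_def)

lemma lsin_le_0: "t > 0 \<Longrightarrow> lsin t \<le> 0"
  using exp_lsin_lcos_sum[of t] by (smt (verit) exp_gt_zero one_less_exp_iff)

lemma lsin_DERIV: "t > 0 \<Longrightarrow> (lsin has_real_derivative exp (3 * lcos t - lsin t)) (at t)"
proof -
  assume t: "t > 0"
  have "exp (3 * lcos t - lsin t) = exp (2 * lcos t) / t"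
  proof -
    have "3 * lcos t - lsin t = 2 * lcos t - ln t"
      by (simp add: ln_cos_arctan_def ln_sin_arctan_def field_simps)
    then have "exp (3 * lcos t - lsin t) = exp (2 * lcos t - ln t)" by (rule arg_cong)
    then show ?thesis using t by (simp add: exp_diff)
  qed
  then have "exp (3 * lcos t - lsin t) = 1 / t - t / (1 + t\<^sup>2)"
    unfolding exp_lcos using t one_plus_sq_pos[of t] by (simp add: field_simps power2_eq_square)
  moreover have "((\<lambda>t. ln t - ln (1 + t\<^sup>2) / 2) has_real_derivative (1 / t - t / (1 + t\<^sup>2))) (at t)"
    using t one_plus_sq_pos[of t] by (auto intro!: derivative_eq_intros simp: divide_simps)
  ultimately show ?thesis by (simp only: ln_sin_arctan_def[abs_def])
qed

lemma lcos_DERIV: "t > 0 \<Longrightarrow> (lcos has_real_derivative - exp (lsin t + lcos t)) (at t)"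
proof -
  assume t: "t > 0"
  have "exp (lsin t + lcos t) = exp (2 * lcos t + ln t)"
    by (simp add: ln_cos_arctan_def ln_sin_arctan_def)
  also have "\<dots> = t / (1 + t\<^sup>2)" using t by (simp add: exp_add exp_lcos)
  finally have "exp (lsin t + lcos t) = t / (1 + t\<^sup>2)" .
  moreover have "((\<lambda>t. - ln (1 + t\<^sup>2) / 2) has_real_derivative - (t / (1 + t\<^sup>2))) (at t)"
    using t one_plus_sq_pos[of t] by (auto intro!: derivative_eq_intros simp: divide_simps)
  ultimately show ?thesis by (simp only: ln_cos_arctan_def[abs_def])
qed

lemma lsin_continuous: "continuous_on {0<..} lsin"
  using lsin_DERIV DERIV_isCont by (auto intro!: continuous_at_imp_continuous_on)

lemma lcos_continuous: "continuous_on {0<..} lcos"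
  using lcos_DERIV DERIV_isCont by (auto intro!: continuous_at_imp_continuous_on)

lemmas lsin_lcos_continuous [continuous_intros] =
  continuous_on_subset[OF lsin_continuous] continuous_on_subset[OF lcos_continuous]

lemma norm_beta_kernel:
  "norm (beta_kernel a b t) = exp ((Re a - 1) * lsin t + (Re b + 1) * lcos t)"
  by (simp add: beta_kernel_def)

lemma beta_kernel_continuous: "continuous_on {0<..} (beta_kernel a b)"
  unfolding beta_kernel_def[abs_def] by (intro continuous_intros) auto

lemma set_borel_measurable_continuous_pos:
  fixes f :: "real \<Rightarrow> 'a::{second_countable_topology,real_normed_vector}"
  assumes "continuous_on {0<..} f"
  shows "set_borel_measurable lborel {0<..} f"
  using borel_measurable_continuous_on_indicator[OF _ assms] unfolding set_borel_measurable_def by simp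

lemma einterval_0_infty: "einterval 0 \<infinity> = {0<..}"
  by (auto simp: einterval_def zero_ereal_def)

text \<open>Since both logarithms are nonpositive, the parameters \<open>x\<close> and \<open>y\<close> may both be lowered to their
  minimum \<open>c\<close>. The resulting kernel is dominated by the derivative of the bounded increasing
  function \<open>sin \<theta> powr c - cos \<theta> powr c\<close>, because
  \<open>(cos \<theta>) powr (2 - c) + (sin \<theta>) powr (2 - c) \<ge> cos\<^sup>2 \<theta> + sin\<^sup>2 \<theta> = 1\<close>.\<close>

lemma real_beta_integrable:
  assumes "x > 0" "y > 0"
  shows "set_integrable lborel {0<..} (\<lambda>t. exp ((x - 1) * lsin t + (y + 1) * lcos t))"
proof -
  define c where "c = min x y"
  have c: "0 < c" "c \<le> x" "c \<le> y" using assms by (auto simp: c_def)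
  define W where "W = (\<lambda>t. exp (c * lsin t) - exp (c * lcos t))"
  define w where "w = (\<lambda>t. c * (exp ((c - 1) * lsin t + 3 * lcos t) + exp (lsin t + (c + 1) * lcos t)))"
  have W_DERIV: "(W has_real_derivative w t) (at t)" if "t > 0" for t
  proof -
    have "(W has_real_derivative (exp (c * lsin t) * (c * exp (3 * lcos t - lsin t))
            - exp (c * lcos t) * (c * - exp (lsin t + lcos t)))) (at t)"
      unfolding W_def
      by (auto intro!: derivative_eq_intros lsin_DERIV lcos_DERIV that)
    also have "exp (c * lsin t) * (c * exp (3 * lcos t - lsin t)) - exp (c * lcos t) * (c * - exp (lsin t + lcos t)) = w t"
      by (simp add: w_def algebra_simps flip: exp_add)
    finally show ?thesis .
  qed
  have w_cont: "continuous_on {0<..} w"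
    unfolding w_def by (intro continuous_intros) auto
  have "set_integrable lborel (einterval 0 \<infinity>) w"
  proof (rule interval_integral_FTC_nonneg(1)[where F = W and A = "-1" and B = 1])
    show "isCont w t" if "0 < ereal t" for t
      using w_cont that by (simp add: continuous_on_eq_continuous_at)
    show "AE t in lborel. 0 < ereal t \<longrightarrow> ereal t < \<infinity> \<longrightarrow> 0 \<le> w t"
      using c by (auto simp: w_def intro!: AE_I2 add_nonneg_nonneg)
    have "(W \<longlongrightarrow> -1) (at_right 0)"
      unfolding W_def ln_sin_arctan_def ln_cos_arctan_def using c(1) by real_asymp
    then show "((W \<circ> real_of_ereal) \<longlongrightarrow> -1) (at_right 0)"
      unfolding zero_ereal_def ereal_tendsto_simps .
    have "(W \<longlongrightarrow> 1) at_top"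
      unfolding W_def ln_sin_arctan_def ln_cos_arctan_def using c(1) by real_asymp
    then show "((W \<circ> real_of_ereal) \<longlongrightarrow> 1) (at_left \<infinity>)"
      unfolding ereal_tendsto_simps .
  qed (auto simp: W_DERIV)
  then have int_w: "set_integrable lborel {0<..} (\<lambda>t. w t / c)"
    by (simp add: einterval_0_infty)
  show ?thesis
  proof (rule set_integrable_bound[OF int_w])
    show "set_borel_measurable lborel {0<..} (\<lambda>t. exp ((x - 1) * lsin t + (y + 1) * lcos t))"
      by (intro set_borel_measurable_continuous_pos continuous_intros) auto
    have "exp ((x - 1) * lsin t + (y + 1) * lcos t) \<le> w t / c" if t: "t > 0" for t
    proof -
      note neg = lcos_le_0[of t] lsin_le_0[OF t]
      have "exp ((x - 1) * lsin t + (y + 1) * lcos t) \<le> exp ((c - 1) * lsin t + (c + 1) * lcos t)"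
        using c neg by (auto intro!: add_mono mult_right_mono_neg)
      also have "\<dots> = exp ((c - 1) * lsin t + (c + 1) * lcos t) * (exp (2 * lcos t) + exp (2 * lsin t))"
        using exp_lsin_lcos_sum[OF t] by simp
      also have "\<dots> \<le> exp ((c - 1) * lsin t + (c + 1) * lcos t) * (exp ((2 - c) * lcos t) + exp ((2 - c) * lsin t))"
        using c neg by (intro mult_left_mono add_mono) (auto intro!: mult_right_mono_neg)
      also have "\<dots> = w t / c"
      proof -
        have "w t / c = exp ((c - 1) * lsin t + 3 * lcos t) + exp (lsin t + (c + 1) * lcos t)"
          using c(1) by (simp add: w_def)
        then show ?thesis by (simp add: algebra_simps flip: exp_add)
      qed
      finally show ?thesis .
    qed
    then show "AE t in lborel. t \<in> {0<..} \<longrightarrow> norm (exp ((x - 1) * lsin t + (y + 1) * lcos t)) \<le> norm (w t / c)"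
      unfolding real_norm_def abs_exp_cancel by (auto intro!: AE_I2 order_trans[OF _ abs_ge_self] simp del: abs_divide)
  qed
qed

lemma beta_integrable_bound:
  fixes g :: "real \<Rightarrow> complex"
  assumes "x > 0" "y > 0" "set_borel_measurable lborel {0<..} g"
    and "\<And>t. t > 0 \<Longrightarrow> norm (g t) \<le> C * exp ((x - 1) * lsin t + (y + 1) * lcos t)"
  shows "set_integrable lborel {0<..} g"
    and "norm (LINT t:{0<..}|lborel. g t)
           \<le> C * (LINT t:{0<..}|lborel. exp ((x - 1) * lsin t + (y + 1) * lcos t))"
proof -
  let ?k = "\<lambda>t. C * exp ((x - 1) * lsin t + (y + 1) * lcos t)"
  have int: "set_integrable lborel {0<..} ?k"
    using real_beta_integrable[OF assms(1,2)] by simp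
  show g: "set_integrable lborel {0<..} g"
    by (rule set_integrable_bound[OF int assms(3)]) (use assms(4) in \<open>fastforce intro!: AE_I2\<close>)
  have "norm (LINT t:{0<..}|lborel. g t) \<le> (LINT t:{0<..}|lborel. norm (g t))"
    by (rule set_integral_norm_bound[OF g])
  also have "\<dots> \<le> (LINT t:{0<..}|lborel. ?k t)"
    by (rule set_integral_mono) (use assms(4) int set_integrable_norm[OF g] in auto)
  finally show "norm (LINT t:{0<..}|lborel. g t)
           \<le> C * (LINT t:{0<..}|lborel. exp ((x - 1) * lsin t + (y + 1) * lcos t))" by simp
qed

lemma beta_transform_integrable:
  assumes "Re a > 0" "Re b > 0" "continuous_on {0<..} \<phi>" "\<And>t. t > 0 \<Longrightarrow> norm (\<phi> t) \<le> M"
  shows "set_integrable lborel {0<..} (\<lambda>t. beta_kernel a b t * \<phi> t)"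
proof (rule beta_integrable_bound(1)[OF assms(1,2)])
  show "set_borel_measurable lborel {0<..} (\<lambda>t. beta_kernel a b t * \<phi> t)"
    by (intro set_borel_measurable_continuous_pos continuous_on_mult beta_kernel_continuous assms(3))
  show "norm (beta_kernel a b t * \<phi> t) \<le> M * exp ((Re a - 1) * lsin t + (Re b + 1) * lcos t)" if "t > 0" for t
    using assms(4)[OF that] by (simp add: norm_mult norm_beta_kernel mult.commute)
qed

lemma norm_exp_minus_linear_le: "norm (exp w - 1 - w) \<le> (norm w)\<^sup>2 * exp (norm w)" for w :: complex
proof -
  have "norm (exp w - (\<Sum>k\<le>1. w ^ k / fact k)) \<le> exp (norm w) * norm w ^ Suc 1 / fact 1"
    by (rule Taylor_exp_field)
  then show ?thesis by (simp add: algebra_simps power2_eq_square)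
qed

lemma square_le_exp: "d > 0 \<Longrightarrow> L \<ge> 0 \<Longrightarrow> L\<^sup>2 \<le> 2 / d\<^sup>2 * exp (d * L)" for d L :: real
proof -
  assume d: "d > 0" and L: "L \<ge> 0"
  have "(d * L)\<^sup>2 / 2 \<le> exp (d * L)"
    using exp_lower_Taylor_quadratic[of "d * L"] d L by (smt (verit) mult_nonneg_nonneg)
  then show ?thesis using d by (simp add: field_simps power_mult_distrib)
qed

text \<open>The parameters enter through \<open>exp\<close> of a linear form \<open>w\<close> in the increment, so the remainder is the
  integral of the kernel against \<open>exp w - 1 - w\<close>. It is quadratic in the increment, as the powers
  of the logarithms are absorbed by lowering both exponents of the kernel by \<open>2 d\<close>.\<close>

lemma beta_transform_has_derivative:
  assumes a: "Re a > 0" and b: "Re b > 0" and cont: "continuous_on {0<..} \<phi>"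
    and bound: "\<And>t. t > 0 \<Longrightarrow> norm (\<phi> t) \<le> M"
  shows "((\<lambda>p. beta_transform \<phi> (fst p) (snd p)) has_derivative
           (\<lambda>h. fst h * (LINT t:{0<..}|lborel. beta_kernel a b t * of_real (lsin t) * \<phi> t)
              + snd h * (LINT t:{0<..}|lborel. beta_kernel a b t * of_real (lcos t) * \<phi> t))) (at (a, b))"
proof -
  define d where "d = min (Re a) (Re b) / 4"
  have d: "d > 0" "Re a - 2 * d > 0" "Re b - 2 * d > 0" using a b by (auto simp: d_def min_def)
  have M: "M \<ge> 0" using order_trans[OF norm_ge_zero bound[of 1]] by simp
  define L where "L t = - (lsin t + lcos t)" for t
  have L: "\<bar>lsin t\<bar> \<le> L t" "\<bar>lcos t\<bar> \<le> L t" "L t \<ge> 0" if "t > 0" for t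
    using lsin_le_0[OF that] lcos_le_0[of t] by (auto simp: L_def)
  define J where "J = (LINT t:{0<..}|lborel. exp ((Re a - 2 * d - 1) * lsin t + (Re b - 2 * d + 1) * lcos t))"
  have kernel_exp: "norm (beta_kernel a b t) * exp (2 * d * L t) = exp ((Re a - 2 * d - 1) * lsin t + (Re b - 2 * d + 1) * lcos t)" for t
    by (simp add: norm_beta_kernel L_def algebra_simps flip: exp_add)
  have meas: "set_borel_measurable lborel {0<..} (\<lambda>t. beta_kernel a b t * f t * \<phi> t)"
    if "continuous_on {0<..} f" for f
    by (intro set_borel_measurable_continuous_pos continuous_on_mult beta_kernel_continuous cont that)
  have int1: "set_integrable lborel {0<..} (\<lambda>t. beta_kernel a b t * of_real (f t) * \<phi> t)"
    if f: "continuous_on {0<..} f" "\<And>t. t > 0 \<Longrightarrow> \<bar>f t\<bar> \<le> L t" for f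
  proof (rule beta_integrable_bound(1)[OF d(2,3)])
    show "set_borel_measurable lborel {0<..} (\<lambda>t. beta_kernel a b t * of_real (f t) * \<phi> t)"
      by (intro meas continuous_intros f)
    fix t :: real assume t: "t > 0"
    have "\<bar>f t\<bar> \<le> exp (2 * d * L t) / (2 * d)"
    proof -
      have "2 * d * L t \<le> exp (2 * d * L t)" using exp_ge_add_one_self[of "2 * d * L t"] by linarith
      then show ?thesis using f(2)[OF t] d(1) by (simp add: field_simps) (smt (verit) mult_left_mono)
    qed
    then have "norm (beta_kernel a b t * of_real (f t) * \<phi> t) \<le> norm (beta_kernel a b t) * (exp (2 * d * L t) / (2 * d)) * M"
      unfolding norm_mult norm_of_real using bound[OF t] M d(1)
      by (intro mult_mono mult_nonneg_nonneg) auto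
    also have "\<dots> = M / (2 * d) * (norm (beta_kernel a b t) * exp (2 * d * L t))" by simp
    finally show "norm (beta_kernel a b t * of_real (f t) * \<phi> t)
      \<le> M / (2 * d) * exp ((Re a - 2 * d - 1) * lsin t + (Re b - 2 * d + 1) * lcos t)"
      unfolding kernel_exp .
  qed
  note int_sin = int1[OF lsin_continuous L(1)] and int_cos = int1[OF lcos_continuous L(2)]
  define A where "A = (LINT t:{0<..}|lborel. beta_kernel a b t * of_real (lsin t) * \<phi> t)"
  define B where "B = (LINT t:{0<..}|lborel. beta_kernel a b t * of_real (lcos t) * \<phi> t)"
  define C where "C = M * (2 / d\<^sup>2) * J"
  let ?F = "\<lambda>p. beta_transform \<phi> (fst p) (snd p)"
  have remainder: "norm (?F p - ?F (a, b) - (fst (p - (a, b)) * A + snd (p - (a, b)) * B)) \<le> C * (norm (p - (a, b)))\<^sup>2"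
    if p: "norm (p - (a, b)) < d" for p
  proof -
    define x where "x = fst (p - (a, b))"
    define y where "y = snd (p - (a, b))"
    define r where "r = norm (p - (a, b))"
    have xy: "norm x \<le> r" "norm y \<le> r" unfolding x_def y_def r_def
      by (metis norm_fst_le prod.collapse, metis norm_snd_le prod.collapse)
    have pxy: "fst p = a + x" "snd p = b + y" by (auto simp: x_def y_def)
    have r: "0 \<le> r" "r < d" using p by (auto simp: r_def)
    have "\<bar>Re x\<bar> < d" "\<bar>Re y\<bar> < d" using xy r abs_Re_le_cmod[of x] abs_Re_le_cmod[of y] by linarith+
    then have pos: "Re (fst p) > 0" "Re (snd p) > 0" using d by (auto simp: pxy)
    define w where "w t = x * of_real (lsin t) + y * of_real (lcos t)" for t
    have kernel_w: "beta_kernel (fst p) (snd p) t = beta_kernel a b t * exp (w t)" for t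
      by (simp add: beta_kernel_def pxy w_def algebra_simps flip: exp_add)
    have "?F p - ?F (a, b) - (x * A + y * B) =
        (LINT t:{0<..}|lborel. beta_kernel (fst p) (snd p) t * \<phi> t - beta_kernel a b t * \<phi> t
          - (x * (beta_kernel a b t * of_real (lsin t) * \<phi> t) + y * (beta_kernel a b t * of_real (lcos t) * \<phi> t)))"
      using beta_transform_integrable[OF pos cont bound] beta_transform_integrable[OF a b cont bound] int_sin int_cos
      by (simp add: set_integral_diff set_integral_add beta_transform_def A_def B_def)
    also have "\<dots> = (LINT t:{0<..}|lborel. beta_kernel a b t * (exp (w t) - 1 - w t) * \<phi> t)"
      by (rule arg_cong[where f = "set_lebesgue_integral lborel {0<..}"])
         (simp add: fun_eq_iff kernel_w w_def algebra_simps)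
    also have "norm \<dots> \<le> (M * (2 / d\<^sup>2) * r\<^sup>2) * J"
      unfolding J_def
    proof (rule beta_integrable_bound(2)[OF d(2,3)])
      show "set_borel_measurable lborel {0<..} (\<lambda>t. beta_kernel a b t * (exp (w t) - 1 - w t) * \<phi> t)"
        unfolding w_def by (intro meas continuous_intros) auto
      fix t :: real assume t: "t > 0"
      have "norm (w t) \<le> norm x * \<bar>lsin t\<bar> + norm y * \<bar>lcos t\<bar>"
        unfolding w_def by (rule norm_triangle_le) (simp add: norm_mult)
      also have "\<dots> \<le> r * \<bar>lsin t\<bar> + r * \<bar>lcos t\<bar>"
        using xy by (intro add_mono mult_right_mono) auto
      also have "\<dots> = r * L t"
        using lsin_le_0[OF t] lcos_le_0[of t] by (simp add: L_def algebra_simps)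
      finally have w: "norm (w t) \<le> r * L t" .
      have "norm (exp (w t) - 1 - w t) \<le> (norm (w t))\<^sup>2 * exp (norm (w t))"
        by (rule norm_exp_minus_linear_le)
      also have "\<dots> \<le> (r * L t)\<^sup>2 * exp (d * L t)"
      proof (intro mult_mono power_mono w)
        have "r * L t \<le> d * L t" using r L(3)[OF t] by (intro mult_right_mono) auto
        then show "exp (norm (w t)) \<le> exp (d * L t)" using w by simp
      qed auto
      also have "\<dots> \<le> r\<^sup>2 * (2 / d\<^sup>2 * exp (d * L t)) * exp (d * L t)"
        unfolding power_mult_distrib using square_le_exp[OF d(1) L(3)[OF t]]
        by (intro mult_right_mono mult_left_mono) auto
      also have "\<dots> = (2 / d\<^sup>2) * r\<^sup>2 * exp (2 * d * L t)"
        by (simp add: mult_ac flip: exp_add)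
      finally have e: "norm (exp (w t) - 1 - w t) \<le> (2 / d\<^sup>2) * r\<^sup>2 * exp (2 * d * L t)" .
      have "norm (beta_kernel a b t * (exp (w t) - 1 - w t) * \<phi> t)
          \<le> norm (beta_kernel a b t) * ((2 / d\<^sup>2) * r\<^sup>2 * exp (2 * d * L t)) * M"
        unfolding norm_mult using e bound[OF t] M by (intro mult_mono mult_nonneg_nonneg) auto
      also have "\<dots> = (M * (2 / d\<^sup>2) * r\<^sup>2) * (norm (beta_kernel a b t) * exp (2 * d * L t))"
        by simp
      finally show "norm (beta_kernel a b t * (exp (w t) - 1 - w t) * \<phi> t)
          \<le> (M * (2 / d\<^sup>2) * r\<^sup>2) * exp ((Re a - 2 * d - 1) * lsin t + (Re b - 2 * d + 1) * lcos t)"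
        unfolding kernel_exp .
    qed
    finally show ?thesis by (simp add: C_def x_def y_def r_def mult_ac)
  qed
  have "(?F has_derivative (\<lambda>h. fst h * A + snd h * B)) (at (a, b))"
  proof (rule has_derivativeI_sandwich[where e = d and H = "\<lambda>p. C * norm (p - (a, b))"])
    show "bounded_linear (\<lambda>h. fst h * A + snd h * B)"
      by (intro bounded_linear_add bounded_linear_mult_left[THEN bounded_linear_compose]
          bounded_linear_fst bounded_linear_snd)
    show "norm (?F p - ?F (a, b) - (fst (p - (a, b)) * A + snd (p - (a, b)) * B)) / norm (p - (a, b))
        \<le> C * norm (p - (a, b))" if "p \<noteq> (a, b)" "dist p (a, b) < d" for p
      using remainder[of p] that by (simp add: dist_norm divide_le_eq power2_eq_square mult_ac)
    have "((\<lambda>p. C * norm (p - (a, b))) \<longlongrightarrow> C * norm ((a, b) - (a, b))) (at (a, b))"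
      by (intro tendsto_intros)
    then show "((\<lambda>p. C * norm (p - (a, b))) \<longlongrightarrow> 0) (at (a, b))" by simp
  qed (use d in auto)
  then show ?thesis unfolding A_def B_def .
qed

lemma beta_transform_holomorphic:
  assumes "holomorphic_several_on a S" "holomorphic_several_on b S"
    and "\<And>z. z \<in> S \<Longrightarrow> Re (a z) > 0" "\<And>z. z \<in> S \<Longrightarrow> Re (b z) > 0"
    and "continuous_on {0<..} \<phi>" "\<And>t. t > 0 \<Longrightarrow> norm (\<phi> t) \<le> M"
  shows "holomorphic_several_on (\<lambda>z. beta_transform \<phi> (a z) (b z)) S"
  unfolding holomorphic_several_on_def
proof
  fix z assume z: "z \<in> S"
  obtain L where L: "Vector_Spaces.linear (*s) (*) L" "(a has_derivative L) (at z)"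
    using assms(1) z unfolding holomorphic_several_on_def by blast
  obtain L' where L': "Vector_Spaces.linear (*s) (*) L'" "(b has_derivative L') (at z)"
    using assms(2) z unfolding holomorphic_several_on_def by blast
  obtain A B where AB: "((\<lambda>p. beta_transform \<phi> (fst p) (snd p)) has_derivative (\<lambda>h. fst h * A + snd h * B)) (at (a z, b z))"
    using beta_transform_has_derivative[OF assms(3,4)[OF z] assms(5,6)] by blast
  have "((\<lambda>z. (a z, b z)) has_derivative (\<lambda>h. (L h, L' h))) (at z)"
    by (rule has_derivative_Pair[OF L(2) L'(2)])
  from has_derivative_compose[OF this AB]
  have "((\<lambda>z. beta_transform \<phi> (a z) (b z)) has_derivative (\<lambda>h. L h * A + L' h * B)) (at z)" by simp
  moreover have "Vector_Spaces.linear (*s) (*) (\<lambda>h. L h * A + L' h * B)"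
    using L(1) L'(1) unfolding clinear_cart_iff by (simp add: algebra_simps)
  ultimately show "\<exists>L. Vector_Spaces.linear (*s) (*) L \<and> ((\<lambda>z. beta_transform \<phi> (a z) (b z)) has_derivative L) (at z)"
    by blast
qed

section \<open>Angular transforms: recursion, continuation and decay\<close>

text \<open>The successive derivatives of one smooth function of the angle. Carrying them as a sequence lets
  the recursion below refer to \<open>\<Phi> (Suc j)\<close> instead of to iterated derivatives.\<close>

definition derivative_sequence :: "(nat \<Rightarrow> real \<Rightarrow> complex) \<Rightarrow> bool" where
  "derivative_sequence \<Phi> \<longleftrightarrow> (\<forall>j \<theta>. (\<Phi> j has_vector_derivative \<Phi> (Suc j) \<theta>) (at \<theta>))"

abbreviation angular_transform :: "(nat \<Rightarrow> real \<Rightarrow> complex) \<Rightarrow> nat \<Rightarrow> complex \<Rightarrow> complex \<Rightarrow> complex" where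
  "angular_transform \<Phi> j \<equiv> beta_transform (\<lambda>t. \<Phi> j (arctan t))"

lemma derivative_sequence_continuous:
  assumes "derivative_sequence \<Phi>" shows "continuous_on S (\<Phi> j)"
  using assms unfolding derivative_sequence_def
  by (intro continuous_at_imp_continuous_on ballI) (blast intro: has_vector_derivative_continuous)

lemma derivative_sequence_arctan_continuous:
  assumes "derivative_sequence \<Phi>" shows "continuous_on S (\<lambda>t. \<Phi> j (arctan t))"
  by (rule continuous_on_compose2[OF derivative_sequence_continuous[OF assms, of UNIV]])
     (auto intro!: continuous_intros)

lemma derivative_sequence_arctan_bounded:
  assumes "derivative_sequence \<Phi>" obtains M where "\<And>t. norm (\<Phi> j (arctan t)) \<le> M"
proof -
  have "compact (\<Phi> j ` {- (pi / 2)..pi / 2})"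
    by (intro compact_continuous_image derivative_sequence_continuous assms) simp
  then obtain M where "\<And>x. x \<in> \<Phi> j ` {- (pi / 2)..pi / 2} \<Longrightarrow> norm x \<le> M"
    using compact_imp_bounded bounded_iff by metis
  then have "norm (\<Phi> j (arctan t)) \<le> M" for t
    using arctan_bounded[of t] by simp
  then show ?thesis by (rule that)
qed

lemma angular_transform_integrable:
  assumes "derivative_sequence \<Phi>" "Re a > 0" "Re b > 0"
  shows "set_integrable lborel {0<..} (\<lambda>t. beta_kernel a b t * \<Phi> j (arctan t))"
proof -
  obtain M where "\<And>t. norm (\<Phi> j (arctan t)) \<le> M"
    using derivative_sequence_arctan_bounded[OF assms(1)] by metis
  then show ?thesis
    by (intro beta_transform_integrable[where M = M] assms derivative_sequence_arctan_continuous)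
qed

lemma angular_transform_sin_cos:
  assumes "derivative_sequence \<Phi>" "Re a > 0" "Re b > 0"
  shows "angular_transform \<Phi> j a b = angular_transform \<Phi> j (a + 2) b + angular_transform \<Phi> j a (b + 2)"
proof -
  have "beta_kernel a b t = beta_kernel (a + 2) b t + beta_kernel a (b + 2) t" if t: "t > 0" for t
  proof -
    have "beta_kernel (a + 2) b t + beta_kernel a (b + 2) t =
        beta_kernel a b t * of_real (exp (2 * lsin t) + exp (2 * lcos t))"
      by (simp add: beta_kernel_def exp_of_real[symmetric] algebra_simps flip: exp_add)
    then show ?thesis using exp_lsin_lcos_sum[OF t] by simp
  qed
  then have "angular_transform \<Phi> j a b =
      (LINT t:{0<..}|lborel. beta_kernel (a + 2) b t * \<Phi> j (arctan t) + beta_kernel a (b + 2) t * \<Phi> j (arctan t))"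
    unfolding beta_transform_def by (intro set_lebesgue_integral_cong) (auto simp: algebra_simps)
  also have "\<dots> = angular_transform \<Phi> j (a + 2) b + angular_transform \<Phi> j a (b + 2)"
    unfolding beta_transform_def
    by (intro set_integral_add(2) angular_transform_integrable) (use assms in auto)
  finally show ?thesis .
qed

text \<open>The boundary terms of the antiderivative \<open>F\<close>, which is \<open>sin \<theta>\<close> to the power \<open>a\<close> times \<open>cos \<theta>\<close> to the
  power \<open>b\<close> times \<open>\<Phi> j \<theta>\<close>, vanish at both ends.\<close>

lemma angular_transform_by_parts:
  assumes \<Phi>: "derivative_sequence \<Phi>" and a: "Re a > 0" and b: "Re b > 0"
  shows "a * angular_transform \<Phi> j a (b + 2) - b * angular_transform \<Phi> j (a + 2) b
           + angular_transform \<Phi> (Suc j) (a + 1) (b + 1) = 0"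
proof -
  define \<phi> where "\<phi> t = \<Phi> j (arctan t)" for t
  define \<phi>' where "\<phi>' t = \<Phi> (Suc j) (arctan t)" for t
  define E where "E t = exp (a * of_real (lsin t) + b * of_real (lcos t))" for t
  define F where "F t = E t * \<phi> t" for t
  define f where "f t = a * (beta_kernel a (b + 2) t * \<phi> t) - b * (beta_kernel (a + 2) b t * \<phi> t)
                         + beta_kernel (a + 1) (b + 1) t * \<phi>' t" for t
  have F_deriv: "(F has_vector_derivative f t) (at t)" if t: "t > 0" for t
  proof -
    have \<phi>_deriv: "(\<phi> has_vector_derivative exp (2 * lcos t) *\<^sub>R \<phi>' t) (at t)"
    proof -
      have "(arctan has_vector_derivative exp (2 * lcos t)) (at t)"
        unfolding exp_lcos by (auto intro!: derivative_eq_intros simp: has_real_derivative_iff_has_vector_derivative[symmetric] inverse_eq_divide)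
      moreover have "(\<Phi> j has_vector_derivative \<phi>' t) (at (arctan t))"
        using \<Phi> unfolding derivative_sequence_def \<phi>'_def by blast
      ultimately show ?thesis
        using vector_diff_chain_at[of arctan "exp (2 * lcos t)" t "\<Phi> j" "\<phi>' t"]
        unfolding \<phi>_def o_def by blast
    qed
    have "((\<lambda>t. a * of_real (lsin t) + b * of_real (lcos t)) has_vector_derivative
        a * of_real (exp (3 * lcos t - lsin t)) + b * of_real (- exp (lsin t + lcos t))) (at t)"
      using lsin_DERIV[OF t] lcos_DERIV[OF t]
      by (intro has_vector_derivative_add has_vector_derivative_mult_right has_vector_derivative_of_real)
         (auto simp: has_real_derivative_iff_has_vector_derivative)
    from field_vector_diff_chain_at[OF this DERIV_exp]
    have "(E has_vector_derivative (a * of_real (exp (3 * lcos t - lsin t)) + b * of_real (- exp (lsin t + lcos t))) * E t) (at t)"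
      unfolding E_def o_def .
    from has_vector_derivative_mult[OF this \<phi>_deriv]
    have "(F has_vector_derivative (E t * (exp (2 * lcos t) *\<^sub>R \<phi>' t)
      + (a * of_real (exp (3 * lcos t - lsin t)) + b * of_real (- exp (lsin t + lcos t))) * E t * \<phi> t)) (at t)"
      unfolding F_def .
    also have "E t * (exp (2 * lcos t) *\<^sub>R \<phi>' t)
      + (a * of_real (exp (3 * lcos t - lsin t)) + b * of_real (- exp (lsin t + lcos t))) * E t * \<phi> t = f t"
      unfolding f_def E_def beta_kernel_def scaleR_conv_of_real
      by (simp add: exp_of_real[symmetric] algebra_simps flip: exp_add)
    finally show ?thesis .
  qed
  obtain M where M: "\<And>t. norm (\<phi> t) \<le> M"
    using derivative_sequence_arctan_bounded[OF \<Phi>] unfolding \<phi>_def by metis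
  have F_bound: "norm (F t) \<le> exp (Re a * lsin t + Re b * lcos t) * M" for t
    unfolding F_def E_def norm_mult using M[of t] by (auto intro!: mult_mono)
  have "((\<lambda>t. exp (Re a * lsin t + Re b * lcos t) * M) \<longlongrightarrow> 0) (at_right 0)"
    unfolding ln_sin_arctan_def ln_cos_arctan_def using a b by real_asymp
  then have lim0: "(F \<longlongrightarrow> 0) (at_right 0)"
    by (rule Lim_null_comparison[rotated]) (use F_bound in auto)
  have "((\<lambda>t. exp (Re a * lsin t + Re b * lcos t) * M) \<longlongrightarrow> 0) at_top"
    unfolding ln_sin_arctan_def ln_cos_arctan_def using a b by real_asymp
  then have lim1: "(F \<longlongrightarrow> 0) at_top"
    by (rule Lim_null_comparison[rotated]) (use F_bound in auto)
  have ints: "set_integrable lborel {0<..} (\<lambda>t. beta_kernel a (b + 2) t * \<phi> t)"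
    "set_integrable lborel {0<..} (\<lambda>t. beta_kernel (a + 2) b t * \<phi> t)"
    "set_integrable lborel {0<..} (\<lambda>t. beta_kernel (a + 1) (b + 1) t * \<phi>' t)"
    unfolding \<phi>_def \<phi>'_def by (intro angular_transform_integrable \<Phi>; use a b in simp)+
  have f_int: "set_integrable lborel {0<..} f"
    unfolding f_def by (intro set_integral_add(1) set_integral_diff(1) set_integrable_mult_right ints)
  have f_cont: "continuous_on {0<..} f"
    unfolding f_def \<phi>_def \<phi>'_def
    by (intro continuous_intros beta_kernel_continuous derivative_sequence_arctan_continuous \<Phi>)
  have "(LBINT t=0..\<infinity>. f t) = 0 - 0"
  proof (rule interval_integral_FTC_integrable[where F = F])
    show "isCont f t" if "0 < ereal t" for t
      using f_cont that by (simp add: continuous_on_eq_continuous_at)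
    show "set_integrable lborel (einterval 0 \<infinity>) f" using f_int by (simp add: einterval_0_infty)
    show "((F \<circ> real_of_ereal) \<longlongrightarrow> 0) (at_right 0)"
      using lim0 unfolding zero_ereal_def ereal_tendsto_simps .
    show "((F \<circ> real_of_ereal) \<longlongrightarrow> 0) (at_left \<infinity>)"
      using lim1 unfolding ereal_tendsto_simps .
  qed (auto simp: F_deriv)
  then have "(LINT t:{0<..}|lborel. f t) = 0"
    by (simp add: interval_lebesgue_integral_def einterval_0_infty)
  moreover have "(LINT t:{0<..}|lborel. f t) =
      a * angular_transform \<Phi> j a (b + 2) - b * angular_transform \<Phi> j (a + 2) b
        + angular_transform \<Phi> (Suc j) (a + 1) (b + 1)"
    unfolding f_def beta_transform_def \<phi>_def[symmetric] \<phi>'_def[symmetric]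
    using ints by (simp add: set_integral_add(2) set_integral_diff(2) set_integral_diff(1))
  ultimately show ?thesis by simp
qed

text \<open>Combining the two previous identities expresses \<open>a\<close> times the transform by transforms with larger
  arguments, and likewise for \<open>b\<close>. Using the first at \<open>(a, b)\<close> and the second at \<open>(a + 2, b)\<close>
  raises both arguments of every term by at least one.\<close>

lemma angular_transform_recursion:
  assumes \<Phi>: "derivative_sequence \<Phi>" and a: "Re a > 0" and b: "Re b > 0"
  shows "a * b * angular_transform \<Phi> j a b =
           (a + b) * (a + b + 2) * angular_transform \<Phi> j (a + 2) (b + 2)
         + (a + b) * angular_transform \<Phi> (Suc j) (a + 3) (b + 1)
         - b * angular_transform \<Phi> (Suc j) (a + 1) (b + 1)"
proof -
  let ?I = "angular_transform \<Phi>"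
  have 1: "a * ?I j a b = (a + b) * ?I j (a + 2) b - ?I (Suc j) (a + 1) (b + 1)"
    using angular_transform_sin_cos[OF assms, of j] angular_transform_by_parts[OF assms, of j]
    by (simp add: algebra_simps)
  have 2: "b * ?I j (a + 2) b = (a + b + 2) * ?I j (a + 2) (b + 2) + ?I (Suc j) (a + 3) (b + 1)"
    using angular_transform_sin_cos[OF \<Phi> _ b, of "a + 2" j] angular_transform_by_parts[OF \<Phi> _ b, of "a + 2" j] a
    by (simp add: algebra_simps)
  have "a * b * ?I j a b = b * (a * ?I j a b)" by simp
  also have "\<dots> = (a + b) * (b * ?I j (a + 2) b) - b * ?I (Suc j) (a + 1) (b + 1)"
    unfolding 1 by (simp add: algebra_simps)
  also have "\<dots> = (a + b) * (a + b + 2) * ?I j (a + 2) (b + 2) + (a + b) * ?I (Suc j) (a + 3) (b + 1)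
         - b * ?I (Suc j) (a + 1) (b + 1)"
    unfolding 2 by (simp add: algebra_simps)
  finally show ?thesis .
qed

text \<open>Level \<open>m\<close> is meaningful for real parts greater than \<open>- m\<close>. The recursion reads off
  \<open>angular_transform_recursion\<close>. At a pole all positive levels involve the same division by
  zero, so that consecutive levels agree there as well.\<close>

primrec angular_continuation ::
    "(nat \<Rightarrow> real \<Rightarrow> complex) \<Rightarrow> nat \<Rightarrow> nat \<Rightarrow> complex \<Rightarrow> complex \<Rightarrow> complex" where
  "angular_continuation \<Phi> 0 = angular_transform \<Phi>"
| "angular_continuation \<Phi> (Suc m) = (\<lambda>j a b.
     ((a + b) * (a + b + 2) * angular_continuation \<Phi> m j (a + 2) (b + 2)
       + (a + b) * angular_continuation \<Phi> m (Suc j) (a + 3) (b + 1)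
       - b * angular_continuation \<Phi> m (Suc j) (a + 1) (b + 1)) / (a * b))"

lemma angular_continuation_Suc:
  assumes \<Phi>: "derivative_sequence \<Phi>"
  shows "Re a > - real m \<Longrightarrow> Re b > - real m \<Longrightarrow>
    angular_continuation \<Phi> (Suc m) j a b = angular_continuation \<Phi> m j a b"
proof (induction m arbitrary: j a b)
  case 0
  then have "a \<noteq> 0" "b \<noteq> 0" by auto
  then show ?case using angular_transform_recursion[OF \<Phi>, of a b j] 0 by (simp add: field_simps)
next
  case (Suc m)
  have "angular_continuation \<Phi> (Suc m) j (a + 2) (b + 2) = angular_continuation \<Phi> m j (a + 2) (b + 2)"
    "angular_continuation \<Phi> (Suc m) (Suc j) (a + 3) (b + 1) = angular_continuation \<Phi> m (Suc j) (a + 3) (b + 1)"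
    "angular_continuation \<Phi> (Suc m) (Suc j) (a + 1) (b + 1) = angular_continuation \<Phi> m (Suc j) (a + 1) (b + 1)"
    by (rule Suc.IH; use Suc.prems in simp)+
  then show ?case by (simp only: angular_continuation.simps(2))
qed

lemma angular_continuation_mono:
  assumes \<Phi>: "derivative_sequence \<Phi>" and "m \<le> m'" "Re a > - real m" "Re b > - real m"
  shows "angular_continuation \<Phi> m' j a b = angular_continuation \<Phi> m j a b"
  using assms(2)
proof (induction m' rule: dec_induct)
  case (step k)
  then show ?case using angular_continuation_Suc[OF \<Phi>, of k a b j] assms(3,4) by simp
qed simp

lemma angular_transform_bound:
  assumes "derivative_sequence \<Phi>" "Re a \<ge> 1" "Re b \<ge> 1" "\<And>\<theta>. norm (\<Phi> j \<theta>) \<le> M"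
  shows "norm (angular_transform \<Phi> j a b) \<le> M * (LINT t:{0<..}|lborel. exp (2 * lcos t))"
proof -
  have M: "M \<ge> 0" using order_trans[OF norm_ge_zero assms(4)] .
  have "norm (angular_transform \<Phi> j a b)
      \<le> M * (LINT t:{0<..}|lborel. exp ((1 - 1) * lsin t + (1 + 1) * lcos t))"
    unfolding beta_transform_def
  proof (rule beta_integrable_bound(2))
    show "set_borel_measurable lborel {0<..} (\<lambda>t. beta_kernel a b t * \<Phi> j (arctan t))"
      by (intro set_borel_measurable_continuous_pos continuous_on_mult beta_kernel_continuous
          derivative_sequence_arctan_continuous assms)
    fix t :: real assume t: "t > 0"
    have "norm (beta_kernel a b t) \<le> exp ((1 - 1) * lsin t + (1 + 1) * lcos t)"
    proof -
      have "(Re a - 1) * lsin t \<le> 0" using lsin_le_0[OF t] assms(2) by (simp add: mult_nonneg_nonpos)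
      moreover have "(Re b + 1) * lcos t \<le> 2 * lcos t"
        using lcos_le_0[of t] assms(3) by (intro mult_right_mono_neg) auto
      ultimately show ?thesis unfolding norm_beta_kernel by simp
    qed
    then show "norm (beta_kernel a b t * \<Phi> j (arctan t)) \<le> M * exp ((1 - 1) * lsin t + (1 + 1) * lcos t)"
      unfolding norm_mult mult.commute[of M] using assms(4) by (intro mult_mono) auto
  qed simp_all
  then show ?thesis by simp
qed

definition uniform_decay :: "real \<Rightarrow> real \<Rightarrow> nat \<Rightarrow> bool" where
  "uniform_decay S C m \<longleftrightarrow> (\<forall>\<Phi> M j a b y. derivative_sequence \<Phi> \<longrightarrow> (\<forall>i\<le>j + m. \<forall>\<theta>. norm (\<Phi> i \<theta>) \<le> M) \<longrightarrow>
     Re a \<ge> 1 - real m \<longrightarrow> Re b \<ge> 1 - real m \<longrightarrow> norm (a + b) \<le> S \<longrightarrow>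
     y \<ge> 1 \<longrightarrow> \<bar>Im a\<bar> \<ge> y \<longrightarrow> \<bar>Im b\<bar> \<ge> y \<longrightarrow>
     norm (angular_continuation \<Phi> m j a b) \<le> C * M / y ^ m)"

lemma uniform_decayD:
  "uniform_decay S C m \<Longrightarrow> derivative_sequence \<Phi> \<Longrightarrow> (\<And>i \<theta>. i \<le> j + m \<Longrightarrow> norm (\<Phi> i \<theta>) \<le> M) \<Longrightarrow>
     Re a \<ge> 1 - real m \<Longrightarrow> Re b \<ge> 1 - real m \<Longrightarrow> norm (a + b) \<le> S \<Longrightarrow>
     y \<ge> 1 \<Longrightarrow> \<bar>Im a\<bar> \<ge> y \<Longrightarrow> \<bar>Im b\<bar> \<ge> y \<Longrightarrow>
     norm (angular_continuation \<Phi> m j a b) \<le> C * M / y ^ m"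
  unfolding uniform_decay_def by blast

text \<open>In the recursion the sum \<open>a + b\<close> stays bounded, so each term carries at least one factor
  \<open>1 / a\<close> or \<open>1 / b\<close> that is not compensated. The bound on \<open>a + b\<close> has to be general in the induction, since
  the shifts increase this sum by up to \<open>4\<close>.\<close>

lemma angular_continuation_decay:
  fixes S :: real
  assumes "S \<ge> 0"
  shows "\<exists>C\<ge>0. uniform_decay S C m"
  using assms
proof (induction m arbitrary: S)
  case 0
  define C where "C = (LINT t:{0<..}|lborel. exp (2 * lcos t))"
  have "C \<ge> 0" unfolding C_def set_lebesgue_integral_def by (rule Bochner_Integration.integral_nonneg) auto
  moreover have "norm (angular_transform \<Phi> j a b) \<le> C * M"
    if "derivative_sequence \<Phi>" "\<forall>\<theta>. norm (\<Phi> j \<theta>) \<le> M" "Re a \<ge> 1" "Re b \<ge> 1" for \<Phi> M j a b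
    using angular_transform_bound[OF that(1,3,4)] that(2) unfolding C_def by (simp add: mult.commute)
  ultimately show ?case unfolding uniform_decay_def by (intro exI[of _ C]) auto
next
  case (Suc m)
  obtain C where C: "C \<ge> 0" "uniform_decay (S + 4) C m"
    using Suc.IH[of "S + 4"] Suc.prems by auto
  define C' where "C' = (S * (S + 2) + S + 1) * C"
  have "C' \<ge> 0" using C Suc.prems by (simp add: C'_def)
  moreover have "norm (angular_continuation \<Phi> (Suc m) j a b) \<le> C' * M / y ^ Suc m"
    if \<Phi>: "derivative_sequence \<Phi>" and M: "\<forall>i\<le>j + Suc m. \<forall>\<theta>. norm (\<Phi> i \<theta>) \<le> M"
      and a: "Re a \<ge> 1 - real (Suc m)" and b: "Re b \<ge> 1 - real (Suc m)"
      and s: "norm (a + b) \<le> S" and y: "y \<ge> 1" "\<bar>Im a\<bar> \<ge> y" "\<bar>Im b\<bar> \<ge> y" for \<Phi> M j a b y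
  proof -
    define D where "D = C * M / y ^ m"
    have M0: "M \<ge> 0" using M norm_ge_zero order_trans by blast
    have D: "D \<ge> 0" using C(1) M0 y(1) by (simp add: D_def)
    have S0: "S * (S + 2) \<ge> 0" using Suc.prems by simp
    have s4: "norm (a + b + 4) \<le> S + 4" "norm (a + b + 2) \<le> S + 4" "norm (a + b + 2) \<le> S + 2"
      using s norm_triangle_ineq[of "a + b" 4] norm_triangle_ineq[of "a + b" 2] by simp_all
    have e: "(a + 2) + (b + 2) = a + b + 4" "(a + 3) + (b + 1) = a + b + 4" "(a + 1) + (b + 1) = a + b + 2"
      by simp_all
    have 1: "norm (angular_continuation \<Phi> m j (a + 2) (b + 2)) \<le> D"
      unfolding D_def by (rule uniform_decayD[OF C(2) \<Phi>]; (unfold e)?; use a b y M s4 in simp)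
    have 2: "norm (angular_continuation \<Phi> m (Suc j) (a + 3) (b + 1)) \<le> D"
      unfolding D_def by (rule uniform_decayD[OF C(2) \<Phi>]; (unfold e)?; use a b y M s4 in simp)
    have 3: "norm (angular_continuation \<Phi> m (Suc j) (a + 1) (b + 1)) \<le> D"
      unfolding D_def by (rule uniform_decayD[OF C(2) \<Phi>]; (unfold e)?; use a b y M s4 in simp)
    have ya: "norm a \<ge> y" "norm b \<ge> y" using y abs_Im_le_cmod[of a] abs_Im_le_cmod[of b] by linarith+
    have pos: "norm a > 0" "norm b > 0" "y > 0" using ya y(1) by linarith+
    have "norm ((a + b) * (a + b + 2) * angular_continuation \<Phi> m j (a + 2) (b + 2)
       + (a + b) * angular_continuation \<Phi> m (Suc j) (a + 3) (b + 1)
       - b * angular_continuation \<Phi> m (Suc j) (a + 1) (b + 1))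
       \<le> S * (S + 2) * D + S * D + norm b * D"
      by (intro order_trans[OF norm_triangle_ineq4] order_trans[OF norm_triangle_ineq] add_mono)
         (auto simp: norm_mult intro!: mult_mono 1 2 3 s s4 D Suc.prems S0)
    also have "\<dots> \<le> (S * (S + 2) * D + S * D) * norm b + norm b * D"
      using mult_left_mono[of 1 "norm b" "S * (S + 2) * D + S * D"] y(1) ya(2) D Suc.prems by simp
    also have "\<dots> = C' * M / y ^ m * norm b"
      by (simp add: C'_def D_def algebra_simps add_divide_distrib)
    finally have "norm (angular_continuation \<Phi> (Suc m) j a b) \<le> C' * M / y ^ m * norm b / (norm a * norm b)"
      unfolding angular_continuation.simps(2) norm_divide norm_mult[of a b]
      by (rule divide_right_mono) simp
    also have "\<dots> = C' * M / y ^ m / norm a" using pos by simp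
    also have "\<dots> \<le> C' * M / y ^ m / y"
      using \<open>C' \<ge> 0\<close> M0 pos ya by (intro divide_left_mono) auto
    also have "\<dots> = C' * M / y ^ Suc m" by simp
    finally show ?thesis .
  qed
  ultimately show ?case unfolding uniform_decay_def by (intro exI[of _ C']) simp
qed

lemma nonpos_Ints_add_nat_cancel:
  "a + of_nat k \<in> \<int>\<^sub>\<le>\<^sub>0 \<Longrightarrow> a \<in> \<int>\<^sub>\<le>\<^sub>0" for a :: complex
  using nonpos_Ints_diff_Nats[of "a + of_nat k" "of_nat k"] by simp

text \<open>The zeros of the denominator are recorded because, on a domain that contains points where neither
  \<open>a\<close> nor \<open>b\<close> is a nonpositive integer, this shows that it does not vanish identically.\<close>

definition quotient_off_poles ::
    "(complex ^ 'm \<Rightarrow> complex) \<Rightarrow> (complex ^ 'm \<Rightarrow> complex) \<Rightarrow> (complex ^ 'm::finite) set \<Rightarrow>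
     (complex ^ 'm \<Rightarrow> complex) \<Rightarrow> bool" where
  "quotient_off_poles a b U F \<longleftrightarrow> (\<exists>p q. holomorphic_several_on p U \<and> holomorphic_several_on q U \<and>
      (\<forall>z\<in>U. q z = 0 \<longrightarrow> a z \<in> \<int>\<^sub>\<le>\<^sub>0 \<or> b z \<in> \<int>\<^sub>\<le>\<^sub>0) \<and>
      (\<forall>z\<in>U. q z \<noteq> 0 \<longrightarrow> F z = p z / q z))"

text \<open>The denominators produced by the recursion are products of shifted \<open>a\<close> and \<open>b\<close>.\<close>

lemma angular_continuation_quotient:
  fixes a b :: "complex ^ 'm::finite \<Rightarrow> complex"
  assumes \<Phi>: "derivative_sequence \<Phi>"
  shows "holomorphic_several_on a U \<Longrightarrow> holomorphic_several_on b U \<Longrightarrow>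
    (\<And>z. z \<in> U \<Longrightarrow> Re (a z) > - real m) \<Longrightarrow> (\<And>z. z \<in> U \<Longrightarrow> Re (b z) > - real m) \<Longrightarrow>
    quotient_off_poles a b U (\<lambda>z. angular_continuation \<Phi> m j (a z) (b z))"
proof (induction m arbitrary: a b j)
  case 0
  obtain M where M: "\<And>t. norm (\<Phi> j (arctan t)) \<le> M"
    using derivative_sequence_arctan_bounded[OF \<Phi>] by metis
  have "holomorphic_several_on (\<lambda>z. angular_transform \<Phi> j (a z) (b z)) U"
    using 0 M by (intro beta_transform_holomorphic[where M = M] derivative_sequence_arctan_continuous \<Phi>) auto
  then show ?case
    unfolding quotient_off_poles_def
    by (intro exI[of _ "\<lambda>z. angular_transform \<Phi> j (a z) (b z)"] exI[of _ "\<lambda>z. 1"]) auto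
next
  case (Suc m)
  have shift: "holomorphic_several_on (\<lambda>z. a z + c) U" "holomorphic_several_on (\<lambda>z. b z + c) U" for c
    by (intro holomorphic_several_on_add Suc.prems holomorphic_several_on_const)+
  have pos: "Re (a z) + 1 > - real m" "Re (b z) + 1 > - real m" if "z \<in> U" for z
    using Suc.prems(3,4)[OF that] by simp_all
  have IH: "quotient_off_poles a b U (\<lambda>z. angular_continuation \<Phi> m i (a z + of_nat (Suc k)) (b z + of_nat (Suc l)))"
    for i k l
  proof -
    have "quotient_off_poles (\<lambda>z. a z + of_nat (Suc k)) (\<lambda>z. b z + of_nat (Suc l)) U
        (\<lambda>z. angular_continuation \<Phi> m i (a z + of_nat (Suc k)) (b z + of_nat (Suc l)))"
      by (rule Suc.IH[OF shift]) (use pos in fastforce)+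
    moreover have "a z \<in> \<int>\<^sub>\<le>\<^sub>0" if "a z + of_nat (Suc k) \<in> \<int>\<^sub>\<le>\<^sub>0" for z
      using that by (rule nonpos_Ints_add_nat_cancel)
    moreover have "b z \<in> \<int>\<^sub>\<le>\<^sub>0" if "b z + of_nat (Suc l) \<in> \<int>\<^sub>\<le>\<^sub>0" for z
      using that by (rule nonpos_Ints_add_nat_cancel)
    ultimately show ?thesis unfolding quotient_off_poles_def by blast
  qed
  obtain p1 q1 where 1: "holomorphic_several_on p1 U" "holomorphic_several_on q1 U"
    "\<forall>z\<in>U. q1 z = 0 \<longrightarrow> a z \<in> \<int>\<^sub>\<le>\<^sub>0 \<or> b z \<in> \<int>\<^sub>\<le>\<^sub>0"
    "\<forall>z\<in>U. q1 z \<noteq> 0 \<longrightarrow> angular_continuation \<Phi> m j (a z + 2) (b z + 2) = p1 z / q1 z"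
    using IH[of j 1 1] unfolding quotient_off_poles_def by auto
  obtain p2 q2 where 2: "holomorphic_several_on p2 U" "holomorphic_several_on q2 U"
    "\<forall>z\<in>U. q2 z = 0 \<longrightarrow> a z \<in> \<int>\<^sub>\<le>\<^sub>0 \<or> b z \<in> \<int>\<^sub>\<le>\<^sub>0"
    "\<forall>z\<in>U. q2 z \<noteq> 0 \<longrightarrow> angular_continuation \<Phi> m (Suc j) (a z + 3) (b z + 1) = p2 z / q2 z"
    using IH[of "Suc j" 2 0] unfolding quotient_off_poles_def by auto
  obtain p3 q3 where 3: "holomorphic_several_on p3 U" "holomorphic_several_on q3 U"
    "\<forall>z\<in>U. q3 z = 0 \<longrightarrow> a z \<in> \<int>\<^sub>\<le>\<^sub>0 \<or> b z \<in> \<int>\<^sub>\<le>\<^sub>0"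
    "\<forall>z\<in>U. q3 z \<noteq> 0 \<longrightarrow> angular_continuation \<Phi> m (Suc j) (a z + 1) (b z + 1) = p3 z / q3 z"
    using IH[of "Suc j" 0 0] unfolding quotient_off_poles_def by auto
  define p where "p z = (a z + b z) * (a z + b z + 2) * p1 z * q2 z * q3 z
     + (a z + b z) * p2 z * q1 z * q3 z - b z * p3 z * q1 z * q2 z" for z
  define q where "q z = a z * b z * q1 z * q2 z * q3 z" for z
  have "holomorphic_several_on p U" "holomorphic_several_on q U"
    unfolding p_def q_def
    by (intro holomorphic_several_intros 1(1,2) 2(1,2) 3(1,2) Suc.prems(1,2))+
  moreover have "\<forall>z\<in>U. q z = 0 \<longrightarrow> a z \<in> \<int>\<^sub>\<le>\<^sub>0 \<or> b z \<in> \<int>\<^sub>\<le>\<^sub>0"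
    using 1(3) 2(3) 3(3) by (auto simp: q_def)
  moreover have "angular_continuation \<Phi> (Suc m) j (a z) (b z) = p z / q z" if z: "z \<in> U" "q z \<noteq> 0" for z
  proof -
    have nz: "a z \<noteq> 0" "b z \<noteq> 0" "q1 z \<noteq> 0" "q2 z \<noteq> 0" "q3 z \<noteq> 0" using z(2) by (auto simp: q_def)
    have "angular_continuation \<Phi> (Suc m) j (a z) (b z) =
      ((a z + b z) * (a z + b z + 2) * (p1 z / q1 z) + (a z + b z) * (p2 z / q2 z) - b z * (p3 z / q3 z)) / (a z * b z)"
      using 1(4) 2(4) 3(4) z(1) nz by simp
    also have "\<dots> = p z / q z"
      using nz by (simp add: p_def q_def divide_simps) (simp add: algebra_simps)
    finally show ?thesis .
  qed
  ultimately show ?case unfolding quotient_off_poles_def by blast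
qed

text \<open>Any level that is large enough for the given arguments returns the same value; the successor
  makes the required bounds on the real parts strict.\<close>

definition angular_meromorphic ::
    "(nat \<Rightarrow> real \<Rightarrow> complex) \<Rightarrow> complex \<Rightarrow> complex \<Rightarrow> complex" where
  "angular_meromorphic \<Phi> a b =
     angular_continuation \<Phi> (Suc (nat \<lceil>max (- Re a) (- Re b)\<rceil>)) 0 a b"

lemma angular_meromorphic_eq:
  assumes "derivative_sequence \<Phi>" "Re a > - real m" "Re b > - real m"
  shows "angular_meromorphic \<Phi> a b = angular_continuation \<Phi> m 0 a b"
proof -
  define k where "k = Suc (nat \<lceil>max (- Re a) (- Re b)\<rceil>)"
  have "max (- Re a) (- Re b) < real k" unfolding k_def by linarith
  then have k: "Re a > - real k" "Re b > - real k" by auto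
  have "angular_continuation \<Phi> k 0 a b = angular_continuation \<Phi> m 0 a b"
    using angular_continuation_mono[OF assms(1), of m k a b 0] angular_continuation_mono[OF assms(1), of k m a b 0] k assms(2,3)
    by (cases "m \<le> k") auto
  then show ?thesis by (simp add: angular_meromorphic_def k_def)
qed

text \<open>The sets \<open>U m\<close> of the proof are convex and exhaust the space, and each one contains the point
  \<open>(1, -1, 0)\<close>, where \<open>a\<close> and \<open>b\<close> are positive. This makes them suitable neighbourhoods for
  exhibiting the function as a quotient.\<close>

lemma mero_continuation_at_angular:
  fixes z\<^sub>0 :: "complex ^ 3" and \<kappa> :: real
  defines "a \<equiv> \<lambda>z :: complex ^ 3. z $ 1 - z $ 3 + of_real \<kappa>" and "b \<equiv> \<lambda>z :: complex ^ 3. z $ 3 - z $ 2 + of_real \<kappa>"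
  assumes \<Phi>: "derivative_sequence \<Phi>" and \<Psi>: "derivative_sequence \<Psi>"
    and C: "holomorphic_several_on C UNIV"
    and \<kappa>: "\<kappa> \<ge> 0"
    and F\<^sub>0: "\<And>z. Re (z $ 1 - z $ 3) > - \<kappa> \<Longrightarrow> Re (z $ 3 - z $ 2) > - \<kappa> \<Longrightarrow>
      F\<^sub>0 z = C z * (angular_transform \<Phi> 0 (a z) (b z) + \<sigma> * angular_transform \<Psi> 0 (a z) (b z))"
    and z\<^sub>0: "Im (z\<^sub>0 $ 1 - z\<^sub>0 $ 3) \<noteq> 0" "Im (z\<^sub>0 $ 3 - z\<^sub>0 $ 2) \<noteq> 0"
  shows "mero_continuation_at {z. Re (z $ 1 - z $ 3) > - \<kappa> \<and> Re (z $ 3 - z $ 2) > - \<kappa>} F\<^sub>0 z\<^sub>0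
    (\<lambda>z. C z * (angular_meromorphic \<Phi> (a z) (b z) + \<sigma> * angular_meromorphic \<Psi> (a z) (b z)))"
    (is "mero_continuation_at ?D F\<^sub>0 z\<^sub>0 ?F")
proof -
  have hol: "holomorphic_several_on a S" "holomorphic_several_on b S" for S
    unfolding a_def b_def
    by (intro holomorphic_several_intros)+
  define U where "U m = {z. Re (a z) > - real m \<and> Re (b z) > - real m}" for m
  have open_U: "open (U m)" for m
    unfolding U_def a_def b_def by (intro open_Collect_conj open_Collect_less continuous_intros)
  have "convex (U m)" for m
  proof -
    have ineq: "u * x + v * y > c" if "x > c" "y > c" "u \<ge> 0" "v \<ge> 0" "u + v = 1" for u v x y c :: real
      using convex_real_interval(4)[of c] convexD[of "{c<..}" x y u v] that by simp
    show ?thesis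
    proof (rule convexI)
      fix x y :: "complex ^ 3" and u v :: real
      assume *: "x \<in> U m" "y \<in> U m" "0 \<le> u" "0 \<le> v" "u + v = 1"
      have v: "v = 1 - u" using *(5) by simp
      have e: "Re (a (u *\<^sub>R x + v *\<^sub>R y)) = u * Re (a x) + v * Re (a y)"
        "Re (b (u *\<^sub>R x + v *\<^sub>R y)) = u * Re (b x) + v * Re (b y)"
        unfolding v by (simp_all add: a_def b_def algebra_simps)
      show "u *\<^sub>R x + v *\<^sub>R y \<in> U m"
        using * ineq[of "- real m"] by (simp add: U_def e)
    qed
  qed
  then have conn_U: "connected (U m)" for m by (rule convex_connected)
  have level_quotient: "quotient_off_poles a b (U m) (\<lambda>z. angular_continuation \<Theta> m 0 (a z) (b z))"
    if "derivative_sequence \<Theta>" for \<Theta> m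
    by (rule angular_continuation_quotient[OF that hol]) (simp_all add: U_def)
  have quotient: "quotient_off_poles a b (U m) ?F" for m
  proof -
    obtain p1 q1 where 1: "holomorphic_several_on p1 (U m)" "holomorphic_several_on q1 (U m)"
      "\<forall>z\<in>U m. q1 z = 0 \<longrightarrow> a z \<in> \<int>\<^sub>\<le>\<^sub>0 \<or> b z \<in> \<int>\<^sub>\<le>\<^sub>0"
      "\<forall>z\<in>U m. q1 z \<noteq> 0 \<longrightarrow> angular_continuation \<Phi> m 0 (a z) (b z) = p1 z / q1 z"
      using level_quotient[OF \<Phi>, of m] unfolding quotient_off_poles_def by blast
    obtain p2 q2 where 2: "holomorphic_several_on p2 (U m)" "holomorphic_several_on q2 (U m)"
      "\<forall>z\<in>U m. q2 z = 0 \<longrightarrow> a z \<in> \<int>\<^sub>\<le>\<^sub>0 \<or> b z \<in> \<int>\<^sub>\<le>\<^sub>0"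
      "\<forall>z\<in>U m. q2 z \<noteq> 0 \<longrightarrow> angular_continuation \<Psi> m 0 (a z) (b z) = p2 z / q2 z"
      using level_quotient[OF \<Psi>, of m] unfolding quotient_off_poles_def by blast
    define p where "p z = C z * (p1 z * q2 z + \<sigma> * (p2 z * q1 z))" for z
    define q where "q z = q1 z * q2 z" for z
    have C': "holomorphic_several_on C (U m)" using holomorphic_several_on_subset[OF C] by simp
    have "holomorphic_several_on p (U m)" "holomorphic_several_on q (U m)"
      unfolding p_def q_def
      by (intro holomorphic_several_intros 1(1,2) 2(1,2) C')+
    moreover have "\<forall>z\<in>U m. q z = 0 \<longrightarrow> a z \<in> \<int>\<^sub>\<le>\<^sub>0 \<or> b z \<in> \<int>\<^sub>\<le>\<^sub>0"
      using 1(3) 2(3) by (auto simp: q_def)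
    moreover have "?F z = p z / q z" if z: "z \<in> U m" "q z \<noteq> 0" for z
    proof -
      have nz: "q1 z \<noteq> 0" "q2 z \<noteq> 0" using z(2) by (auto simp: q_def)
      have "?F z = C z * (p1 z / q1 z + \<sigma> * (p2 z / q2 z))"
        using 1(4) 2(4) z(1) nz angular_meromorphic_eq[OF \<Phi>, of m "a z" "b z"]
          angular_meromorphic_eq[OF \<Psi>, of m "a z" "b z"] by (simp add: U_def)
      also have "\<dots> = p z / q z" using nz by (simp add: p_def q_def field_simps)
      finally show ?thesis .
    qed
    ultimately show ?thesis unfolding quotient_off_poles_def by blast
  qed
  have level: "\<exists>m. z \<in> U m" for z
  proof -
    obtain m where "max (- Re (a z)) (- Re (b z)) < real m" using reals_Archimedean2 by blast
    then show ?thesis by (intro exI[of _ m]) (auto simp: U_def)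
  qed
  have "meromorphic_several ?F"
    unfolding meromorphic_several_def
  proof
    fix z :: "complex ^ 3"
    obtain m where m: "z \<in> U m" using level by blast
    obtain p q where pq: "holomorphic_several_on p (U m)" "holomorphic_several_on q (U m)"
      "\<forall>z\<in>U m. q z = 0 \<longrightarrow> a z \<in> \<int>\<^sub>\<le>\<^sub>0 \<or> b z \<in> \<int>\<^sub>\<le>\<^sub>0" "\<forall>z\<in>U m. q z \<noteq> 0 \<longrightarrow> ?F z = p z / q z"
      using quotient[of m] unfolding quotient_off_poles_def by blast
    define w :: "complex ^ 3" where "w = vector [1, -1, 0]"
    have "a w = of_real (1 + \<kappa>)" "b w = of_real (1 + \<kappa>)" by (simp_all add: a_def b_def w_def)
    then have "Re (a w) > 0" "Re (b w) > 0" using \<kappa> by simp_all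
    then have "w \<in> U m" "a w \<notin> \<int>\<^sub>\<le>\<^sub>0" "b w \<notin> \<int>\<^sub>\<le>\<^sub>0"
      by (auto simp: U_def elim!: nonpos_Ints_cases)
    then have "\<exists>z\<in>U m. q z \<noteq> 0" using pq(3) by blast
    then show "\<exists>U p q. open U \<and> connected U \<and> z \<in> U \<and> holomorphic_several_on p U \<and>
        holomorphic_several_on q U \<and> (\<exists>z\<in>U. q z \<noteq> 0) \<and> (\<forall>z\<in>U. q z \<noteq> 0 \<longrightarrow> ?F z = p z / q z)"
      using open_U conn_U m pq by blast
  qed
  moreover have "\<forall>z\<in>?D. ?F z = F\<^sub>0 z"
    using angular_meromorphic_eq[OF \<Phi>, of 0] angular_meromorphic_eq[OF \<Psi>, of 0] F\<^sub>0
    by (auto simp: a_def b_def)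
  moreover have "\<exists>V. open V \<and> z\<^sub>0 \<in> V \<and> holomorphic_several_on ?F V"
  proof -
    obtain m where m: "z\<^sub>0 \<in> U m" using level by blast
    obtain p q where pq: "holomorphic_several_on p (U m)" "holomorphic_several_on q (U m)"
      "\<forall>z\<in>U m. q z = 0 \<longrightarrow> a z \<in> \<int>\<^sub>\<le>\<^sub>0 \<or> b z \<in> \<int>\<^sub>\<le>\<^sub>0" "\<forall>z\<in>U m. q z \<noteq> 0 \<longrightarrow> ?F z = p z / q z"
      using quotient[of m] unfolding quotient_off_poles_def by blast
    define V where "V = U m \<inter> {z. Im (a z) \<noteq> 0 \<and> Im (b z) \<noteq> 0}"
    have "open {z. Im (a z) \<noteq> 0 \<and> Im (b z) \<noteq> 0}"
      unfolding a_def b_def by (intro open_Collect_conj open_Collect_neq continuous_intros)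
    then have V: "open V" "V \<subseteq> U m" using open_U by (auto simp: V_def)
    have nz: "q z \<noteq> 0" if "z \<in> V" for z
    proof -
      have "a z \<notin> \<int>\<^sub>\<le>\<^sub>0" "b z \<notin> \<int>\<^sub>\<le>\<^sub>0" using that by (auto simp: V_def elim!: nonpos_Ints_cases)
      then show ?thesis using pq(3) that V(2) by blast
    qed
    have "holomorphic_several_on (\<lambda>z. p z / q z) V"
      using pq(1,2) V(2) nz by (intro holomorphic_several_on_divide) (auto elim: holomorphic_several_on_subset)
    then have "holomorphic_several_on ?F V"
      by (rule holomorphic_several_on_cong) (use V nz pq(4) in auto)
    moreover have "z\<^sub>0 \<in> V" using m z\<^sub>0 by (simp add: V_def a_def b_def)
    ultimately show ?thesis using V(1) by blast
  qed
  ultimately show ?thesis unfolding mero_continuation_at_def by blast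
qed

section \<open>Block matrices\<close>

lemma sum_UNIV_Plus:
  fixes f :: "'a::finite + 'b::finite \<Rightarrow> 'c::comm_monoid_add"
  shows "sum f UNIV = (\<Sum>i\<in>UNIV. f (Inl i)) + (\<Sum>i\<in>UNIV. f (Inr i))"
  unfolding UNIV_Plus_UNIV[symmetric] by (subst sum.Plus) auto

lemma upper_block_mult:
  "upper_block a b c ** upper_block a' b' c' = upper_block (a ** a') (a ** b' + b ** c') (c ** c')"
  by (simp add: vec_eq_iff matrix_matrix_mult_def sum_UNIV_Plus upper_block_def split: sum.splits)

lemma upper_block_mat_1: "upper_block (mat 1) 0 (mat 1) = mat 1"
  by (simp add: vec_eq_iff upper_block_def mat_def split: sum.splits)

text \<open>Used with \<open>e = Inl\<close> and \<open>e = Inr\<close>, so that both diagonal blocks are treated by one argument.\<close>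

definition embed_block :: "('n::finite \<Rightarrow> 'm::finite) \<Rightarrow> real ^ 'n ^ 'n \<Rightarrow> real ^ 'm ^ 'm" where
  "embed_block e A = (\<chi> i j. if i \<in> range e \<and> j \<in> range e then A $ inv e i $ inv e j
                             else if i = j then 1 else 0)"

lemma det_embed_block:
  assumes e: "inj e"
  shows "det (embed_block e A) = det A"
proof (induction A rule: induct_matrix_row_operations)
  case (1 A i)
  have "row (e i) (embed_block e A) = 0"
    using 1 e by (auto simp: vec_eq_iff row_def embed_block_def)
  then show ?case using det_zero_row(1)[OF 1] det_zero_row(1) by metis
next
  case (2 A)
  have "det (embed_block e A) = (\<Prod>i\<in>UNIV. embed_block e A $ i $ i)"
    by (intro det_diagonal) (auto simp: embed_block_def inv_f_f[OF e] intro!: 2)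
  also have "\<dots> = (\<Prod>i\<in>range e. embed_block e A $ i $ i)"
    by (rule prod.mono_neutral_right) (auto simp: embed_block_def)
  also have "\<dots> = (\<Prod>i\<in>UNIV. A $ i $ i)"
    by (subst prod.reindex[OF e]) (simp add: embed_block_def inv_f_f[OF e])
  also have "\<dots> = det A" using 2 by (intro det_diagonal[symmetric]) auto
  finally show ?case .
next
  case (3 A m n)
  have inv: "inv e (Transposition.transpose (e m) (e n) j) = Transposition.transpose m n (inv e j)"
    if "j \<in> range e" for j
    using that e by (auto simp: Transposition.transpose_def inv_f_f inj_eq)
  have range: "Transposition.transpose (e m) (e n) j \<in> range e \<longleftrightarrow> j \<in> range e" for j
    by (auto simp: Transposition.transpose_def)
  have "embed_block e (\<chi> i j. A $ i $ Transposition.transpose m n j) =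
      (\<chi> i j. embed_block e A $ i $ Transposition.transpose (e m) (e n) j)"
    by (auto simp: vec_eq_iff embed_block_def range inv) (auto simp: Transposition.transpose_def split: if_splits)
  moreover have "e m \<noteq> e n" using e 3(2) by (simp add: inj_eq)
  ultimately show ?case using 3
    by (simp add: det_permute_columns permutes_swap_id sign_swap_id)
next
  case (4 A m n c)
  have "embed_block e (\<chi> i. if i = m then row m A + c *\<^sub>R row n A else row i A) =
      (\<chi> k. if k = e m then row (e m) (embed_block e A) + c *s row (e n) (embed_block e A) else row k (embed_block e A))"
    using e by (auto simp: vec_eq_iff row_def embed_block_def inv_f_f inj_eq)
  moreover have "e m \<noteq> e n" using e 4(2) by (simp add: inj_eq)
  moreover have "det (\<chi> i. if i = m then row m A + c *\<^sub>R row n A else row i A) = det A"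
  proof -
    have "(\<chi> i. if i = m then row m A + c *\<^sub>R row n A else row i A) =
        (\<chi> i. if i = m then row m A + c *s row n A else row i A)"
      by (simp add: vec_eq_iff)
    also have "det \<dots> = det A" by (rule det_row_operation[OF 4(2)])
    finally show ?thesis .
  qed
  ultimately show ?case using 4(1) by (simp add: det_row_operation)
qed

text \<open>Conjugation by a diagonal block matrix doubles \<open>b\<close>, while the determinant is multiplicative in
  \<open>b\<close>; hence it equals its own square.\<close>

lemma det_upper_unipotent: "det (upper_block (mat 1) b (mat 1) :: ('n::finite) mat2) = 1"
proof -
  let ?u = "\<lambda>b. upper_block (mat 1) b (mat 1) :: 'n mat2"
  have add: "?u b ** ?u b' = ?u (b' + b)" for b b' by (simp add: upper_block_mult)
  have two: "mat 2 ** A = A + A" for A :: "real ^ 'n ^ 'n"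
    by (simp add: vec_eq_iff matrix_matrix_mult_def mat_def if_distrib[of "\<lambda>x. x * _"] cong: if_cong)
  have "upper_block (mat 2) 0 (mat 1) ** ?u b = ?u (b + b) ** (upper_block (mat 2) 0 (mat 1) :: 'n mat2)"
    by (simp add: upper_block_mult two)
  then have "det (upper_block (mat 2) 0 (mat 1) :: 'n mat2) * det (?u b) =
      det (?u (b + b)) * det (upper_block (mat 2) 0 (mat 1) :: 'n mat2)"
    by (metis det_mul)
  moreover have "det (upper_block (mat 2) 0 (mat 1) :: 'n mat2) \<noteq> 0"
  proof -
    have "mat (1/2) + mat (1/2) = (mat 1 :: real ^ 'n ^ 'n)"
      by (simp add: vec_eq_iff mat_def)
    then have "(upper_block (mat 2) 0 (mat 1) :: 'n mat2) ** upper_block (mat (1/2)) 0 (mat 1) = mat 1"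
      by (simp add: upper_block_mult two upper_block_mat_1)
    then show ?thesis by (metis det_I det_mul mult_zero_left zero_neq_one)
  qed
  ultimately have "det (?u b) = det (?u (b + b))" by simp
  also have "\<dots> = det (?u b) * det (?u b)" unfolding add[symmetric] det_mul ..
  finally have "det (?u b) = 0 \<or> det (?u b) = 1" by simp
  moreover have "det (?u b) * det (?u (- b)) = 1"
    using add[of b "- b"] by (metis add.left_inverse det_I det_mul upper_block_mat_1)
  ultimately show ?thesis by auto
qed

lemma det_upper_block: "det (upper_block g\<^sub>1 b g\<^sub>2 :: ('n::finite) mat2) = det g\<^sub>1 * det g\<^sub>2"
proof -
  have 1: "upper_block g\<^sub>1 0 (mat 1) = embed_block Inl g\<^sub>1"
    by (auto simp: vec_eq_iff upper_block_def embed_block_def mat_def split: sum.splits)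
  have 2: "upper_block (mat 1) 0 g\<^sub>2 = embed_block Inr g\<^sub>2"
    by (auto simp: vec_eq_iff upper_block_def embed_block_def mat_def split: sum.splits)
  have "upper_block g\<^sub>1 b g\<^sub>2 =
      upper_block (mat 1) 0 g\<^sub>2 ** (upper_block (mat 1) b (mat 1) ** upper_block g\<^sub>1 0 (mat 1))"
    by (simp add: upper_block_mult)
  then show ?thesis
    by (simp add: det_mul det_upper_unipotent 1 2 det_embed_block)
qed

lemma GL_iff_det: "g \<in> GL \<longleftrightarrow> det g \<noteq> 0"
  by (simp add: GL_def invertible_det_nz)

lemma GL_upper_block_iff: "upper_block g\<^sub>1 b g\<^sub>2 \<in> GL \<longleftrightarrow> g\<^sub>1 \<in> GL \<and> g\<^sub>2 \<in> GL"
  by (simp add: GL_iff_det det_upper_block)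

lemma GL_mult_iff: "g ** h \<in> GL \<longleftrightarrow> g \<in> GL \<and> h \<in> GL"
  by (simp add: GL_iff_det det_mul)

lemma orthogonal_matrix_GL: "orthogonal_matrix k \<Longrightarrow> k \<in> GL"
  using det_orthogonal_matrix[of k] by (auto simp: GL_iff_det)

lemma orthogonal_matrix_columns:
  fixes k :: "real ^ 'm ^ 'm"
  shows "orthogonal_matrix k \<longleftrightarrow> (\<forall>i j. column i k \<bullet> column j k = (if i = j then 1 else 0))"
proof -
  have "(transpose k ** k) $ i $ j = column i k \<bullet> column j k" for i j
    by (simp add: matrix_matrix_mult_def transpose_def column_def inner_vec_def)
  then show ?thesis
    unfolding orthogonal_matrix by (auto simp: vec_eq_iff mat_def)
qed

text \<open>The columns of \<open>k\<close> are an orthonormal basis of the span \<open>V\<close> of the first half of the columns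
  of \<open>g\<close>, followed by one of the orthogonal complement of \<open>V\<close>.\<close>

lemma upper_block_orthogonal_decomposition:
  fixes g :: "('n::finite) mat2"
  assumes g: "g \<in> GL"
  obtains k g\<^sub>1 b g\<^sub>2 where "orthogonal_matrix k" "g\<^sub>1 \<in> GL" "g\<^sub>2 \<in> GL" "g = k ** upper_block g\<^sub>1 b g\<^sub>2"
proof -
  define c where "c j = column (Inl j) g" for j :: 'n
  define V where "V = span (range c)"
  have det: "det g \<noteq> 0" using g by (simp add: GL_iff_det)
  have inj: "inj c"
  proof (rule injI, rule ccontr)
    fix i j assume "c i = c j" "i \<noteq> j"
    then show False using det_identical_columns[of "Inl i" "Inl j" g] det by (simp add: c_def)
  qed
  have "independent (columns g)"
    using det_dependent_columns[of g] det by (auto simp: dependent_vec_eq)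
  moreover have "range c \<subseteq> columns g" by (auto simp: c_def columns_def)
  ultimately have "independent (range c)" using independent_mono by blast
  then have dimV: "dim V = CARD('n)"
    unfolding V_def dim_span using dim_eq_card_independent[OF \<open>independent (range c)\<close>] card_image[OF inj] by simp
  define V' where "V' = {y. \<forall>x\<in>V. orthogonal x y}"
  have "dim {y \<in> UNIV. \<forall>x\<in>V. orthogonal x y} + dim V = dim (UNIV :: (real ^ ('n + 'n)) set)"
    by (rule dim_subspace_orthogonal_to_vectors) (auto simp: V_def subspace_span)
  then have dimV': "dim V' = CARD('n)" using dimV by (simp add: V'_def)
  have sub: "subspace V" "subspace V'"
    unfolding V_def V'_def by (auto simp: subspace_def orthogonal_def inner_right_distrib intro: span_add span_scale span_zero)
  obtain B where B: "B \<subseteq> V" "pairwise orthogonal B" "\<And>x. x \<in> B \<Longrightarrow> norm x = 1" "card B = dim V" "independent B"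
    using orthonormal_basis_subspace[OF sub(1)] by metis
  obtain B' where B': "B' \<subseteq> V'" "pairwise orthogonal B'" "\<And>x. x \<in> B' \<Longrightarrow> norm x = 1" "card B' = dim V'" "independent B'"
    using orthonormal_basis_subspace[OF sub(2)] by metis
  have "finite B" "finite B'" using B(5) B'(5) independent_imp_finite by auto
  then obtain \<beta> \<beta>' where \<beta>: "bij_betw \<beta> (UNIV :: 'n set) B" and \<beta>': "bij_betw \<beta>' (UNIV :: 'n set) B'"
    using B(4) B'(4) dimV dimV' finite_same_card_bij[of "UNIV :: 'n set"] by (metis finite)
  define k :: "'n mat2" where "k = (\<chi> i j. (case j of Inl l \<Rightarrow> \<beta> l | Inr l \<Rightarrow> \<beta>' l) $ i)"
  have col: "column (Inl l) k = \<beta> l" "column (Inr l) k = \<beta>' l" for l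
    by (simp_all add: k_def column_def vec_eq_iff)
  have mem: "\<beta> l \<in> B" "\<beta>' l \<in> B'" for l using \<beta> \<beta>' by (auto simp: bij_betw_def)
  have ortho: "\<beta> i \<bullet> \<beta> j = (if i = j then 1 else 0)" "\<beta>' i \<bullet> \<beta>' j = (if i = j then 1 else 0)"
    "\<beta> i \<bullet> \<beta>' j = 0" "\<beta>' j \<bullet> \<beta> i = 0" for i j
  proof -
    have "\<beta> i = \<beta> j \<longleftrightarrow> i = j" "\<beta>' i = \<beta>' j \<longleftrightarrow> i = j"
      using \<beta> \<beta>' by (auto simp: bij_betw_def inj_eq)
    then show "\<beta> i \<bullet> \<beta> j = (if i = j then 1 else 0)" "\<beta>' i \<bullet> \<beta>' j = (if i = j then 1 else 0)"
      using B(2,3) B'(2,3) mem unfolding pairwise_def orthogonal_def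
      by (auto simp: norm_eq_1)
    show "\<beta> i \<bullet> \<beta>' j = 0" using mem(1)[of i] mem(2)[of j] B(1) B'(1) by (auto simp: V'_def orthogonal_def)
    then show "\<beta>' j \<bullet> \<beta> i = 0" by (simp add: inner_commute)
  qed
  have k: "orthogonal_matrix k"
    unfolding orthogonal_matrix_columns
  proof (intro allI)
    fix i j :: "'n + 'n"
    show "column i k \<bullet> column j k = (if i = j then 1 else 0)"
      by (cases i; cases j) (simp_all add: col ortho)
  qed
  define p where "p = transpose k ** g"
  have gp: "g = k ** p"
    using k by (simp add: p_def matrix_mul_assoc orthogonal_matrix_def)
  have "p $ Inr i $ Inl j = 0" for i j
  proof -
    have "p $ Inr i $ Inl j = \<beta>' i \<bullet> c j"
      by (simp add: p_def matrix_matrix_mult_def transpose_def k_def inner_vec_def c_def column_def)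
    moreover have "c j \<in> V" by (auto simp: V_def span_base)
    ultimately show ?thesis using mem(2)[of i] B'(1) by (auto simp: V'_def orthogonal_def inner_commute)
  qed
  then have p: "p = upper_block (\<chi> i j. p $ Inl i $ Inl j) (\<chi> i j. p $ Inl i $ Inr j) (\<chi> i j. p $ Inr i $ Inr j)"
    (is "p = upper_block ?a ?b ?c")
    by (simp add: vec_eq_iff upper_block_def split: sum.splits)
  have "p \<in> GL" using g gp by (metis GL_mult_iff)
  then have "?a \<in> GL" "?c \<in> GL" using p GL_upper_block_iff by metis+
  then show ?thesis using that[OF k, of ?a ?c ?b] gp p by metis
qed

text \<open>For \<open>g = k ** upper_block g\<^sub>1 b g\<^sub>2\<close> with orthogonal \<open>k\<close>, the determinant of this matrix is
  \<open>(det g\<^sub>1)\<^sup>2\<close>. So \<open>\<bar>det g\<^sub>1\<bar>\<close> and \<open>\<bar>det g\<^sub>2\<bar>\<close>, although defined through a decomposition that is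
  not unique, are smooth functions of \<open>g\<close>.\<close>

definition column_gram :: "('n::finite) mat2 \<Rightarrow> real ^ 'n ^ 'n" where
  "column_gram g = (\<chi> i j. column (Inl i) g \<bullet> column (Inl j) g)"

lemma column_gram_altdef:
  "column_gram g = (\<chi> i j. (transpose g ** g) $ Inl i $ Inl j)"
  by (simp add: column_gram_def vec_eq_iff matrix_matrix_mult_def transpose_def column_def inner_vec_def)

lemma column_gram_orthogonal: "orthogonal_matrix k \<Longrightarrow> column_gram k = mat 1"
  unfolding column_gram_altdef orthogonal_matrix by (simp add: vec_eq_iff mat_def)

lemma column_Inl_mult_upper_block:
  "column (Inl j) (g ** upper_block g\<^sub>1 b g\<^sub>2) = (\<Sum>l\<in>UNIV. g\<^sub>1 $ l $ j *\<^sub>R column (Inl l) g)"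
  by (simp add: vec_eq_iff column_def matrix_matrix_mult_def sum_UNIV_Plus upper_block_def mult.commute)

lemma column_gram_mult_upper_block:
  "column_gram (g ** upper_block g\<^sub>1 b g\<^sub>2) = transpose g\<^sub>1 ** column_gram g ** g\<^sub>1"
proof -
  note column_Inl_mult_upper_block[of _ g g\<^sub>1 b g\<^sub>2]
  then have "column_gram (g ** upper_block g\<^sub>1 b g\<^sub>2) $ i $ j =
      (\<Sum>l\<in>UNIV. \<Sum>m\<in>UNIV. g\<^sub>1 $ m $ i * column_gram g $ m $ l * g\<^sub>1 $ l $ j)" for i j
    by (simp add: column_gram_def inner_sum_left inner_sum_right sum_distrib_left mult_ac)
  then show ?thesis
    by (simp add: vec_eq_iff matrix_matrix_mult_def transpose_def sum_distrib_right)
qed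

lemma det_column_gram_mult_upper_block:
  "det (column_gram (g ** upper_block g\<^sub>1 b g\<^sub>2)) = (det g\<^sub>1)\<^sup>2 * det (column_gram g)"
  by (simp add: column_gram_mult_upper_block det_mul det_transpose power2_eq_square)

lemma det_column_gram_pos:
  assumes "g \<in> GL" shows "det (column_gram g) > 0"
proof -
  obtain k g\<^sub>1 b g\<^sub>2 where "orthogonal_matrix k" "g\<^sub>1 \<in> GL" "g = k ** upper_block g\<^sub>1 b g\<^sub>2"
    using upper_block_orthogonal_decomposition[OF assms] by metis
  then show ?thesis
    by (simp add: det_column_gram_mult_upper_block column_gram_orthogonal GL_iff_det)
qed

section \<open>Smooth functions and the compact picture\<close>

lemma Cinf_differentiable: "f \<in> Cinf S \<Longrightarrow> x \<in> S \<Longrightarrow> iter_deriv vs f differentiable (at x)"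
  unfolding Cinf_def by blast

lemma Cinf_has_derivative:
  "f \<in> Cinf S \<Longrightarrow> x \<in> S \<Longrightarrow> (iter_deriv vs f has_derivative (\<lambda>v. iter_deriv (v # vs) f x)) (at x)"
  using Cinf_differentiable[of f S x vs] unfolding frechet_derivative_works by simp

lemma Cinf_zero: "f \<in> Cinf S \<Longrightarrow> x \<notin> S \<Longrightarrow> f x = 0"
  unfolding Cinf_def by blast

text \<open>Closure of a class of functions under directional derivatives is enough: every iterated
  derivative of a member agrees on \<open>S\<close> with a member.\<close>

lemma Cinf_if_derivative_closed:
  fixes P :: "('a::real_normed_vector \<Rightarrow> complex) \<Rightarrow> bool"
  assumes S: "open S" and P: "P f"
    and closed: "\<And>f. P f \<Longrightarrow> \<exists>D. (\<forall>v. P (D v)) \<and> (\<forall>x\<in>S. (f has_derivative (\<lambda>v. D v x)) (at x))"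
    and zero: "\<And>x. x \<notin> S \<Longrightarrow> f x = 0"
  shows "f \<in> Cinf S"
proof -
  have "\<exists>g. P g \<and> (\<forall>x\<in>S. iter_deriv vs f x = g x)" for vs
  proof (induction vs)
    case Nil
    then show ?case using P by auto
  next
    case (Cons v vs)
    then obtain g where g: "P g" "\<forall>x\<in>S. iter_deriv vs f x = g x" by blast
    from closed[OF g(1)]
    obtain D where D: "(\<forall>v. P (D v)) \<and> (\<forall>x\<in>S. (g has_derivative (\<lambda>v. D v x)) (at x))" ..
    have "iter_deriv (v # vs) f x = D v x" if x: "x \<in> S" for x
    proof -
      have "(iter_deriv vs f has_derivative (\<lambda>v. D v x)) (at x)"
        by (rule has_derivative_transform_within_open[of g _ x UNIV S]) (use D x g(2) S in auto)
      then have "frechet_derivative (iter_deriv vs f) (at x) = (\<lambda>v. D v x)"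
        by (rule frechet_derivative_at[symmetric])
      then show ?thesis by simp
    qed
    then show ?case using D by (intro exI[of _ "D v"]) blast
  qed
  moreover have "g differentiable (at x)" if "P g" "x \<in> S" for g x
  proof -
    from closed[OF that(1)]
    obtain D where "(\<forall>v. P (D v)) \<and> (\<forall>x\<in>S. (g has_derivative (\<lambda>v. D v x)) (at x))" ..
    then show ?thesis using that(2) unfolding differentiable_def by auto
  qed
  ultimately have "iter_deriv vs f differentiable (at x)" if x: "x \<in> S" for vs x
  proof -
    obtain g where g: "P g" "\<forall>x\<in>S. iter_deriv vs f x = g x"
      using \<open>\<And>vs. \<exists>g. P g \<and> (\<forall>x\<in>S. iter_deriv vs f x = g x)\<close>[of vs] by auto
    obtain G where "(g has_derivative G) (at x)"
      using \<open>\<And>g x. P g \<Longrightarrow> x \<in> S \<Longrightarrow> g differentiable (at x)\<close>[OF g(1) x] unfolding differentiable_def by auto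
    then have "(iter_deriv vs f has_derivative G) (at x)"
      by (rule has_derivative_transform_within_open[of g _ x UNIV S]) (use x g(2) S in auto)
    then show ?thesis unfolding differentiable_def by auto
  qed
  then show ?thesis using zero unfolding Cinf_def by blast
qed

text \<open>A class closed under directional derivatives that contains \<open>f\<close> and all complex powers of positive
  polynomials. The derivative of \<open>u powr \<alpha>\<close> stays in the class because the exponent is arbitrary.\<close>

inductive smooth_algebra ::
    "'a::real_normed_vector set \<Rightarrow> ('a \<Rightarrow> complex) \<Rightarrow> ('a \<Rightarrow> complex) \<Rightarrow> bool"
  for S f where
  iter_deriv: "smooth_algebra S f (iter_deriv vs f)"
| const: "smooth_algebra S f (\<lambda>_. c)"
| linear: "bounded_linear \<phi> \<Longrightarrow> smooth_algebra S f \<phi>"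
| add: "smooth_algebra S f F \<Longrightarrow> smooth_algebra S f G \<Longrightarrow> smooth_algebra S f (\<lambda>x. F x + G x)"
| mult: "smooth_algebra S f F \<Longrightarrow> smooth_algebra S f G \<Longrightarrow> smooth_algebra S f (\<lambda>x. F x * G x)"
| powr: "smooth_algebra S f (\<lambda>x. of_real (u x)) \<Longrightarrow> (\<And>x. x \<in> S \<Longrightarrow> u x > 0) \<Longrightarrow>
    smooth_algebra S f (\<lambda>x. of_real (u x) powr \<alpha>)"

lemma smooth_algebra_derivative:
  assumes f: "f \<in> Cinf S" and F: "smooth_algebra S f F"
  shows "\<exists>D. (\<forall>v. smooth_algebra S f (D v)) \<and> (\<forall>x\<in>S. (F has_derivative (\<lambda>v. D v x)) (at x))"
  using F
proof induction
  case (iter_deriv vs)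
  show ?case
    by (intro exI[of _ "\<lambda>v. iter_deriv (v # vs) f"] conjI allI ballI smooth_algebra.iter_deriv
        Cinf_has_derivative[OF f])
next
  case (const c)
  show ?case by (intro exI[of _ "\<lambda>_ _. 0"]) (auto intro: smooth_algebra.const)
next
  case (linear \<phi>)
  then show ?case
    by (intro exI[of _ "\<lambda>v _. \<phi> v"]) (auto intro: smooth_algebra.const bounded_linear_imp_has_derivative)
next
  case (add F G)
  then obtain D E where D: "\<forall>v. smooth_algebra S f (D v)" "\<forall>x\<in>S. (F has_derivative (\<lambda>v. D v x)) (at x)"
    and E: "\<forall>v. smooth_algebra S f (E v)" "\<forall>x\<in>S. (G has_derivative (\<lambda>v. E v x)) (at x)" by blast
  then show ?case
    by (intro exI[of _ "\<lambda>v x. D v x + E v x"]) (auto intro: smooth_algebra.add has_derivative_add)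
next
  case (mult F G)
  then obtain D E where D: "\<forall>v. smooth_algebra S f (D v)" "\<forall>x\<in>S. (F has_derivative (\<lambda>v. D v x)) (at x)"
    and E: "\<forall>v. smooth_algebra S f (E v)" "\<forall>x\<in>S. (G has_derivative (\<lambda>v. E v x)) (at x)" by blast
  then show ?case using mult.hyps
    by (intro exI[of _ "\<lambda>v x. F x * E v x + D v x * G x"])
       (auto intro!: smooth_algebra.add smooth_algebra.mult has_derivative_mult)
next
  case (powr u \<alpha>)
  then obtain D where D: "\<forall>v. smooth_algebra S f (D v)"
    "\<forall>x\<in>S. ((\<lambda>x. complex_of_real (u x)) has_derivative (\<lambda>v. D v x)) (at x)" by blast
  have "((\<lambda>x. of_real (u x) powr \<alpha>) has_derivative (\<lambda>v. \<alpha> * of_real (u x) powr (\<alpha> - 1) * D v x)) (at x)"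
    if x: "x \<in> S" for x
  proof -
    have "complex_of_real (u x) \<notin> \<real>\<^sub>\<le>\<^sub>0" using powr.hyps(2)[OF x] by simp
    then have "((\<lambda>z. z powr \<alpha>) has_derivative (*) (\<alpha> * of_real (u x) powr (\<alpha> - 1))) (at (complex_of_real (u x)))"
      using has_field_derivative_powr[of "complex_of_real (u x)" \<alpha>] by (simp add: has_field_derivative_def)
    from has_derivative_compose[OF bspec[OF D(2) x] this] show ?thesis .
  qed
  moreover have "smooth_algebra S f (\<lambda>x. \<alpha> * of_real (u x) powr (\<alpha> - 1) * D v x)" for v
    by (intro smooth_algebra.mult smooth_algebra.const smooth_algebra.powr powr.hyps D(1)[rule_format])
  ultimately show ?case by (intro exI[of _ "\<lambda>v x. \<alpha> * of_real (u x) powr (\<alpha> - 1) * D v x"]) auto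
qed

lemma smooth_algebra_sum:
  "(\<And>i. i \<in> I \<Longrightarrow> smooth_algebra S f (F i)) \<Longrightarrow> smooth_algebra S f (\<lambda>x. \<Sum>i\<in>I. F i x)"
  by (induction I rule: infinite_finite_induct) (auto intro: smooth_algebra.intros)

lemma smooth_algebra_prod:
  "(\<And>i. i \<in> I \<Longrightarrow> smooth_algebra S f (F i)) \<Longrightarrow> smooth_algebra S f (\<lambda>x. \<Prod>i\<in>I. F i x)"
  by (induction I rule: infinite_finite_induct) (auto intro: smooth_algebra.intros)

lemma smooth_algebra_det:
  fixes M :: "'a::real_normed_vector \<Rightarrow> real ^ 'm ^ 'm"
  assumes "\<And>i j. smooth_algebra S f (\<lambda>x. of_real (M x $ i $ j))"
  shows "smooth_algebra S f (\<lambda>x. of_real (det (M x)))"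
  unfolding det_def of_real_sum of_real_mult of_real_prod
  by (intro smooth_algebra_sum smooth_algebra.mult smooth_algebra.const smooth_algebra_prod assms)

lemma smooth_algebra_entry: "smooth_algebra S f (\<lambda>g :: real ^ 'm::finite ^ 'k::finite. of_real (g $ i $ j))"
  by (intro smooth_algebra.linear bounded_linear_compose[OF bounded_linear_of_real]
      bounded_linear_compose[OF bounded_linear_vec_nth] bounded_linear_vec_nth)

lemma open_GL: "open (GL :: (real ^ 'm::finite ^ 'm) set)"
proof -
  have "continuous_on UNIV (det :: real ^ 'm ^ 'm \<Rightarrow> real)"
    unfolding det_def by (intro continuous_intros)
  then have "open (det -` (- {0}) :: (real ^ 'm ^ 'm) set)" by (intro open_vimage) auto
  also have "det -` (- {0}) = (GL :: (real ^ 'm ^ 'm) set)" by (auto simp: GL_iff_det)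
  finally show ?thesis .
qed

text \<open>On \<open>k ** upper_block g\<^sub>1 b g\<^sub>2\<close> with orthogonal \<open>k\<close> this is \<open>\<bar>det g\<^sub>1\<bar>\<close> to the power \<open>r + s\<close> times
  \<open>\<bar>det g\<^sub>2\<bar>\<close> to the power \<open>s\<close>, the ratio of two of the characters that define \<open>prin\<close>.\<close>

definition section_factor :: "complex \<Rightarrow> complex \<Rightarrow> ('n::finite) mat2 \<Rightarrow> complex" where
  "section_factor r s g = of_real (det (column_gram g)) powr (r / 2) * of_real ((det g)\<^sup>2) powr (s / 2)"

lemma of_real_square_powr: "complex_of_real (x\<^sup>2) powr (s / 2) = of_real \<bar>x\<bar> powr s"
proof (cases "x = 0")
  case False
  have "ln (x\<^sup>2) = 2 * ln \<bar>x\<bar>" using False ln_powr[of "\<bar>x\<bar>" 2] by (simp add: powr_numeral)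
  moreover have "Ln (complex_of_real (x\<^sup>2)) = of_real (ln (x\<^sup>2))" using False by (intro Ln_of_real) simp
  ultimately show ?thesis using False by (simp add: powr_def Ln_of_real)
qed simp

lemma of_real_mult_powr:
  "a > 0 \<Longrightarrow> b > 0 \<Longrightarrow> complex_of_real (a * b) powr s = of_real a powr s * of_real b powr s"
  using Ln_of_real[of "a * b"]
  by (simp add: powr_def Ln_of_real ln_mult algebra_simps flip: exp_add)

lemma section_factor_mult_upper_block:
  assumes "g \<in> GL" "g\<^sub>1 \<in> GL" "g\<^sub>2 \<in> GL"
  shows "section_factor r s (g ** upper_block g\<^sub>1 b g\<^sub>2) =
    of_real \<bar>det g\<^sub>1\<bar> powr (r + s) * of_real \<bar>det g\<^sub>2\<bar> powr s * section_factor r s g"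
proof -
  have nz: "det g \<noteq> 0" "det g\<^sub>1 \<noteq> 0" "det g\<^sub>2 \<noteq> 0" using assms by (simp_all add: GL_iff_det)
  have "section_factor r s (g ** upper_block g\<^sub>1 b g\<^sub>2) =
     of_real ((det g\<^sub>1)\<^sup>2 * det (column_gram g)) powr (r / 2) * of_real (((det g\<^sub>1)\<^sup>2 * (det g\<^sub>2)\<^sup>2) * (det g)\<^sup>2) powr (s / 2)"
    unfolding section_factor_def det_column_gram_mult_upper_block
    by (simp add: det_mul det_upper_block power_mult_distrib mult_ac)
  also have "\<dots> = (of_real ((det g\<^sub>1)\<^sup>2) powr (r / 2) * of_real ((det g\<^sub>1)\<^sup>2) powr (s / 2))
      * of_real ((det g\<^sub>2)\<^sup>2) powr (s / 2) * section_factor r s g"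
  proof -
    have "of_real ((det g\<^sub>1)\<^sup>2 * det (column_gram g)) powr (r / 2) =
        complex_of_real ((det g\<^sub>1)\<^sup>2) powr (r / 2) * of_real (det (column_gram g)) powr (r / 2)"
      using nz det_column_gram_pos[OF assms(1)] by (intro of_real_mult_powr) auto
    moreover have "of_real (((det g\<^sub>1)\<^sup>2 * (det g\<^sub>2)\<^sup>2) * (det g)\<^sup>2) powr (s / 2) =
        complex_of_real ((det g\<^sub>1)\<^sup>2 * (det g\<^sub>2)\<^sup>2) powr (s / 2) * of_real ((det g)\<^sup>2) powr (s / 2)"
      using nz by (intro of_real_mult_powr) auto
    moreover have "of_real ((det g\<^sub>1)\<^sup>2 * (det g\<^sub>2)\<^sup>2) powr (s / 2) =
        complex_of_real ((det g\<^sub>1)\<^sup>2) powr (s / 2) * of_real ((det g\<^sub>2)\<^sup>2) powr (s / 2)"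
      using nz by (intro of_real_mult_powr) auto
    ultimately show ?thesis unfolding section_factor_def by (simp only: mult_ac)
  qed
  also have "\<dots> = of_real \<bar>det g\<^sub>1\<bar> powr (r + s) * of_real \<bar>det g\<^sub>2\<bar> powr s * section_factor r s g"
    unfolding of_real_square_powr by (simp add: powr_add)
  finally show ?thesis .
qed

lemma section_factor_orthogonal: "orthogonal_matrix k \<Longrightarrow> section_factor r s k = 1"
  using det_orthogonal_matrix[of k] by (auto simp: section_factor_def column_gram_orthogonal)

lemma signed_power_mult_abs_powr:
  "signed_power \<epsilon> \<mu> x * of_real \<bar>x\<bar> powr \<rho> = signed_power \<epsilon> (\<mu> + \<rho>) x"
  by (simp add: signed_power_def powr_add)

lemma prin_equivariant:
  "f \<in> prin \<xi>\<^sub>1 \<xi>\<^sub>2 \<mu>\<^sub>1 \<mu>\<^sub>2 \<Longrightarrow> g \<in> GL \<Longrightarrow> g\<^sub>1 \<in> GL \<Longrightarrow> g\<^sub>2 \<in> GL \<Longrightarrow>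
    f (g ** upper_block g\<^sub>1 b g\<^sub>2) = signed_power \<xi>\<^sub>1 (- \<mu>\<^sub>1 - of_nat CARD('n) / 2) (det g\<^sub>1) *
       signed_power \<xi>\<^sub>2 (- \<mu>\<^sub>2 + of_nat CARD('n) / 2) (det g\<^sub>2) * f g"
  for f :: "('n::finite) mat2 \<Rightarrow> complex"
  unfolding prin_def by blast

lemma prin_Cinf: "f \<in> prin \<xi>\<^sub>1 \<xi>\<^sub>2 \<mu>\<^sub>1 \<mu>\<^sub>2 \<Longrightarrow> f \<in> Cinf GL"
  unfolding prin_def by blast

lemma section_factor_prin:
  fixes f :: "('n::finite) mat2 \<Rightarrow> complex"
  assumes f: "f \<in> prin \<xi>\<^sub>1 \<xi>\<^sub>2 \<mu>\<^sub>1 \<mu>\<^sub>2"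
  shows "(\<lambda>g. f g * section_factor ((\<mu>\<^sub>1 - \<rho>\<^sub>1) - (\<mu>\<^sub>2 - \<rho>\<^sub>2)) (\<mu>\<^sub>2 - \<rho>\<^sub>2) g) \<in> prin \<xi>\<^sub>1 \<xi>\<^sub>2 \<rho>\<^sub>1 \<rho>\<^sub>2"
proof -
  define r where "r = (\<mu>\<^sub>1 - \<rho>\<^sub>1) - (\<mu>\<^sub>2 - \<rho>\<^sub>2)"
  define s where "s = \<mu>\<^sub>2 - \<rho>\<^sub>2"
  have entries: "smooth_algebra GL f (\<lambda>g. of_real (column_gram g $ i $ j))" for i j
    by (simp add: column_gram_def inner_vec_def column_def)
       (intro smooth_algebra_sum smooth_algebra.mult smooth_algebra_entry)
  have "smooth_algebra GL f (section_factor r s)"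
    unfolding section_factor_def[abs_def]
  proof (intro smooth_algebra.mult smooth_algebra.powr smooth_algebra_det entries)
    show "smooth_algebra GL f (\<lambda>g. of_real ((det g)\<^sup>2))"
      unfolding power2_eq_square of_real_mult
      by (intro smooth_algebra.mult smooth_algebra_det smooth_algebra_entry)
  qed (simp_all add: det_column_gram_pos GL_iff_det)
  then have "smooth_algebra GL f (\<lambda>g. f g * section_factor r s g)"
    using smooth_algebra.iter_deriv[of GL f "[]"] by (auto intro: smooth_algebra.mult)
  then have smooth: "(\<lambda>g. f g * section_factor r s g) \<in> Cinf GL"
    by (rule Cinf_if_derivative_closed[OF open_GL _ smooth_algebra_derivative[OF prin_Cinf[OF f]]])
       (use Cinf_zero[OF prin_Cinf[OF f]] in auto)
  have "f (g ** upper_block g\<^sub>1 b g\<^sub>2) * section_factor r s (g ** upper_block g\<^sub>1 b g\<^sub>2) =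
      signed_power \<xi>\<^sub>1 (- \<rho>\<^sub>1 - of_nat CARD('n) / 2) (det g\<^sub>1) *
      signed_power \<xi>\<^sub>2 (- \<rho>\<^sub>2 + of_nat CARD('n) / 2) (det g\<^sub>2) * (f g * section_factor r s g)"
    if g: "g \<in> GL" "g\<^sub>1 \<in> GL" "g\<^sub>2 \<in> GL" for g g\<^sub>1 g\<^sub>2 b
  proof -
    have 1: "signed_power \<xi>\<^sub>1 (- \<mu>\<^sub>1 - of_nat CARD('n) / 2) (det g\<^sub>1) * of_real \<bar>det g\<^sub>1\<bar> powr (r + s) =
        signed_power \<xi>\<^sub>1 (- \<rho>\<^sub>1 - of_nat CARD('n) / 2) (det g\<^sub>1)"
      unfolding signed_power_mult_abs_powr
      by (rule arg_cong[where f = "\<lambda>\<mu>. signed_power \<xi>\<^sub>1 \<mu> (det g\<^sub>1)"]) (simp add: r_def s_def)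
    have 2: "signed_power \<xi>\<^sub>2 (- \<mu>\<^sub>2 + of_nat CARD('n) / 2) (det g\<^sub>2) * of_real \<bar>det g\<^sub>2\<bar> powr s =
        signed_power \<xi>\<^sub>2 (- \<rho>\<^sub>2 + of_nat CARD('n) / 2) (det g\<^sub>2)"
      unfolding signed_power_mult_abs_powr
      by (rule arg_cong[where f = "\<lambda>\<mu>. signed_power \<xi>\<^sub>2 \<mu> (det g\<^sub>2)"]) (simp add: s_def)
    show ?thesis
      unfolding prin_equivariant[OF f g] section_factor_mult_upper_block[OF g] 1[symmetric] 2[symmetric]
      by (simp only: mult_ac)
  qed
  with smooth show ?thesis unfolding prin_def r_def s_def by blast
qed

lemma prin_determined_by_orthogonal:
  fixes f f' :: "('n::finite) mat2 \<Rightarrow> complex"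
  assumes f: "f \<in> prin \<xi>\<^sub>1 \<xi>\<^sub>2 \<rho>\<^sub>1 \<rho>\<^sub>2" and f': "f' \<in> prin \<xi>\<^sub>1 \<xi>\<^sub>2 \<rho>\<^sub>1 \<rho>\<^sub>2"
    and eq: "\<And>k. orthogonal_matrix k \<Longrightarrow> f k = f' k"
  shows "f = f'"
proof
  fix g
  show "f g = f' g"
  proof (cases "g \<in> GL")
    case True
    obtain k g\<^sub>1 b g\<^sub>2 where k: "orthogonal_matrix k" "g\<^sub>1 \<in> GL" "g\<^sub>2 \<in> GL" "g = k ** upper_block g\<^sub>1 b g\<^sub>2"
      using upper_block_orthogonal_decomposition[OF True] by metis
    then show ?thesis
      by (simp add: prin_equivariant[OF f] prin_equivariant[OF f'] orthogonal_matrix_GL eq)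
  next
    case False
    then show ?thesis using Cinf_zero prin_Cinf f f' by metis
  qed
qed

lemma compact_section_eq:
  fixes f :: "('n::finite) mat2 \<Rightarrow> complex"
  assumes f: "f \<in> prin \<xi>\<^sub>1 \<xi>\<^sub>2 \<mu>\<^sub>1 \<mu>\<^sub>2"
  shows "compact_section \<xi>\<^sub>1 \<xi>\<^sub>2 \<rho>\<^sub>1 \<rho>\<^sub>2 f =
    (\<lambda>g. f g * section_factor ((\<mu>\<^sub>1 - \<rho>\<^sub>1) - (\<mu>\<^sub>2 - \<rho>\<^sub>2)) (\<mu>\<^sub>2 - \<rho>\<^sub>2) g)" (is "_ = ?F")
  unfolding compact_section_def
proof (rule the_equality)
  show F: "?F \<in> prin \<xi>\<^sub>1 \<xi>\<^sub>2 \<rho>\<^sub>1 \<rho>\<^sub>2 \<and> (\<forall>k. orthogonal_matrix k \<longrightarrow> ?F k = f k)"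
    using section_factor_prin[OF f] by (simp add: section_factor_orthogonal)
  fix f' assume f': "f' \<in> prin \<xi>\<^sub>1 \<xi>\<^sub>2 \<rho>\<^sub>1 \<rho>\<^sub>2 \<and> (\<forall>k. orthogonal_matrix k \<longrightarrow> f' k = f k)"
  show "f' = ?F"
    by (rule prin_determined_by_orthogonal[of f' \<xi>\<^sub>1 \<xi>\<^sub>2 \<rho>\<^sub>1 \<rho>\<^sub>2 ?F]) (use f' F in auto)
qed

section \<open>Seminorms and derivatives along a flow\<close>

lemma iter_deriv_lincomb:
  assumes S: "open S" and f: "f \<in> Cinf S" and g: "g \<in> Cinf S" and x: "x \<in> S"
  shows "iter_deriv vs (\<lambda>x. c * f x + d * g x) x = c * iter_deriv vs f x + d * iter_deriv vs g x"
  using x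
proof (induction vs arbitrary: x)
  case (Cons v vs)
  have "((\<lambda>x. c * iter_deriv vs f x + d * iter_deriv vs g x) has_derivative
      (\<lambda>v. c * iter_deriv (v # vs) f x + d * iter_deriv (v # vs) g x)) (at x)"
    by (intro has_derivative_add has_derivative_mult_right Cinf_has_derivative[OF f] Cinf_has_derivative[OF g] Cons.prems)
  then have "(iter_deriv vs (\<lambda>x. c * f x + d * g x) has_derivative
      (\<lambda>v. c * iter_deriv (v # vs) f x + d * iter_deriv (v # vs) g x)) (at x)"
    by (rule has_derivative_transform_within_open[OF _ S Cons.prems]) (simp add: Cons.IH)
  from frechet_derivative_at[OF this] show ?case by (simp add: fun_eq_iff)
qed simp

definition continuous_seminorm ::
    "('a::real_normed_vector set) \<Rightarrow> ('a \<Rightarrow> complex) set \<Rightarrow> (('a \<Rightarrow> complex) \<Rightarrow> real) \<Rightarrow> bool" where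
  "continuous_seminorm S V q \<longleftrightarrow>
     seminorm_on V q \<and> continuous_map (subtopology (Cinf_topology S) V) euclideanreal q"

lemma continuous_seminorm_nonneg: "continuous_seminorm S V q \<Longrightarrow> f \<in> V \<Longrightarrow> q f \<ge> 0"
  by (simp add: continuous_seminorm_def seminorm_on_def)

lemma continuous_seminorm_add:
  assumes "continuous_seminorm S V q" "continuous_seminorm S V r"
  shows "continuous_seminorm S V (\<lambda>f. q f + r f)"
proof -
  have "continuous_map (subtopology (Cinf_topology S) V) euclideanreal (\<lambda>f. q f + r f)"
    using assms unfolding continuous_seminorm_def by (intro continuous_map_add) auto
  moreover have "seminorm_on V (\<lambda>f. q f + r f)"
    unfolding seminorm_on_def
  proof (intro conjI ballI allI)
    fix f g c assume f: "f \<in> V" and g: "g \<in> V"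
    have "q (\<lambda>x. f x + g x) \<le> q f + q g" "r (\<lambda>x. f x + g x) \<le> r f + r g"
      using assms f g unfolding continuous_seminorm_def seminorm_on_def by auto
    then show "q (\<lambda>x. f x + g x) + r (\<lambda>x. f x + g x) \<le> q f + r f + (q g + r g)" by simp
  next
    fix f and c :: complex assume f: "f \<in> V"
    have "q (\<lambda>x. c * f x) = norm c * q f" "r (\<lambda>x. c * f x) = norm c * r f" "q f \<ge> 0" "r f \<ge> 0"
      using assms f unfolding continuous_seminorm_def seminorm_on_def by auto
    then show "q (\<lambda>x. c * f x) + r (\<lambda>x. c * f x) = norm c * (q f + r f)" "0 \<le> q f + r f"
      by (simp_all add: algebra_simps)
  qed
  ultimately show ?thesis unfolding continuous_seminorm_def by blast
qed

lemma continuous_seminorm_scale: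
  assumes "continuous_seminorm S V q" "c \<ge> 0"
  shows "continuous_seminorm S V (\<lambda>f. c * q f)"
proof -
  have "continuous_map (subtopology (Cinf_topology S) V) euclideanreal (\<lambda>f. c * q f)"
    using assms unfolding continuous_seminorm_def
    by (intro continuous_map_real_mult) auto
  moreover have "seminorm_on V (\<lambda>f. c * q f)"
    using assms unfolding continuous_seminorm_def seminorm_on_def
    by (auto simp: mult_left_mono simp flip: distrib_left)
  ultimately show ?thesis unfolding continuous_seminorm_def by blast
qed

lemma continuous_seminorm_zero: "continuous_seminorm S V (\<lambda>_. 0)"
  by (simp add: continuous_seminorm_def seminorm_on_def)

lemma continuous_seminorm_sum:
  "(\<And>i. i \<in> I \<Longrightarrow> continuous_seminorm S V (q i)) \<Longrightarrow> continuous_seminorm S V (\<lambda>f. \<Sum>i\<in>I. q i f)"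
  by (induction I rule: infinite_finite_induct)
     (auto intro: continuous_seminorm_zero continuous_seminorm_add)

lemma iter_deriv_bounded_on_compact:
  assumes "f \<in> Cinf S" "compact K" "K \<subseteq> S"
  shows "bdd_above ((\<lambda>x. norm (iter_deriv vs f x)) ` K)"
proof -
  have "continuous_on K (iter_deriv vs f)"
    using assms Cinf_differentiable
    by (intro continuous_at_imp_continuous_on ballI differentiable_imp_continuous_within) blast
  then have "compact ((\<lambda>x. norm (iter_deriv vs f x)) ` K)"
    by (intro compact_continuous_image continuous_on_norm assms)
  then show ?thesis by (intro bounded_imp_bdd_above compact_imp_bounded)
qed

text \<open>The subbasic neighbourhood of \<open>f\<close> given by \<open>K\<close>, \<open>vs\<close> and \<open>e / 2\<close> consists of functions whose
  seminorm differs from that of \<open>f\<close> by at most \<open>e / 2\<close>.\<close>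

lemma continuous_seminorm_SUP_iter_deriv:
  assumes S: "open S" and V: "V \<subseteq> Cinf S" and K: "compact K" "K \<subseteq> S" "K \<noteq> {}"
  shows "continuous_seminorm S V (\<lambda>f. SUP x\<in>K. norm (iter_deriv vs f x))"
    (is "continuous_seminorm S V ?q")
proof -
  have upper: "norm (iter_deriv vs f x) \<le> ?q f" if "f \<in> Cinf S" "x \<in> K" for f x
    by (intro cSUP_upper iter_deriv_bounded_on_compact[OF _ K(1,2)] that)
  have "seminorm_on V ?q"
    unfolding seminorm_on_def
  proof (intro conjI ballI allI)
    fix f assume "f \<in> V"
    then have f: "f \<in> Cinf S" using V by blast
    obtain x where "x \<in> K" using K(3) by blast
    then show "?q f \<ge> 0" using order_trans[OF norm_ge_zero upper[OF f]] by blast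
    show "?q (\<lambda>x. c * f x) = norm c * ?q f" for c
    proof (cases "c = 0")
      case True
      have "norm (iter_deriv vs (\<lambda>x. c * f x) x) = 0" if "x \<in> K" for x
        using iter_deriv_lincomb[OF S f f, of x vs c 0] that K(2) True by auto
      then have "?q (\<lambda>x. c * f x) = (SUP x\<in>K. 0)" by (intro SUP_cong) auto
      then show ?thesis using True K(3) by simp
    next
      case False
      have eq: "norm (iter_deriv vs (\<lambda>x. c * f x) x) = norm c * norm (iter_deriv vs f x)" if "x \<in> K" for x
        using iter_deriv_lincomb[OF S f f, of x vs c 0] that K(2) by (auto simp: norm_mult)
      then have "?q (\<lambda>x. c * f x) = (SUP x\<in>K. norm c * norm (iter_deriv vs f x))"
        by (intro SUP_cong) auto
      also have "\<dots> = norm c * ?q f"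
      proof (rule antisym)
        have le: "norm c * norm (iter_deriv vs f x) \<le> norm c * ?q f" if "x \<in> K" for x
          using upper[OF f that] by (simp add: mult_left_mono)
        show "(SUP x\<in>K. norm c * norm (iter_deriv vs f x)) \<le> norm c * ?q f"
          by (intro cSUP_least K(3) le)
        have "norm (iter_deriv vs f x) \<le> (SUP x\<in>K. norm c * norm (iter_deriv vs f x)) / norm c" if "x \<in> K" for x
        proof -
          have "norm c * norm (iter_deriv vs f x) \<le> (SUP x\<in>K. norm c * norm (iter_deriv vs f x))"
            by (intro cSUP_upper that bdd_aboveI2[where M = "norm c * ?q f"] le)
          then show ?thesis using False by (simp add: pos_le_divide_eq mult.commute)
        qed
        then have "?q f \<le> (SUP x\<in>K. norm c * norm (iter_deriv vs f x)) / norm c"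
          by (intro cSUP_least K(3))
        then show "norm c * ?q f \<le> (SUP x\<in>K. norm c * norm (iter_deriv vs f x))"
          using False by (simp add: pos_le_divide_eq mult.commute)
      qed
      finally show ?thesis .
    qed
  next
    fix f g assume "f \<in> V" "g \<in> V"
    then have f: "f \<in> Cinf S" and g: "g \<in> Cinf S" using V by auto
    show "?q (\<lambda>x. f x + g x) \<le> ?q f + ?q g"
    proof (intro cSUP_least K(3))
      fix x assume x: "x \<in> K"
      then have "iter_deriv vs (\<lambda>x. f x + g x) x = iter_deriv vs f x + iter_deriv vs g x"
        using iter_deriv_lincomb[OF S f g, of x vs 1 1] K(2) by auto
      then show "norm (iter_deriv vs (\<lambda>x. f x + g x) x) \<le> ?q f + ?q g"
        using order_trans[OF norm_triangle_ineq add_mono[OF upper[OF f x] upper[OF g x]]] by simp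
    qed
  qed
  moreover have "continuous_map (subtopology (Cinf_topology S) V) euclideanreal ?q"
    unfolding continuous_map_def
  proof (intro conjI allI impI)
    let ?X = "subtopology (Cinf_topology S) V"
    fix U :: "real set" assume "openin euclideanreal U"
    then have U: "open U" by simp
    show "openin ?X {f \<in> topspace ?X. ?q f \<in> U}"
    proof (subst openin_subopen, intro ballI)
      fix f assume "f \<in> {f \<in> topspace ?X. ?q f \<in> U}"
      then have f: "f \<in> V" "?q f \<in> U" "f \<in> topspace ?X" by auto
      then have fC: "f \<in> Cinf S" using V by blast
      obtain e where e: "e > 0" "\<And>y. dist y (?q f) < e \<Longrightarrow> y \<in> U" using U f(2) unfolding open_dist by metis
      define N where "N = {g \<in> Cinf S. \<forall>x\<in>K. norm (iter_deriv vs (\<lambda>y. g y - f y) x) < e / 2}"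
      have "openin (Cinf_topology S) N"
        unfolding Cinf_topology_def N_def using fC K(1,2) e(1)
        by (intro topology_generated_by_Basis CollectI exI[of _ f] exI[of _ K] exI[of _ vs] exI[of _ "e / 2"]) auto
      then have "openin ?X (N \<inter> V)" by (auto simp: openin_subtopology)
      moreover have zero: "iter_deriv vs (\<lambda>y. f y - f y) x = 0" if "x \<in> K" for x
        using iter_deriv_lincomb[OF S fC fC, of x vs 1 "-1"] that K(2) by auto
      have "f \<in> N \<inter> V" using fC f(1) e(1) zero by (simp add: N_def)
      moreover have "?q g \<in> U" if g: "g \<in> N \<inter> V" for g
      proof -
        have gC: "g \<in> Cinf S" using g by (simp add: N_def)
        have close: "norm (iter_deriv vs g x - iter_deriv vs f x) \<le> e / 2" if "x \<in> K" for x
        proof -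
          have "iter_deriv vs (\<lambda>y. g y - f y) x = iter_deriv vs g x - iter_deriv vs f x"
            using iter_deriv_lincomb[OF S gC fC, of x vs 1 "-1"] that K(2) by auto
          then show ?thesis using g that by (auto simp: N_def intro: less_imp_le)
        qed
        have "?q g \<le> ?q f + e / 2"
        proof (intro cSUP_least K(3))
          fix x assume x: "x \<in> K"
          show "norm (iter_deriv vs g x) \<le> ?q f + e / 2"
            using close[OF x] upper[OF fC x] norm_triangle_ineq2[of "iter_deriv vs g x" "iter_deriv vs f x"] by linarith
        qed
        moreover have "?q f \<le> ?q g + e / 2"
        proof (intro cSUP_least K(3))
          fix x assume x: "x \<in> K"
          show "norm (iter_deriv vs f x) \<le> ?q g + e / 2"
            using close[OF x] upper[OF gC x] norm_triangle_ineq3[of "iter_deriv vs g x" "iter_deriv vs f x"] by linarith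
        qed
        ultimately have "dist (?q g) (?q f) < e" using e(1) by (simp add: dist_real_def abs_le_iff)
        then show ?thesis by (rule e(2))
      qed
      moreover have "N \<inter> V \<subseteq> topspace ?X" using \<open>openin ?X (N \<inter> V)\<close> by (rule openin_subset)
      ultimately show "\<exists>T. openin ?X T \<and> f \<in> T \<and> T \<subseteq> {f \<in> topspace ?X. ?q f \<in> U}" by blast
    qed
  qed simp
  ultimately show ?thesis unfolding continuous_seminorm_def by blast
qed

text \<open>Differential operators with coefficients that are polynomial in the matrix entries. The
  coefficients \<open>(g ** A) \<bullet> B\<close> are chosen such that, along a curve with \<open>\<gamma>' = \<gamma> ** J\<close>, their
  derivative has the same shape with \<open>J ** A\<close> in place of \<open>A\<close>.\<close>

inductive angular_operator ::
    "(((real ^ 'm::finite ^ 'm) \<Rightarrow> complex) \<Rightarrow> (real ^ 'm ^ 'm) \<Rightarrow> complex) \<Rightarrow> bool" where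
  iter_deriv: "angular_operator (\<lambda>f g. iter_deriv vs f g)"
| coefficient: "angular_operator T \<Longrightarrow> angular_operator (\<lambda>f g. of_real ((g ** (A :: real ^ 'm ^ 'm)) \<bullet> B) * T f g)"
| add: "angular_operator T \<Longrightarrow> angular_operator T' \<Longrightarrow> angular_operator (\<lambda>f g. T f g + T' f g)"

lemma angular_operator_zero: "angular_operator (\<lambda>f g. 0)"
  using angular_operator.coefficient[OF angular_operator.iter_deriv, where A = 0] by simp

lemma angular_operator_sum:
  "(\<And>i. i \<in> I \<Longrightarrow> angular_operator (T i)) \<Longrightarrow> angular_operator (\<lambda>f g. \<Sum>i\<in>I. T i f g)"
  by (induction I rule: infinite_finite_induct)
     (auto intro: angular_operator_zero angular_operator.add)

lemma bounded_linear_matrix_mult_right: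
  fixes A :: "real ^ 'm::finite ^ 'm"
  shows "bounded_linear (\<lambda>g :: real ^ 'm ^ 'm. g ** A)"
  by (rule linear_conv_bounded_linear[THEN iffD1], rule linearI)
     (simp_all add: vec_eq_iff matrix_matrix_mult_def sum.distrib sum_distrib_left algebra_simps)

lemma bounded_linear_matrix_mult_left:
  fixes A :: "real ^ 'm::finite ^ 'm"
  shows "bounded_linear (\<lambda>g :: real ^ 'm ^ 'm. A ** g)"
  by (rule linear_conv_bounded_linear[THEN iffD1], rule linearI)
     (simp_all add: vec_eq_iff matrix_matrix_mult_def sum.distrib sum_distrib_left algebra_simps)

definition derivative_along_flow ::
    "real ^ 'm ^ 'm \<Rightarrow> (((real ^ 'm::finite ^ 'm) \<Rightarrow> complex) \<Rightarrow> (real ^ 'm ^ 'm) \<Rightarrow> complex) \<Rightarrow>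
     (((real ^ 'm ^ 'm) \<Rightarrow> complex) \<Rightarrow> (real ^ 'm ^ 'm) \<Rightarrow> complex) \<Rightarrow> bool" where
  "derivative_along_flow J T T' \<longleftrightarrow> (\<forall>S f \<gamma>. f \<in> Cinf S \<longrightarrow> (\<forall>\<theta>. \<gamma> \<theta> \<in> S) \<longrightarrow>
    (\<forall>\<theta>. (\<gamma> has_vector_derivative \<gamma> \<theta> ** J) (at \<theta>)) \<longrightarrow>
    (\<forall>\<theta>. ((\<lambda>\<theta>. T f (\<gamma> \<theta>)) has_vector_derivative T' f (\<gamma> \<theta>)) (at \<theta>)))"

lemma derivative_along_flowD:
  "derivative_along_flow J T T' \<Longrightarrow> f \<in> Cinf S \<Longrightarrow> (\<And>\<theta>. \<gamma> \<theta> \<in> S) \<Longrightarrow>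
    (\<And>\<theta>. (\<gamma> has_vector_derivative \<gamma> \<theta> ** J) (at \<theta>)) \<Longrightarrow>
    ((\<lambda>\<theta>. T f (\<gamma> \<theta>)) has_vector_derivative T' f (\<gamma> \<theta>)) (at \<theta>)"
  unfolding derivative_along_flow_def by simp

text \<open>By the chain rule, a derivative along the curve is a directional derivative in the direction
  \<open>\<gamma> ** J\<close>. This direction moves with the point, so it is expanded in the standard basis, which
  produces coefficients and iterated derivatives in fixed directions.\<close>

lemma angular_operator_derivative:
  fixes J :: "real ^ 'm::finite ^ 'm"
  assumes "angular_operator T"
  shows "\<exists>T'. angular_operator T' \<and> derivative_along_flow J T T'"
  using assms
proof induction
  case (iter_deriv vs)
  define T' where "T' f g = (\<Sum>B\<in>Basis. of_real ((g ** J) \<bullet> B) * iter_deriv (B # vs) f g)" for f :: "real ^ 'm ^ 'm \<Rightarrow> complex" and g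
  have "angular_operator T'"
    unfolding T'_def[abs_def] by (intro angular_operator_sum angular_operator.coefficient angular_operator.iter_deriv)
  moreover have "((\<lambda>\<theta>. iter_deriv vs f (\<gamma> \<theta>)) has_vector_derivative T' f (\<gamma> \<theta>)) (at \<theta>)"
    if f: "f \<in> Cinf S" and \<gamma>: "\<gamma> \<theta> \<in> S" "(\<gamma> has_vector_derivative \<gamma> \<theta> ** J) (at \<theta>)" for S f \<gamma> \<theta>
  proof -
    let ?D = "\<lambda>v. iter_deriv (v # vs) f (\<gamma> \<theta>)"
    have D: "(iter_deriv vs f has_derivative ?D) (at (\<gamma> \<theta>))" by (rule Cinf_has_derivative[OF f \<gamma>(1)])
    interpret D: bounded_linear ?D by (rule has_derivative_bounded_linear[OF D])
    have "?D (\<gamma> \<theta> ** J) = ?D (\<Sum>B\<in>Basis. ((\<gamma> \<theta> ** J) \<bullet> B) *\<^sub>R B)"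
      by (simp add: euclidean_representation)
    also have "\<dots> = T' f (\<gamma> \<theta>)" unfolding T'_def D.sum D.scaleR by (simp add: scaleR_conv_of_real)
    finally have "?D (\<gamma> \<theta> ** J) = T' f (\<gamma> \<theta>)" .
    moreover have "((\<lambda>\<theta>. iter_deriv vs f (\<gamma> \<theta>)) has_derivative (\<lambda>h. ?D (h *\<^sub>R (\<gamma> \<theta> ** J)))) (at \<theta>)"
      using has_derivative_compose[OF \<gamma>(2)[unfolded has_vector_derivative_def] D] .
    ultimately show ?thesis unfolding has_vector_derivative_def D.scaleR by simp
  qed
  ultimately show ?case unfolding derivative_along_flow_def by blast
next
  case (coefficient T A B)
  then obtain T' where T': "angular_operator T'" "derivative_along_flow J T T'" by blast
  let ?T = "\<lambda>f g. of_real ((g ** A) \<bullet> B) * T' f g + of_real ((g ** (J ** A)) \<bullet> B) * T f g"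
  have "((\<lambda>\<theta>. of_real ((\<gamma> \<theta> ** A) \<bullet> B) * T f (\<gamma> \<theta>)) has_vector_derivative ?T f (\<gamma> \<theta>)) (at \<theta>)"
    if "f \<in> Cinf S" "\<And>\<theta>. \<gamma> \<theta> \<in> S" and \<gamma>: "\<And>\<theta>. (\<gamma> has_vector_derivative \<gamma> \<theta> ** J) (at \<theta>)" for S f \<gamma> \<theta>
  proof -
    have lin: "bounded_linear (\<lambda>g. complex_of_real ((g ** A) \<bullet> B))"
      by (intro bounded_linear_compose[OF bounded_linear_of_real] bounded_linear_compose[OF bounded_linear_inner_left]
          bounded_linear_matrix_mult_right)
    have "((\<lambda>\<theta>. complex_of_real ((\<gamma> \<theta> ** A) \<bullet> B)) has_vector_derivative of_real ((\<gamma> \<theta> ** J ** A) \<bullet> B)) (at \<theta>)"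
      using bounded_linear.has_vector_derivative[OF lin \<gamma>] .
    from has_vector_derivative_mult[OF this derivative_along_flowD[OF T'(2) that]] show ?thesis
      by (simp add: matrix_mul_assoc)
  qed
  moreover have "angular_operator ?T"
    by (intro angular_operator.add angular_operator.coefficient coefficient.hyps T'(1))
  ultimately show ?case unfolding derivative_along_flow_def by (intro exI[of _ ?T]) blast
next
  case (add T1 T2)
  then obtain T1' T2' where T1': "angular_operator T1'" "derivative_along_flow J T1 T1'"
    and T2': "angular_operator T2'" "derivative_along_flow J T2 T2'" by blast
  have "derivative_along_flow J (\<lambda>f g. T1 f g + T2 f g) (\<lambda>f g. T1' f g + T2' f g)"
    using T1'(2) T2'(2) unfolding derivative_along_flow_def by (auto intro: has_vector_derivative_add)
  moreover have "angular_operator (\<lambda>f g. T1' f g + T2' f g)" by (intro angular_operator.add T1'(1) T2'(1))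
  ultimately show ?case by (intro exI[of _ "\<lambda>f g. T1' f g + T2' f g"]) blast
qed

lemma angular_operator_sequence:
  fixes J :: "real ^ 'm::finite ^ 'm"
  shows "\<exists>D. D 0 = (\<lambda>f g. f g) \<and> (\<forall>j. angular_operator (D j) \<and> derivative_along_flow J (D j) (D (Suc j)))"
proof -
  define D where "D = rec_nat (\<lambda>f g. f g)
    (\<lambda>_ T. SOME T'. angular_operator T' \<and> derivative_along_flow J T T')"
  have D0: "D 0 = (\<lambda>f g. f g)" by (simp add: D_def)
  have step: "angular_operator (D (Suc j)) \<and> derivative_along_flow J (D j) (D (Suc j))"
    if "angular_operator (D j)" for j
    using someI_ex[OF angular_operator_derivative[OF that, of J]] by (simp add: D_def)
  have "angular_operator (D j)" for j
  proof (induction j)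
    case 0
    show ?case unfolding D0 using angular_operator.iter_deriv[of "[]"] by simp
  qed (use step in simp)
  then show ?thesis using D0 step by (intro exI[of _ D]) simp
qed

lemma angular_operator_bound:
  fixes V :: "(real ^ 'm::finite ^ 'm \<Rightarrow> complex) set"
  assumes S: "open S" and V: "V \<subseteq> Cinf S" and K: "compact K" "K \<subseteq> S" "K \<noteq> {}"
    and T: "angular_operator T"
  shows "\<exists>q. continuous_seminorm S V q \<and> (\<forall>f\<in>V. \<forall>g\<in>K. norm (T f g) \<le> q f)"
  using T
proof induction
  case (iter_deriv vs)
  have "norm (iter_deriv vs f x) \<le> (SUP x\<in>K. norm (iter_deriv vs f x))" if "f \<in> V" "x \<in> K" for f x
    using that V by (intro cSUP_upper iter_deriv_bounded_on_compact[OF _ K(1,2)]) auto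
  then show ?case
    using continuous_seminorm_SUP_iter_deriv[OF S V K, of vs] by blast
next
  case (coefficient T A B)
  then obtain q where q: "continuous_seminorm S V q" "\<forall>f\<in>V. \<forall>g\<in>K. norm (T f g) \<le> q f" by blast
  have "compact ((\<lambda>g. (g ** A) \<bullet> B) ` K)"
    by (intro compact_continuous_image K(1) linear_continuous_on
        bounded_linear_compose[OF bounded_linear_inner_left] bounded_linear_matrix_mult_right)
  then obtain C where "\<forall>y\<in>(\<lambda>g. (g ** A) \<bullet> B) ` K. norm y \<le> C"
    using compact_imp_bounded bounded_iff by metis
  then have C: "\<bar>(g ** A) \<bullet> B\<bar> \<le> \<bar>C\<bar>" if "g \<in> K" for g using that by fastforce
  have "norm (of_real ((g ** A) \<bullet> B) * T f g) \<le> \<bar>C\<bar> * q f" if "f \<in> V" "g \<in> K" for f g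
    unfolding norm_mult norm_of_real using C q(2) that by (intro mult_mono) auto
  then show ?case using continuous_seminorm_scale[OF q(1) abs_ge_zero[of C]]
    by (intro exI[of _ "\<lambda>f. \<bar>C\<bar> * q f"] conjI ballI)
next
  case (add T1 T2)
  then obtain q1 q2 where q1: "continuous_seminorm S V q1" "\<forall>f\<in>V. \<forall>g\<in>K. norm (T1 f g) \<le> q1 f"
    and q2: "continuous_seminorm S V q2" "\<forall>f\<in>V. \<forall>g\<in>K. norm (T2 f g) \<le> q2 f" by blast
  have "norm (T1 f g + T2 f g) \<le> q1 f + q2 f" if "f \<in> V" "g \<in> K" for f g
    using q1(2) q2(2) that by (intro norm_triangle_le add_mono) auto
  then show ?case using continuous_seminorm_add[OF q1(1) q2(1)]
    by (intro exI[of _ "\<lambda>f. q1 f + q2 f"] conjI ballI)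
qed

section \<open>Rotations and shears\<close>

definition plane_matrix :: "real \<Rightarrow> real \<Rightarrow> real \<Rightarrow> real \<Rightarrow> ('n::{finite,linorder}) mat2" where
  "plane_matrix a b c d = (\<chi> i j.
     if i = idx_n then (if j = idx_n then a else if j = idx_2n then b else 0)
     else if i = idx_2n then (if j = idx_n then c else if j = idx_2n then d else 0)
     else if i = j then 1 else 0)"

abbreviation rotation :: "real \<Rightarrow> ('n::{finite,linorder}) mat2" where
  "rotation \<theta> \<equiv> plane_matrix (cos \<theta>) (- sin \<theta>) (sin \<theta>) (cos \<theta>)"

lemma idx_n_neq_idx_2n [simp]: "idx_n \<noteq> idx_2n" "idx_2n \<noteq> idx_n"
  by (simp_all add: idx_n_def idx_2n_def)

lemma mult_plane_matrix_nth:
  "(M ** plane_matrix a b c d) $ i $ j =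
     (if j = idx_n then a * M $ i $ idx_n + c * M $ i $ idx_2n
      else if j = idx_2n then b * M $ i $ idx_n + d * M $ i $ idx_2n else M $ i $ j)"
proof -
  let ?P = "plane_matrix a b c d :: 'a mat2"
  have "(M ** ?P) $ i $ j = (\<Sum>k\<in>UNIV. M $ i $ k * ?P $ k $ j)"
    by (simp add: matrix_matrix_mult_def)
  also have "\<dots> = (\<Sum>k\<in>UNIV. (if k = idx_n then M $ i $ idx_n * ?P $ idx_n $ j else 0)
       + (if k = idx_2n then M $ i $ idx_2n * ?P $ idx_2n $ j else 0)
       + (if k = j \<and> j \<noteq> idx_n \<and> j \<noteq> idx_2n then M $ i $ j else 0))"
    by (rule sum.cong) (auto simp: plane_matrix_def)
  also have "\<dots> = M $ i $ idx_n * ?P $ idx_n $ j + M $ i $ idx_2n * ?P $ idx_2n $ j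
      + (if j \<noteq> idx_n \<and> j \<noteq> idx_2n then M $ i $ j else 0)"
    by (simp add: sum.distrib)
  also have "\<dots> = (if j = idx_n then a * M $ i $ idx_n + c * M $ i $ idx_2n
      else if j = idx_2n then b * M $ i $ idx_n + d * M $ i $ idx_2n else M $ i $ j)"
    by (simp add: plane_matrix_def)
  finally show ?thesis .
qed

lemma plane_matrix_mult:
  "plane_matrix a b c d ** plane_matrix a' b' c' d' =
     plane_matrix (a * a' + b * c') (a * b' + b * d') (c * a' + d * c') (c * b' + d * d')"
  unfolding vec_eq_iff mult_plane_matrix_nth by (auto simp: plane_matrix_def)

lemma transpose_plane_matrix: "transpose (plane_matrix a b c d) = plane_matrix a c b d"
  by (auto simp: vec_eq_iff transpose_def plane_matrix_def)

lemma plane_matrix_1: "plane_matrix 1 0 0 1 = mat 1"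
  by (auto simp: vec_eq_iff mat_def plane_matrix_def)

lemma shear_eq_plane_matrix: "mat 1 + t *\<^sub>R elem_mat idx_2n idx_n = plane_matrix 1 0 t 1"
  by (auto simp: vec_eq_iff mat_def plane_matrix_def elem_mat_def)

lemma orthogonal_rotation: "orthogonal_matrix (rotation \<theta>)"
proof -
  have "cos \<theta> * cos \<theta> + sin \<theta> * sin \<theta> = 1" using sin_cos_squared_add2[of \<theta>] by (simp add: power2_eq_square)
  then show ?thesis
    unfolding orthogonal_matrix transpose_plane_matrix plane_matrix_mult
    by (simp add: plane_matrix_1[symmetric] mult.commute add.commute)
qed

lemma rotation_has_vector_derivative:
  fixes X :: "('n::{finite,linorder}) mat2"
  shows "((\<lambda>\<theta>. X ** rotation \<theta>) has_vector_derivative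
           X ** rotation \<theta> ** (elem_mat idx_2n idx_n - elem_mat idx_n idx_2n)) (at \<theta>)"
proof -
  let ?P = "elem_mat idx_n idx_n + elem_mat idx_2n idx_2n :: 'n mat2"
  let ?J = "elem_mat idx_2n idx_n - elem_mat idx_n idx_2n :: 'n mat2"
  have elem: "(M ** elem_mat p q) $ i $ j = (if j = q then M $ i $ p else 0)" for M :: "'n mat2" and p q i j
    by (auto simp: matrix_matrix_mult_def elem_mat_def if_distrib[of "\<lambda>x. _ * x"] cong: if_cong)
  have diff: "M ** (A - B) = M ** A - M ** B" for M A B :: "'n mat2"
    by (simp add: vec_eq_iff matrix_matrix_mult_def sum_subtractf right_diff_distrib)
  have J: "rotation \<theta> ** ?J = (- sin \<theta>) *\<^sub>R ?P + cos \<theta> *\<^sub>R ?J"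
    unfolding diff by (auto simp: vec_eq_iff elem) (auto simp: plane_matrix_def elem_mat_def)
  have rot: "rotation \<theta> = (mat 1 - ?P) + (cos \<theta> *\<^sub>R ?P + sin \<theta> *\<^sub>R ?J)" for \<theta>
    by (auto simp: vec_eq_iff mat_def plane_matrix_def elem_mat_def)
  have "((\<lambda>\<theta>. (mat 1 - ?P) + (cos \<theta> *\<^sub>R ?P + sin \<theta> *\<^sub>R ?J)) has_vector_derivative
      0 + ((- sin \<theta>) *\<^sub>R ?P + cos \<theta> *\<^sub>R ?J)) (at \<theta>)"
    using has_vector_derivative_scaleR[OF DERIV_cos has_vector_derivative_const[of ?P]]
      has_vector_derivative_scaleR[OF DERIV_sin has_vector_derivative_const[of ?J]]
    by (intro has_vector_derivative_add has_vector_derivative_const) auto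
  then have "(rotation has_vector_derivative rotation \<theta> ** ?J) (at \<theta>)"
    unfolding rot[symmetric] J[symmetric] by simp
  from bounded_linear.has_vector_derivative[OF bounded_linear_matrix_mult_left this]
  show ?thesis by (simp add: matrix_mul_assoc)
qed

lemma exp_lcos_eq_cos_arctan: "exp (lcos t) = cos (arctan t)"
proof -
  have "exp (lcos t) = exp (- ln (sqrt (1 + t\<^sup>2)))"
    using one_plus_sq_pos[of t] by (simp add: ln_cos_arctan_def ln_sqrt)
  also have "\<dots> = 1 / sqrt (1 + t\<^sup>2)"
    using one_plus_sq_pos[of t] by (simp add: exp_minus inverse_eq_divide)
  finally show ?thesis by (simp add: cos_arctan)
qed

definition diag_last :: "real \<Rightarrow> real ^ ('n::{finite,linorder}) ^ ('n::{finite,linorder})" where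
  "diag_last x = (\<chi> i j. if i = j then if i = Max UNIV then x else 1 else 0)"

lemma det_diag_last: "det (diag_last x) = x"
  by (subst det_diagonal) (simp_all add: diag_last_def)

text \<open>In the plane of the two distinguished coordinates, \<open>((1,0),(t,1)) = ((c,-s),(s,c)) ((1/c,s),(0,c))\<close>
  with \<open>c = cos (arctan t)\<close> and \<open>s = sin (arctan t) = t c\<close>.\<close>

lemma shear_decomposition:
  "(mat 1 + t *\<^sub>R elem_mat idx_2n idx_n :: ('n::{finite,linorder}) mat2) =
     rotation (arctan t) ** upper_block (diag_last (1 / cos (arctan t)))
       (\<chi> i j. if i = Max UNIV \<and> j = Max UNIV then sin (arctan t) else 0) (diag_last (cos (arctan t)))"
proof -
  define c where "c = cos (arctan t)"
  define s where "s = sin (arctan t)"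
  have c: "c > 0" and s: "s = t * c" and cs: "s * s + c * c = 1"
    using cos_arctan_not_zero[of t] tan_arctan[of t] cos_gt_zero_pi[of "arctan t"] arctan_bounded[of t]
      sin_cos_squared_add[of "arctan t"]
    by (auto simp: c_def s_def tan_def field_simps power2_eq_square)
  have "upper_block (diag_last (1 / c)) (\<chi> i j. if i = Max UNIV \<and> j = Max UNIV then s else 0) (diag_last c)
      = (plane_matrix (1 / c) s 0 c :: 'n mat2)"
    by (simp add: vec_eq_iff upper_block_def plane_matrix_def diag_last_def idx_n_def idx_2n_def split: sum.splits)
  moreover have "plane_matrix c (- s) s c ** plane_matrix (1 / c) s 0 c = (plane_matrix 1 0 t 1 :: 'n mat2)"
    unfolding plane_matrix_mult using c cs by (simp add: s)
  ultimately have "rotation (arctan t) ** upper_block (diag_last (1 / c)) (\<chi> i j. if i = Max UNIV \<and> j = Max UNIV then s else 0)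
      (diag_last c) = (plane_matrix 1 0 t 1 :: 'n mat2)"
    by (simp only: c_def s_def)
  then show ?thesis by (simp only: shear_eq_plane_matrix c_def s_def)
qed

lemma signed_power_pos: "x > 0 \<Longrightarrow> signed_power \<epsilon> \<mu> x = exp (\<mu> * of_real (ln x))"
  by (simp add: signed_power_def powr_def Ln_of_real)

lemma prin_shear:
  fixes X :: "('n::{finite,linorder}) mat2"
  assumes f: "f \<in> prin \<xi>\<^sub>1 \<xi>\<^sub>2 \<mu>\<^sub>1 \<mu>\<^sub>2" and X: "X \<in> GL"
  shows "f (X ** (mat 1 + t *\<^sub>R elem_mat idx_2n idx_n)) =
    exp ((\<mu>\<^sub>1 - \<mu>\<^sub>2 + of_nat CARD('n)) * of_real (lcos t)) * f (X ** rotation (arctan t))"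
proof -
  let ?c = "cos (arctan t)"
  have c: "?c > 0" using exp_lcos_eq_cos_arctan[of t] by (metis exp_gt_zero)
  have ln: "ln ?c = lcos t" "ln (1 / ?c) = - lcos t"
    using c by (simp_all add: exp_lcos_eq_cos_arctan[symmetric] flip: exp_minus inverse_eq_divide)
  have GL: "X ** rotation (arctan t) \<in> GL" "diag_last ?c \<in> GL" "diag_last (1 / ?c) \<in> GL"
    using X c orthogonal_matrix_GL[OF orthogonal_rotation] by (simp_all add: GL_mult_iff, simp_all add: GL_iff_det det_diag_last)
  have "f (X ** (mat 1 + t *\<^sub>R elem_mat idx_2n idx_n)) =
      signed_power \<xi>\<^sub>1 (- \<mu>\<^sub>1 - of_nat CARD('n) / 2) (1 / ?c) *
      signed_power \<xi>\<^sub>2 (- \<mu>\<^sub>2 + of_nat CARD('n) / 2) ?c * f (X ** rotation (arctan t))"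
    unfolding shear_decomposition matrix_mul_assoc prin_equivariant[OF f GL(1,3,2)] det_diag_last ..
  also have "signed_power \<xi>\<^sub>1 (- \<mu>\<^sub>1 - of_nat CARD('n) / 2) (1 / ?c) * signed_power \<xi>\<^sub>2 (- \<mu>\<^sub>2 + of_nat CARD('n) / 2) ?c
      = exp ((\<mu>\<^sub>1 - \<mu>\<^sub>2 + of_nat CARD('n)) * of_real (lcos t))"
    using c by (simp add: signed_power_pos ln algebra_simps flip: exp_add)
  finally show ?thesis .
qed

lemma set_integral_punctured_line:
  fixes g :: "real \<Rightarrow> complex"
  assumes "set_integrable lborel {0<..} g" "set_integrable lborel {0<..} (\<lambda>t. g (- t))"
  shows "(LINT t:- {0}|lborel. g t) = (LINT t:{0<..}|lborel. g t) + (LINT t:{0<..}|lborel. g (- t))"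
proof -
  have ind: "indicator {0<..} (0 + (- 1) * t) *\<^sub>R g (- (0 + (- 1) * t)) = indicator {..<0} t *\<^sub>R g t" for t :: real
    by (simp add: indicator_def)
  have neg: "set_integrable lborel {..<0} g"
    using lborel_integrable_real_affine[OF assms(2)[unfolded set_integrable_def], of "-1" 0]
    unfolding set_integrable_def ind by simp
  have "(LINT t:{0<..}|lborel. g (- t)) = (LINT t:{..<0}|lborel. g t)"
    using lborel_integral_real_affine[of "-1" "\<lambda>t. indicator {0<..} t *\<^sub>R g (- t)" 0]
    unfolding set_lebesgue_integral_def ind by simp
  moreover have "(LINT t:- {0}|lborel. g t) = (LINT t:{0<..}|lborel. g t) + (LINT t:{..<0}|lborel. g t)"
  proof -
    have "- {0} = {0<..} \<union> {..<(0::real)}" and disj: "{0<..} \<inter> {..<(0::real)} = {}" by auto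
    then show ?thesis by (simp only: set_integral_Un[OF disj assms(1) neg])
  qed
  ultimately show ?thesis by simp
qed

text \<open>Substitution of \<open>r t\<close> for \<open>t\<close> in the measure \<open>dt / \<bar>t\<bar>\<close>, which is invariant under scaling.\<close>

lemma set_integral_mellin_scale:
  fixes \<phi> :: "real \<Rightarrow> complex"
  assumes r: "r > 0"
  shows "(LINT t:- {0}|lborel. signed_power \<epsilon> a t * \<phi> (r * t) / of_real \<bar>t\<bar>) =
    exp (- a * of_real (ln r)) * (LINT t:- {0}|lborel. signed_power \<epsilon> a t * \<phi> t / of_real \<bar>t\<bar>)"
proof -
  have sp: "signed_power \<epsilon> a (r * t) = exp (a * of_real (ln r)) * signed_power \<epsilon> a t" if "t \<noteq> 0" for t
  proof -
    have "of_real \<bar>r * t\<bar> powr a = of_real r powr a * of_real \<bar>t\<bar> powr a"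
      using of_real_mult_powr[of r "\<bar>t\<bar>" a] r that by (simp add: abs_mult)
    moreover have "of_real r powr a = exp (a * of_real (ln r))" using r by (simp add: powr_def Ln_of_real)
    moreover have "sgn (r * t) = sgn t" using r by (simp add: sgn_mult)
    ultimately show ?thesis by (simp add: signed_power_def)
  qed
  have "(LINT t:- {0}|lborel. signed_power \<epsilon> a t * \<phi> t / of_real \<bar>t\<bar>) =
     r *\<^sub>R (LINT t|lborel. indicator (- {0}) (0 + r * t) *\<^sub>R (signed_power \<epsilon> a (0 + r * t) * \<phi> (0 + r * t) / of_real \<bar>0 + r * t\<bar>))"
    unfolding set_lebesgue_integral_def
    using r by (subst lborel_integral_real_affine[of r _ 0]) auto
  also have "\<dots> = (LINT t:- {0}|lborel. exp (a * of_real (ln r)) * (signed_power \<epsilon> a t * \<phi> (r * t) / of_real \<bar>t\<bar>))"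
    unfolding set_lebesgue_integral_def integral_scaleR_right[symmetric]
    using r by (intro Bochner_Integration.integral_cong refl)
      (auto simp: indicator_def sp abs_mult scaleR_conv_of_real)
  also have "\<dots> = exp (a * of_real (ln r)) * (LINT t:- {0}|lborel. signed_power \<epsilon> a t * \<phi> (r * t) / of_real \<bar>t\<bar>)"
    by (rule set_integral_mult_right)
  finally have eq: "(LINT t:- {0}|lborel. signed_power \<epsilon> a t * \<phi> t / of_real \<bar>t\<bar>) =
      exp (a * of_real (ln r)) * (LINT t:- {0}|lborel. signed_power \<epsilon> a t * \<phi> (r * t) / of_real \<bar>t\<bar>)" .
  show ?thesis unfolding eq by (simp flip: mult.assoc exp_add)
qed

section \<open>The operator as an angular transform\<close>

lemma GL_corner_GL: "X \<in> GL_corner \<Longrightarrow> X \<in> GL"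
  by (simp add: GL_corner_def)

lemma GL_corner_column: "X \<in> GL_corner \<Longrightarrow> X $ i $ idx_2n = (if i = idx_2n then 1 else 0)"
  and GL_corner_row: "X \<in> GL_corner \<Longrightarrow> X $ idx_2n $ i = (if i = idx_2n then 1 else 0)"
  by (auto simp: GL_corner_def)

text \<open>The \<open>n\<close>-th column of \<open>X\<close> is a unit vector orthogonal to the preceding ones. A rotation in the
  plane of that column and the \<open>2n\<close>-th one, itself a unit vector orthogonal to all others, then
  does not change the Gram matrix of the first \<open>n\<close> columns.\<close>

definition adapted :: "('n::{finite,linorder}) mat2 \<Rightarrow> bool" where
  "adapted X \<longleftrightarrow> X \<in> GL_corner \<and>
     (\<forall>i. column_gram X $ i $ Max UNIV = (if i = Max UNIV then 1 else 0))"

lemma column_gram_rotation: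
  fixes X :: "('n::{finite,linorder}) mat2"
  assumes X: "adapted X"
  shows "column_gram (X ** rotation \<theta>) = column_gram X"
proof -
  let ?N = "Max UNIV :: 'n"
  have XC: "X \<in> GL_corner" using X by (simp add: adapted_def)
  have gram: "column (Inl i) X \<bullet> column idx_n X = (if i = ?N then 1 else 0)" for i
    using X by (simp add: adapted_def column_gram_def idx_n_def)
  have col: "column (Inl j) (X ** rotation \<theta>) =
      (if j = ?N then cos \<theta> *\<^sub>R column idx_n X + sin \<theta> *\<^sub>R column idx_2n X else column (Inl j) X)" for j
    by (auto simp: vec_eq_iff column_def mult_plane_matrix_nth) (auto simp: idx_n_def idx_2n_def)
  have "column idx_2n X = axis idx_2n 1"
    using GL_corner_column[OF XC] by (simp add: vec_eq_iff column_def axis_def)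
  then have e: "column idx_2n X \<bullet> v = v $ idx_2n" for v by (simp add: inner_axis')
  have e0: "column (Inl j) X $ idx_2n = 0" "column idx_n X $ idx_2n = 0" "column idx_2n X $ idx_2n = 1" for j
    using GL_corner_row[OF XC] by (simp_all add: column_def idx_2n_def idx_n_def)
  have "column (Inl i) (X ** rotation \<theta>) \<bullet> column (Inl j) (X ** rotation \<theta>) = column (Inl i) X \<bullet> column (Inl j) X" for i j
  proof -
    have N: "column (Inl ?N) X = column idx_n X" by (simp add: idx_n_def)
    note inn = e e0 inner_commute[of _ "column idx_2n X"] gram gram[of ?N, unfolded N]
      inner_commute[of "column idx_n X" "column (Inl k) X" for k]
    show ?thesis
      unfolding col using sin_cos_squared_add2[of \<theta>] gram[of ?N]
      by (auto simp: inner_add_left inner_add_right inn N)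
  qed
  then show ?thesis by (simp add: column_gram_def)
qed

lemma section_factor_rotation:
  fixes X :: "('n::{finite,linorder}) mat2"
  assumes "adapted X"
  shows "section_factor r s (X ** rotation \<theta>) = section_factor r s X"
proof -
  have "det (rotation \<theta> :: 'n mat2) = 1 \<or> det (rotation \<theta> :: 'n mat2) = - 1"
    by (intro det_orthogonal_matrix orthogonal_rotation)
  then have "(det (rotation \<theta> :: 'n mat2))\<^sup>2 = 1" by auto
  then show ?thesis
    by (simp add: section_factor_def column_gram_rotation[OF assms] det_mul power_mult_distrib)
qed

lemma signed_power_neg:
  "t > 0 \<Longrightarrow> signed_power \<epsilon> \<mu> (- t) = (if \<epsilon> = 0 then 1 else - 1) * signed_power \<epsilon> \<mu> t"
  by (simp add: signed_power_def)

text \<open>On the negative half-line the substitution of \<open>- t\<close> for \<open>t\<close> reverses the angle and produces the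
  sign of the character, hence the second transform \<open>\<Psi>\<close>.\<close>

lemma B_family_adapted:
  fixes f :: "('n::{finite,linorder}) mat2 \<Rightarrow> complex" and z :: "complex ^ 3"
  defines "a \<equiv> z $ 1 - z $ 3 + of_real (real CARD('n) / 2)"
    and "b \<equiv> z $ 3 - z $ 2 + of_real (real CARD('n) / 2)"
  assumes f: "f \<in> prin \<xi>\<^sub>1 \<xi>\<^sub>2 \<mu>\<^sub>1 \<mu>\<^sub>2" and X: "adapted X"
    and \<Phi>: "derivative_sequence \<Phi>" "\<And>\<theta>. \<Phi> 0 \<theta> = f (X ** rotation \<theta>)"
    and \<Psi>: "derivative_sequence \<Psi>" "\<And>\<theta>. \<Psi> 0 \<theta> = f (X ** rotation (- \<theta>))"
    and z: "Re a > 0" "Re b > 0"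
  shows "B_family \<xi>\<^sub>1 \<xi>\<^sub>2 \<eta> f X z =
    section_factor ((\<mu>\<^sub>1 - z $ 1) - (\<mu>\<^sub>2 - z $ 2)) (\<mu>\<^sub>2 - z $ 2) X *
      (angular_transform \<Phi> 0 a b + (if \<xi>\<^sub>1 + \<eta> = 0 then 1 else - 1) * angular_transform \<Psi> 0 a b)"
proof -
  define C where "C = section_factor ((\<mu>\<^sub>1 - z $ 1) - (\<mu>\<^sub>2 - z $ 2)) (\<mu>\<^sub>2 - z $ 2) X"
  define f' where "f' = compact_section \<xi>\<^sub>1 \<xi>\<^sub>2 (z $ 1) (z $ 2) f"
  define \<sigma> :: complex where "\<sigma> = (if \<xi>\<^sub>1 + \<eta> = 0 then 1 else - 1)"
  have f'_eq: "f' = (\<lambda>g. f g * section_factor ((\<mu>\<^sub>1 - z $ 1) - (\<mu>\<^sub>2 - z $ 2)) (\<mu>\<^sub>2 - z $ 2) g)"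
    unfolding f'_def by (rule compact_section_eq[OF f])
  have f': "f' \<in> prin \<xi>\<^sub>1 \<xi>\<^sub>2 (z $ 1) (z $ 2)"
    unfolding f'_eq by (rule section_factor_prin[OF f])
  have XGL: "X \<in> GL" using X by (simp add: adapted_def GL_corner_GL)
  have rot: "f' (X ** rotation \<theta>) = C * f (X ** rotation \<theta>)" for \<theta>
    by (simp add: f'_eq C_def section_factor_rotation[OF X])
  have a': "z $ 1 - z $ 3 + of_nat CARD('n) / 2 = a" by (simp add: a_def)
  define g where "g t = signed_power (\<xi>\<^sub>1 + \<eta>) a t *
        f' (X ** (mat 1 + t *\<^sub>R elem_mat idx_2n idx_n)) / of_real \<bar>t\<bar>" for t
  have kernel: "signed_power (\<xi>\<^sub>1 + \<eta>) a t * exp ((z $ 1 - z $ 2 + of_nat CARD('n)) * of_real (lcos t)) / of_real t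
      = beta_kernel a b t" if t: "t > 0" for t
  proof -
    have ab: "z $ 1 - z $ 2 + of_nat CARD('n) = a + b" by (simp add: a_def b_def)
    have ln: "ln t = lsin t - lcos t" by (simp add: ln_sin_arctan_def ln_cos_arctan_def)
    have "complex_of_real t = exp (of_real (ln t))" using t by (simp add: exp_of_real)
    then have "signed_power (\<xi>\<^sub>1 + \<eta>) a t * exp ((a + b) * of_real (lcos t)) / of_real t =
        exp (a * of_real (ln t) + (a + b) * of_real (lcos t) - of_real (ln t))"
      by (simp add: signed_power_pos[OF t] exp_add exp_diff)
    also have "a * of_real (ln t) + (a + b) * of_real (lcos t) - of_real (ln t) =
        (a - 1) * of_real (lsin t) + (b + 1) * of_real (lcos t)"
      unfolding ln by (simp add: algebra_simps)
    finally show ?thesis unfolding ab beta_kernel_def .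
  qed
  have lcos_neg: "lcos (- t) = lcos t" for t by (simp add: ln_cos_arctan_def)
  have g_pos: "g t = C * (beta_kernel a b t * \<Phi> 0 (arctan t))" if t: "t > 0" for t
    unfolding g_def prin_shear[OF f' XGL] rot kernel[OF t, symmetric] \<Phi>(2) using t by simp
  have g_neg: "g (- t) = C * (\<sigma> * (beta_kernel a b t * \<Psi> 0 (arctan t)))" if t: "t > 0" for t
    unfolding g_def prin_shear[OF f' XGL] rot kernel[OF t, symmetric] \<Psi>(2) lcos_neg
      signed_power_neg[OF t] \<sigma>_def[symmetric] arctan_minus
    using t by simp
  note int = angular_transform_integrable[OF \<Phi>(1) z, of 0] angular_transform_integrable[OF \<Psi>(1) z, of 0]
  have "set_integrable lborel {0<..} (\<lambda>t. C * (beta_kernel a b t * \<Phi> 0 (arctan t)))"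
    using int(1) by simp
  then have int_pos: "set_integrable lborel {0<..} g"
    by (rule set_integrable_cong[THEN iffD1, rotated -1]) (auto simp: g_pos)
  have "set_integrable lborel {0<..} (\<lambda>t. C * (\<sigma> * (beta_kernel a b t * \<Psi> 0 (arctan t))))"
    using int(2) by simp
  then have int_neg: "set_integrable lborel {0<..} (\<lambda>t. g (- t))"
    by (rule set_integrable_cong[THEN iffD1, rotated -1]) (auto simp: g_neg)
  have "B_family \<xi>\<^sub>1 \<xi>\<^sub>2 \<eta> f X z = (LINT t:- {0}|lborel. g t)"
    unfolding B_family_def B_integral_def f'_def[symmetric] a' g_def ..
  also have "\<dots> = (LINT t:{0<..}|lborel. g t) + (LINT t:{0<..}|lborel. g (- t))"
    by (rule set_integral_punctured_line[OF int_pos int_neg])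
  also have "(LINT t:{0<..}|lborel. g t) = (LINT t:{0<..}|lborel. C * (beta_kernel a b t * \<Phi> 0 (arctan t)))"
    by (rule set_lebesgue_integral_cong) (auto simp: g_pos)
  also have "(LINT t:{0<..}|lborel. g (- t)) = (LINT t:{0<..}|lborel. C * (\<sigma> * (beta_kernel a b t * \<Psi> 0 (arctan t))))"
    by (rule set_lebesgue_integral_cong) (auto simp: g_neg)
  finally show ?thesis
    unfolding beta_transform_def C_def[symmetric] \<sigma>_def[symmetric] by (simp add: distrib_left)
qed

text \<open>The \<open>n\<close>-th column of \<open>h\<close> is replaced by the normalised vector \<open>w\<close> in the span of the first \<open>n\<close>
  columns that is orthogonal to the first \<open>n - 1\<close> of them. This is right multiplication by a block
  upper triangular \<open>Q\<close>, which passes through the unipotent matrices by rescaling \<open>t\<close> by \<open>r\<close>; both effects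
  together amount to the factor \<open>exp (\<nu> ln r)\<close>.\<close>

lemma B_family_reduce_to_adapted:
  fixes h :: "('n::{finite,linorder}) mat2" and f :: "'n mat2 \<Rightarrow> complex"
  assumes f: "f \<in> prin \<xi>\<^sub>1 \<xi>\<^sub>2 \<mu>\<^sub>1 \<mu>\<^sub>2" and h: "h \<in> GL_corner"
  obtains X and r :: real where "adapted X"
    "\<And>z. B_family \<xi>\<^sub>1 \<xi>\<^sub>2 \<eta> f h z = exp (z $ 3 * of_real (ln r)) * B_family \<xi>\<^sub>1 \<xi>\<^sub>2 \<eta> f X z"
proof -
  let ?N = "Max UNIV :: 'n"
  let ?E = "elem_mat idx_2n idx_n :: 'n mat2"
  have hGL: "h \<in> GL" using h by (rule GL_corner_GL)
  define G where "G = column_gram h"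
  have "det G \<noteq> 0" using det_column_gram_pos[OF hGL] by (simp add: G_def)
  then obtain c where c: "G *v c = axis ?N 1"
    using cramer[of G] by blast
  \<comment> \<open>As \<open>c\<close> is the last column of the inverse Gram matrix, \<open>w\<close> is orthogonal to all but the last
    of the first \<open>n\<close> columns.\<close>
  define w where "w = (\<Sum>l\<in>UNIV. c $ l *\<^sub>R column (Inl l) h)"
  have col_w: "column (Inl i) h \<bullet> w = (if i = ?N then 1 else 0)" for i
  proof -
    have "column (Inl i) h \<bullet> w = (G *v c) $ i"
      by (simp add: w_def inner_sum_right G_def column_gram_def matrix_vector_mult_def mult.commute)
    then show ?thesis by (simp add: c axis_def)
  qed
  have ww: "w \<bullet> w = c $ ?N"
  proof -
    have "w \<bullet> w = (\<Sum>l\<in>UNIV. c $ l * (column (Inl l) h \<bullet> w))"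
      by (subst (1) w_def) (simp add: inner_sum_left)
    then show ?thesis by (simp add: col_w if_distrib[of "\<lambda>x. _ * x"] cong: if_cong)
  qed
  define r where "r = norm w"
  have "w \<noteq> 0" using col_w[of ?N] by auto
  then have r: "r > 0" by (simp add: r_def)
  have cN: "c $ ?N / r = r"
    using r unfolding ww[symmetric] r_def by (simp add: power2_norm_eq_inner[symmetric] power2_eq_square)
  define q where "q = (\<chi> i j. if j = ?N then c $ i / r else (mat 1 :: ((real, 'n) vec, 'n) vec) $ i $ j)"
  have det_q: "det q = r"
    using cramer_lemma[of ?N "mat 1 :: ((real, 'n) vec, 'n) vec" "\<chi> i. c $ i / r"] cN
    unfolding q_def matrix_vector_mul_lid vec_lambda_beta by simp
  then have qGL: "q \<in> GL" "mat 1 \<in> (GL :: ((real, 'n) vec, 'n) vec set)" using r by (simp_all add: GL_iff_det)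
  define Q :: "'n mat2" where "Q = upper_block q 0 (mat 1)"
  define X where "X = h ** Q"
  have Q_col: "Q $ i $ idx_2n = (if i = idx_2n then 1 else 0)" for i
    by (simp add: Q_def upper_block_def idx_2n_def mat_def split: sum.splits)
  have Q_row: "Q $ idx_2n $ j = (if j = idx_2n then 1 else 0)" for j
    by (auto simp: Q_def upper_block_def idx_2n_def mat_def split: sum.splits)
  have Q_row_n: "Q $ idx_n $ j = (if j = idx_n then r else 0)" for j
    using cN by (auto simp: Q_def upper_block_def idx_n_def q_def mat_def split: sum.splits)
  have "X \<in> GL_corner"
  proof -
    have "X \<in> GL" using hGL qGL by (simp add: X_def Q_def GL_mult_iff GL_upper_block_iff)
    moreover have "X $ i $ idx_2n = (if i = idx_2n then 1 else 0)" for i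
      by (simp add: X_def matrix_matrix_mult_def Q_col GL_corner_column[OF h] if_distrib[of "\<lambda>x. _ * x"] cong: if_cong)
    moreover have "X $ idx_2n $ j = (if j = idx_2n then 1 else 0)" for j
      by (simp add: X_def matrix_matrix_mult_def GL_corner_row[OF h] Q_row if_distrib[of "\<lambda>x. x * _"] cong: if_cong)
    ultimately show ?thesis by (simp add: GL_corner_def)
  qed
  moreover have "column_gram X $ i $ ?N = (if i = ?N then 1 else 0)" for i
  proof -
    have "column (Inl ?N) X = (1 / r) *\<^sub>R w"
      unfolding X_def Q_def column_Inl_mult_upper_block w_def
      by (simp add: q_def scaleR_sum_right)
    moreover have "column (Inl i) X = column (Inl i) h" if "i \<noteq> ?N"
      unfolding X_def Q_def column_Inl_mult_upper_block using that
      by (simp add: q_def mat_def if_distrib[of "\<lambda>x. x *\<^sub>R _"] cong: if_cong)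
    ultimately show ?thesis
      using r by (auto simp: column_gram_def col_w ww)
        (simp add: r_def power2_norm_eq_inner[symmetric] power2_eq_square flip: ww)
  qed
  ultimately have X: "adapted X" by (simp add: adapted_def)
  have QE: "(mat 1 + t *\<^sub>R ?E) ** Q = Q ** (mat 1 + (r * t) *\<^sub>R ?E)" for t
  proof -
    have "?E ** Q = r *\<^sub>R ?E"
      by (auto simp: vec_eq_iff matrix_matrix_mult_def elem_mat_def Q_row_n if_distrib[of "\<lambda>x. x * _"] cong: if_cong)
    moreover have "Q ** ?E = ?E"
      by (auto simp: vec_eq_iff matrix_matrix_mult_def elem_mat_def Q_col if_distrib[of "\<lambda>x. _ * x"] cong: if_cong)
    moreover have "(mat 1 + t *\<^sub>R ?E) ** Q = Q + t *\<^sub>R (?E ** Q)"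
      by (simp add: linear_add[OF bounded_linear.linear[OF bounded_linear_matrix_mult_right[of Q]]]
          linear_scale[OF bounded_linear.linear[OF bounded_linear_matrix_mult_right[of Q]]])
    moreover have "Q ** (mat 1 + (r * t) *\<^sub>R ?E) = Q + (r * t) *\<^sub>R (Q ** ?E)"
      by (simp add: linear_add[OF bounded_linear.linear[OF bounded_linear_matrix_mult_left[of Q]]]
          linear_scale[OF bounded_linear.linear[OF bounded_linear_matrix_mult_left[of Q]]])
    ultimately show ?thesis by simp
  qed
  have "B_family \<xi>\<^sub>1 \<xi>\<^sub>2 \<eta> f h z = exp (z $ 3 * of_real (ln r)) * B_family \<xi>\<^sub>1 \<xi>\<^sub>2 \<eta> f X z" for z
  proof -
    define f' where "f' = compact_section \<xi>\<^sub>1 \<xi>\<^sub>2 (z $ 1) (z $ 2) f"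
    define a where "a = z $ 1 - z $ 3 + of_nat CARD('n) / 2"
    have f': "f' \<in> prin \<xi>\<^sub>1 \<xi>\<^sub>2 (z $ 1) (z $ 2)"
      unfolding f'_def compact_section_eq[OF f] by (rule section_factor_prin[OF f])
    have shift: "f' (h ** (mat 1 + t *\<^sub>R ?E)) =
        exp ((z $ 1 + of_nat CARD('n) / 2) * of_real (ln r)) * f' (X ** (mat 1 + (r * t) *\<^sub>R ?E))" for t
    proof -
      have "mat 1 + t *\<^sub>R ?E \<in> GL"
        unfolding shear_decomposition GL_mult_iff GL_upper_block_iff
        using orthogonal_matrix_GL[OF orthogonal_rotation, of "arctan t"]
        by (simp add: GL_iff_det det_diag_last)
      then have GL: "h ** (mat 1 + t *\<^sub>R ?E) \<in> GL" using hGL by (simp add: GL_mult_iff)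
      have "f' (X ** (mat 1 + (r * t) *\<^sub>R ?E)) = f' (h ** (mat 1 + t *\<^sub>R ?E) ** Q)"
        by (simp add: X_def QE flip: matrix_mul_assoc)
      also have "\<dots> = exp (- (z $ 1 + of_nat CARD('n) / 2) * of_real (ln r)) * f' (h ** (mat 1 + t *\<^sub>R ?E))"
        unfolding Q_def prin_equivariant[OF f' GL qGL] det_q
        using r by (simp add: signed_power_pos)
      finally have "f' (X ** (mat 1 + (r * t) *\<^sub>R ?E)) =
          exp (- ((z $ 1 + of_nat CARD('n) / 2) * of_real (ln r))) * f' (h ** (mat 1 + t *\<^sub>R ?E))"
        by (simp only: mult_minus_left)
      then show ?thesis by (simp add: exp_minus)
    qed
    have "B_family \<xi>\<^sub>1 \<xi>\<^sub>2 \<eta> f h z = exp ((z $ 1 + of_nat CARD('n) / 2) * of_real (ln r)) *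
        (LINT t:- {0}|lborel. signed_power (\<xi>\<^sub>1 + \<eta>) a t * f' (X ** (mat 1 + (r * t) *\<^sub>R ?E)) / of_real \<bar>t\<bar>)"
      unfolding B_family_def B_integral_def f'_def[symmetric] a_def[symmetric] shift
        set_integral_mult_right[symmetric]
      by (simp add: mult_ac)
    also have "\<dots> = exp ((z $ 1 + of_nat CARD('n) / 2) * of_real (ln r)) * (exp (- a * of_real (ln r)) * B_family \<xi>\<^sub>1 \<xi>\<^sub>2 \<eta> f X z)"
      unfolding set_integral_mellin_scale[OF r, of "\<xi>\<^sub>1 + \<eta>" a "\<lambda>t. f' (X ** (mat 1 + t *\<^sub>R ?E))"]
        B_family_def B_integral_def f'_def[symmetric] a_def[symmetric] ..
    also have "\<dots> = exp (z $ 3 * of_real (ln r)) * B_family \<xi>\<^sub>1 \<xi>\<^sub>2 \<eta> f X z"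
      unfolding mult.assoc[symmetric] exp_add[symmetric] by (simp add: a_def algebra_simps)
    finally show ?thesis .
  qed
  then show ?thesis using that X by blast
qed

section \<open>Continuation and decay of the operator\<close>

lemma compact_orthogonal_matrices: "compact {k :: real ^ 'm::finite ^ 'm. orthogonal_matrix k}"
proof -
  have "norm k \<le> real CARD('m)" if k: "orthogonal_matrix k" for k :: "real ^ 'm ^ 'm"
  proof -
    have "norm (row i k) = 1" for i
      using k by (simp add: orthogonal_matrix_orthonormal_rows)
    then have "norm (k $ i) = 1" for i by (simp add: row_def)
    then show ?thesis
      unfolding norm_vec_def[of k] using L2_set_le_sum[of UNIV "\<lambda>i. norm (k $ i)"] by (simp del: norm_vec_def)
  qed
  then have "bounded {k :: real ^ 'm ^ 'm. orthogonal_matrix k}" by (auto simp: bounded_iff)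
  moreover have "closed {k :: real ^ 'm ^ 'm. orthogonal_matrix k}"
  proof -
    have "continuous_on UNIV (\<lambda>k :: real ^ 'm ^ 'm. transpose k ** k)"
      unfolding matrix_matrix_mult_def transpose_def by (intro continuous_intros)
    then have "closed ((\<lambda>k :: real ^ 'm ^ 'm. transpose k ** k) -` {mat 1})"
      by (intro closed_vimage) auto
    then show ?thesis by (simp add: vimage_def orthogonal_matrix)
  qed
  ultimately show ?thesis by (simp add: compact_eq_bounded_closed)
qed

lemma holomorphic_section_factor:
  assumes "X \<in> GL"
  shows "holomorphic_several_on (\<lambda>z :: complex ^ 3. section_factor ((\<mu>\<^sub>1 - z $ 1) - (\<mu>\<^sub>2 - z $ 2)) (\<mu>\<^sub>2 - z $ 2) X) S"
proof -
  have "det (column_gram X) \<noteq> 0" "(det X)\<^sup>2 \<noteq> 0"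
    using det_column_gram_pos[OF assms] assms by (simp_all add: GL_iff_det)
  then have "(\<lambda>z :: complex ^ 3. section_factor ((\<mu>\<^sub>1 - z $ 1) - (\<mu>\<^sub>2 - z $ 2)) (\<mu>\<^sub>2 - z $ 2) X) =
      (\<lambda>z. exp (((\<mu>\<^sub>1 - z $ 1) - (\<mu>\<^sub>2 - z $ 2)) * (Ln (of_real (det (column_gram X))) / 2)) *
           exp ((\<mu>\<^sub>2 - z $ 2) * (Ln (of_real ((det X)\<^sup>2)) / 2)))"
    by (simp add: section_factor_def powr_def fun_eq_iff)
  then show ?thesis
    by (simp only:) (intro holomorphic_several_intros)
qed

text \<open>The factor \<open>E\<close> accommodates the passage from a general matrix to an adapted one.\<close>

lemma mero_continuation_at_B_family:
  fixes f :: "('n::{finite,linorder}) mat2 \<Rightarrow> complex" and z\<^sub>0 :: "complex ^ 3"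
  defines "a \<equiv> \<lambda>z :: complex ^ 3. z $ 1 - z $ 3 + of_real (real CARD('n) / 2)"
    and "b \<equiv> \<lambda>z :: complex ^ 3. z $ 3 - z $ 2 + of_real (real CARD('n) / 2)"
  assumes f: "f \<in> prin \<xi>\<^sub>1 \<xi>\<^sub>2 \<mu>\<^sub>1 \<mu>\<^sub>2" and X: "adapted X"
    and \<Phi>: "derivative_sequence \<Phi>" "\<And>\<theta>. \<Phi> 0 \<theta> = f (X ** rotation \<theta>)"
    and \<Psi>: "derivative_sequence \<Psi>" "\<And>\<theta>. \<Psi> 0 \<theta> = f (X ** rotation (- \<theta>))"
    and E: "holomorphic_several_on E UNIV" "\<And>z. F\<^sub>0 z = E z * B_family \<xi>\<^sub>1 \<xi>\<^sub>2 \<eta> f X z"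
    and z\<^sub>0: "Im (z\<^sub>0 $ 1 - z\<^sub>0 $ 3) \<noteq> 0" "Im (z\<^sub>0 $ 3 - z\<^sub>0 $ 2) \<noteq> 0"
  shows "mero_continuation_at (conv_domain TYPE('n)) F\<^sub>0 z\<^sub>0 (\<lambda>z.
     (E z * section_factor ((\<mu>\<^sub>1 - z $ 1) - (\<mu>\<^sub>2 - z $ 2)) (\<mu>\<^sub>2 - z $ 2) X) *
      (angular_meromorphic \<Phi> (a z) (b z)
       + (if \<xi>\<^sub>1 + \<eta> = 0 then 1 else - 1) *
         angular_meromorphic \<Psi> (a z) (b z)))"
proof -
  have XGL: "X \<in> GL" using X by (simp add: adapted_def GL_corner_GL)
  have D: "conv_domain TYPE('n) = {z. Re (z $ 1 - z $ 3) > - (real CARD('n) / 2) \<and> Re (z $ 3 - z $ 2) > - (real CARD('n) / 2)}"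
    by (simp add: conv_domain_def)
  show ?thesis
    unfolding D a_def b_def
  proof (rule mero_continuation_at_angular[OF \<Phi>(1) \<Psi>(1) _ _ _ z\<^sub>0])
    show "holomorphic_several_on (\<lambda>z. E z * section_factor ((\<mu>\<^sub>1 - z $ 1) - (\<mu>\<^sub>2 - z $ 2)) (\<mu>\<^sub>2 - z $ 2) X) UNIV"
      by (intro holomorphic_several_on_mult E(1) holomorphic_section_factor XGL)
    fix z :: "complex ^ 3"
    assume "- (real CARD('n) / 2) < Re (z $ 1 - z $ 3)" "- (real CARD('n) / 2) < Re (z $ 3 - z $ 2)"
    then have "Re (z $ 1 - z $ 3 + of_real (real CARD('n) / 2)) > 0" "Re (z $ 3 - z $ 2 + of_real (real CARD('n) / 2)) > 0"
      by simp_all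
    from B_family_adapted[OF f X \<Phi> \<Psi> this]
    show "F\<^sub>0 z = E z * section_factor ((\<mu>\<^sub>1 - z $ 1) - (\<mu>\<^sub>2 - z $ 2)) (\<mu>\<^sub>2 - z $ 2) X *
      (angular_transform \<Phi> 0 (z $ 1 - z $ 3 + of_real (real CARD('n) / 2)) (z $ 3 - z $ 2 + of_real (real CARD('n) / 2))
       + (if \<xi>\<^sub>1 + \<eta> = 0 then 1 else - 1) *
         angular_transform \<Psi> 0 (z $ 1 - z $ 3 + of_real (real CARD('n) / 2)) (z $ 3 - z $ 2 + of_real (real CARD('n) / 2)))"
      unfolding E(2) by (simp only: mult.assoc)
  qed simp
qed

lemma conv_domain_open_nonempty:
  "open (conv_domain TYPE('n::{finite,linorder}))" "conv_domain TYPE('n::{finite,linorder}) \<noteq> {}"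
proof -
  show "open (conv_domain TYPE('n))"
    unfolding conv_domain_def by (intro open_Collect_conj open_Collect_less continuous_intros)
  have "vector [1, - 1, 0] \<in> conv_domain TYPE('n)"
    by (simp add: conv_domain_def add_pos_nonneg)
  then show "conv_domain TYPE('n) \<noteq> {}" by blast
qed

lemma derivative_sequence_reflect:
  assumes "derivative_sequence \<Phi>"
  shows "derivative_sequence (\<lambda>j \<theta>. (- 1) ^ j * \<Phi> j (- \<theta>))"
  unfolding derivative_sequence_def
proof (intro allI)
  fix j \<theta>
  have "(uminus has_vector_derivative (- 1)) (at \<theta>)" for \<theta> :: real
    by (auto intro!: derivative_eq_intros)
  moreover have "(\<Phi> j has_vector_derivative \<Phi> (Suc j) (- \<theta>)) (at (- \<theta>))"
    using assms unfolding derivative_sequence_def by blast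
  ultimately have "(\<Phi> j \<circ> uminus has_vector_derivative (- 1) *\<^sub>R \<Phi> (Suc j) (- \<theta>)) (at \<theta>)"
    by (intro vector_diff_chain_at)
  from has_vector_derivative_mult_right[OF this, of "(- 1) ^ j"]
  show "((\<lambda>\<theta>. (- 1) ^ j * \<Phi> j (- \<theta>)) has_vector_derivative (- 1) ^ Suc j * \<Phi> (Suc j) (- \<theta>)) (at \<theta>)"
    by (simp add: o_def)
qed

lemma orthogonal_corner_adapted: "h \<in> O_corner \<Longrightarrow> adapted h"
  by (auto simp: O_corner_def adapted_def column_gram_orthogonal mat_def)

theorem theorem5p3:
  fixes \<xi>\<^sub>1 \<xi>\<^sub>2 \<eta> :: bit and \<mu>\<^sub>1 \<mu>\<^sub>2 :: complex and R :: real and N :: nat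
  assumes "R > 0"
  shows "\<exists>(q :: (('n::{finite,linorder}) mat2 \<Rightarrow> complex) \<Rightarrow> real) (T :: real).
           seminorm_on (prin \<xi>\<^sub>1 \<xi>\<^sub>2 \<mu>\<^sub>1 \<mu>\<^sub>2) q \<and>
           continuous_map (prin_topology \<xi>\<^sub>1 \<xi>\<^sub>2 \<mu>\<^sub>1 \<mu>\<^sub>2) euclideanreal q \<and>
           (\<forall>f \<in> prin \<xi>\<^sub>1 \<xi>\<^sub>2 \<mu>\<^sub>1 \<mu>\<^sub>2. \<forall>\<nu>. \<bar>Re \<nu>\<bar> \<le> R \<and> \<bar>Im \<nu>\<bar> > T \<longrightarrow>
              B_no_pole \<xi>\<^sub>1 \<xi>\<^sub>2 \<eta> \<mu>\<^sub>1 \<mu>\<^sub>2 \<nu> f \<and>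
              Linf_norm O_corner (B_op \<xi>\<^sub>1 \<xi>\<^sub>2 \<eta> \<mu>\<^sub>1 \<mu>\<^sub>2 \<nu> f)
                \<le> ereal (q f * (1 + \<bar>Im \<nu>\<bar>) powi (- int N)))"
proof -
  define V :: "('n mat2 \<Rightarrow> complex) set" where "V = prin \<xi>\<^sub>1 \<xi>\<^sub>2 \<mu>\<^sub>1 \<mu>\<^sub>2"
  define K where "K = {k :: 'n mat2. orthogonal_matrix k}"
  have VC: "V \<subseteq> Cinf GL" using prin_Cinf by (auto simp: V_def)
  have K: "compact K" "K \<subseteq> GL" "K \<noteq> {}"
    using compact_orthogonal_matrices orthogonal_matrix_GL orthogonal_matrix_id by (auto simp: K_def)
  define J :: "'n mat2" where "J = elem_mat idx_2n idx_n - elem_mat idx_n idx_2n"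
  from angular_operator_sequence[of J]
  obtain D where "D 0 = (\<lambda>f g. f g) \<and> (\<forall>j. angular_operator (D j) \<and> derivative_along_flow J (D j) (D (Suc j)))" ..
  then have D: "D 0 = (\<lambda>f g. f g)" "\<And>j. angular_operator (D j)" "\<And>j. derivative_along_flow J (D j) (D (Suc j))"
    by simp_all
  define \<Phi> where "\<Phi> f X j \<theta> = D j f (X ** rotation \<theta>)" for f and X :: "'n mat2" and j \<theta>
  define \<Psi> where "\<Psi> f X j \<theta> = (- 1) ^ j * \<Phi> f X j (- \<theta>)" for f and X :: "'n mat2" and j \<theta>
  have \<Phi>: "derivative_sequence (\<Phi> f X)" if "f \<in> V" "X \<in> GL" for f X
    unfolding derivative_sequence_def \<Phi>_def
  proof (intro allI derivative_along_flowD[OF D(3), where S = GL])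
    show "f \<in> Cinf GL" using that VC by blast
    show "((\<lambda>\<theta>. X ** rotation \<theta>) has_vector_derivative X ** rotation \<theta> ** J) (at \<theta>)" for \<theta>
      unfolding J_def by (rule rotation_has_vector_derivative)
    show "X ** rotation \<theta> \<in> GL" for \<theta>
      using that orthogonal_matrix_GL[OF orthogonal_rotation] by (simp add: GL_mult_iff)
  qed
  have \<Psi>: "derivative_sequence (\<Psi> f X)" if "f \<in> V" "X \<in> GL" for f X
    using derivative_sequence_reflect[OF \<Phi>[OF that]] unfolding \<Psi>_def[abs_def] .
  have \<Phi>0: "\<Phi> f X 0 \<theta> = f (X ** rotation \<theta>)" and \<Psi>0: "\<Psi> f X 0 \<theta> = f (X ** rotation (- \<theta>))" for f X \<theta>
    by (simp_all only: \<Psi>_def \<Phi>_def D(1) power_0 mult_1)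
  have "\<forall>j. \<exists>q. continuous_seminorm GL V q \<and> (\<forall>f\<in>V. \<forall>g\<in>K. norm (D j f g) \<le> q f)"
    using angular_operator_bound[OF open_GL VC K D(2)] by blast
  then obtain qs where qs: "\<And>j. continuous_seminorm GL V (qs j)" "\<And>j f g. f \<in> V \<Longrightarrow> g \<in> K \<Longrightarrow> norm (D j f g) \<le> qs j f"
    by metis
  \<comment> \<open>At level \<open>m\<close> the recursion ends at arguments with real parts at least \<open>1\<close>, where the transform
    is bounded uniformly in \<open>\<nu>\<close>, and it has gained at least \<open>N\<close> powers of \<open>\<bar>Im \<nu>\<bar>\<close>.\<close>
  define m where "m = max N (nat \<lceil>R + norm \<mu>\<^sub>1 + norm \<mu>\<^sub>2 + 1\<rceil>)"
  have m: "real m \<ge> R + norm \<mu>\<^sub>1 + norm \<mu>\<^sub>2 + 1" "m \<ge> N" unfolding m_def by linarith+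
  obtain C where C: "C \<ge> 0" and decay: "uniform_decay (norm (\<mu>\<^sub>1 - \<mu>\<^sub>2 + of_nat CARD('n))) C m"
    using angular_continuation_decay[OF norm_ge_zero] by blast
  define Q where "Q f = (\<Sum>j\<le>m. qs j f)" for f
  have Q: "continuous_seminorm GL V Q" unfolding Q_def[abs_def] by (intro continuous_seminorm_sum qs)
  define q where "q f = (2 * C * 2 ^ N) * Q f" for f
  \<comment> \<open>Beyond \<open>T\<close> the imaginary parts of \<open>a\<close> and \<open>b\<close> are at least \<open>(1 + \<bar>Im \<nu>\<bar>) / 2 \<ge> 1\<close> in absolute value.\<close>
  define T where "T = 2 * (norm \<mu>\<^sub>1 + norm \<mu>\<^sub>2) + 1"
  have q: "continuous_seminorm GL V q"
    unfolding q_def[abs_def] using C by (intro continuous_seminorm_scale Q) simp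
  have main: "B_no_pole \<xi>\<^sub>1 \<xi>\<^sub>2 \<eta> \<mu>\<^sub>1 \<mu>\<^sub>2 \<nu> f \<and>
      Linf_norm O_corner (B_op \<xi>\<^sub>1 \<xi>\<^sub>2 \<eta> \<mu>\<^sub>1 \<mu>\<^sub>2 \<nu> f) \<le> ereal (q f * (1 + \<bar>Im \<nu>\<bar>) powi (- int N))"
    if f: "f \<in> V" and \<nu>: "\<bar>Re \<nu>\<bar> \<le> R" "\<bar>Im \<nu>\<bar> > T" for f \<nu>
  proof -
    define z\<^sub>0 :: "complex ^ 3" where "z\<^sub>0 = vector [\<mu>\<^sub>1, \<mu>\<^sub>2, \<nu>]"
    have z0: "z\<^sub>0 $ 1 = \<mu>\<^sub>1" "z\<^sub>0 $ 2 = \<mu>\<^sub>2" "z\<^sub>0 $ 3 = \<nu>" by (simp_all add: z\<^sub>0_def)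
    have \<mu>: "\<bar>Im \<mu>\<^sub>1\<bar> \<le> norm \<mu>\<^sub>1" "\<bar>Im \<mu>\<^sub>2\<bar> \<le> norm \<mu>\<^sub>2" "\<bar>Re \<mu>\<^sub>1\<bar> \<le> norm \<mu>\<^sub>1" "\<bar>Re \<mu>\<^sub>2\<bar> \<le> norm \<mu>\<^sub>2"
      "norm \<mu>\<^sub>1 \<ge> 0" "norm \<mu>\<^sub>2 \<ge> 0"
      by (auto simp: abs_Im_le_cmod abs_Re_le_cmod)
    have Im0: "Im (z\<^sub>0 $ 1 - z\<^sub>0 $ 3) \<noteq> 0" "Im (z\<^sub>0 $ 3 - z\<^sub>0 $ 2) \<noteq> 0"
      using \<mu> \<nu>(2) unfolding z0 T_def by auto
    have fp: "f \<in> prin \<xi>\<^sub>1 \<xi>\<^sub>2 \<mu>\<^sub>1 \<mu>\<^sub>2" using f by (simp add: V_def)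

    have "continuation_regular (conv_domain TYPE('n)) (B_family \<xi>\<^sub>1 \<xi>\<^sub>2 \<eta> f h) z\<^sub>0"
      if h: "h \<in> GL_corner" for h
    proof -
      obtain X r where X: "adapted X" and
        eq: "\<And>z. B_family \<xi>\<^sub>1 \<xi>\<^sub>2 \<eta> f h z = exp (z $ 3 * complex_of_real (ln r)) * B_family \<xi>\<^sub>1 \<xi>\<^sub>2 \<eta> f X z"
        using B_family_reduce_to_adapted[OF fp h, where \<eta> = \<eta>] by metis
      have XGL: "X \<in> GL" using X by (simp add: adapted_def GL_corner_GL)
      have hol: "holomorphic_several_on (\<lambda>z :: complex ^ 3. exp (z $ 3 * complex_of_real (ln r))) UNIV"
        by (intro holomorphic_several_intros)
      note cont = mero_continuation_at_B_family[where E = "\<lambda>z. exp (z $ 3 * complex_of_real (ln r))"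
          and F\<^sub>0 = "B_family \<xi>\<^sub>1 \<xi>\<^sub>2 \<eta> f h" and \<Phi> = "\<Phi> f X" and \<Psi> = "\<Psi> f X" and f = f and X = X
          and \<eta> = \<eta> and z\<^sub>0 = z\<^sub>0 and \<xi>\<^sub>1 = \<xi>\<^sub>1 and \<xi>\<^sub>2 = \<xi>\<^sub>2 and \<mu>\<^sub>1 = \<mu>\<^sub>1 and \<mu>\<^sub>2 = \<mu>\<^sub>2]
      show ?thesis
        unfolding continuation_regular_def
        by (rule exI, rule cont[OF fp X \<Phi>[OF f XGL] \<Phi>0 \<Psi>[OF f XGL] \<Psi>0 hol eq Im0])
    qed
    then have no_pole: "B_no_pole \<xi>\<^sub>1 \<xi>\<^sub>2 \<eta> \<mu>\<^sub>1 \<mu>\<^sub>2 \<nu> f"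
      by (simp add: B_no_pole_def z\<^sub>0_def)
    define y where "y = (1 + \<bar>Im \<nu>\<bar>) / 2"
    have "T \<ge> 1" using \<mu>(5,6) by (simp add: T_def)
    with \<nu>(2) have "\<bar>Im \<nu>\<bar> \<ge> 1" by simp
    then have y: "y \<ge> 1" by (simp add: y_def)
    have bound: "norm (B_op \<xi>\<^sub>1 \<xi>\<^sub>2 \<eta> \<mu>\<^sub>1 \<mu>\<^sub>2 \<nu> f h) \<le> q f * (1 + \<bar>Im \<nu>\<bar>) powi (- int N)"
      if h: "h \<in> O_corner" for h
    proof -
      have ho: "orthogonal_matrix h" and hGL: "h \<in> GL" using h by (auto simp: O_corner_def GL_corner_GL)
      define a where "a = \<mu>\<^sub>1 - \<nu> + of_real (real CARD('n) / 2)"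
      define b where "b = \<nu> - \<mu>\<^sub>2 + of_real (real CARD('n) / 2)"
      define \<sigma> :: complex where "\<sigma> = (if \<xi>\<^sub>1 + \<eta> = 0 then 1 else - 1)"
      have norm_\<sigma>: "norm \<sigma> = 1" by (auto simp: \<sigma>_def)
      note B_value = continuation_value_eq[OF conv_domain_open_nonempty
          mero_continuation_at_B_family[where E = "\<lambda>z. 1" and F\<^sub>0 = "B_family \<xi>\<^sub>1 \<xi>\<^sub>2 \<eta> f h"
            and \<Phi> = "\<Phi> f h" and \<Psi> = "\<Psi> f h" and f = f and X = h and \<eta> = \<eta> and z\<^sub>0 = z\<^sub>0
            and \<xi>\<^sub>1 = \<xi>\<^sub>1 and \<xi>\<^sub>2 = \<xi>\<^sub>2 and \<mu>\<^sub>1 = \<mu>\<^sub>1 and \<mu>\<^sub>2 = \<mu>\<^sub>2,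
            OF fp orthogonal_corner_adapted[OF h] \<Phi>[OF f hGL] \<Phi>0 \<Psi>[OF f hGL] \<Psi>0
              holomorphic_several_on_const[of 1] mult_1[symmetric] Im0]]
      have "B_op \<xi>\<^sub>1 \<xi>\<^sub>2 \<eta> \<mu>\<^sub>1 \<mu>\<^sub>2 \<nu> f h = angular_meromorphic (\<Phi> f h) a b + \<sigma> * angular_meromorphic (\<Psi> f h) a b"
        unfolding B_op_def z\<^sub>0_def[symmetric] B_value z0
        by (simp add: section_factor_orthogonal[OF ho] a_def b_def \<sigma>_def)
      also have "\<dots> = angular_continuation (\<Phi> f h) m 0 a b + \<sigma> * angular_continuation (\<Psi> f h) m 0 a b"
      proof -
        have "Re a > - real m" "Re b > - real m" using m(1) \<mu> \<nu>(1) by (auto simp: a_def b_def)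
        then show ?thesis using angular_meromorphic_eq \<Phi>[OF f hGL] \<Psi>[OF f hGL] by simp
      qed
      finally have "norm (B_op \<xi>\<^sub>1 \<xi>\<^sub>2 \<eta> \<mu>\<^sub>1 \<mu>\<^sub>2 \<nu> f h) \<le>
          norm (angular_continuation (\<Phi> f h) m 0 a b) + norm (angular_continuation (\<Psi> f h) m 0 a b)"
        using norm_triangle_ineq[of "angular_continuation (\<Phi> f h) m 0 a b" "\<sigma> * angular_continuation (\<Psi> f h) m 0 a b"]
        by (simp add: norm_mult norm_\<sigma>)
      also have "\<dots> \<le> C * Q f / y ^ m + C * Q f / y ^ m"
      proof -
        have re: "Re a \<ge> 1 - real m" "Re b \<ge> 1 - real m"
          using m(1) \<mu> \<nu>(1) by (auto simp: a_def b_def)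
        have "a + b = \<mu>\<^sub>1 - \<mu>\<^sub>2 + of_nat CARD('n)" by (simp add: a_def b_def)
        then have ab: "norm (a + b) \<le> norm (\<mu>\<^sub>1 - \<mu>\<^sub>2 + of_nat CARD('n))" by simp
        have "\<bar>Im a\<bar> \<ge> \<bar>Im \<nu>\<bar> - norm \<mu>\<^sub>1" "\<bar>Im b\<bar> \<ge> \<bar>Im \<nu>\<bar> - norm \<mu>\<^sub>2"
          using abs_triangle_ineq2_sym[of "Im \<nu>" "Im \<mu>\<^sub>1"] abs_triangle_ineq2[of "Im \<nu>" "Im \<mu>\<^sub>2"] \<mu>(1,2)
          by (simp_all add: a_def b_def)
        moreover have "(1 + i) / 2 \<le> x" if "i - s \<le> x" "2 * s + 1 \<le> i" for i s x :: real
          using that by (simp add: field_simps)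
        moreover have "2 * norm \<mu>\<^sub>1 + 1 \<le> \<bar>Im \<nu>\<bar>" "2 * norm \<mu>\<^sub>2 + 1 \<le> \<bar>Im \<nu>\<bar>"
          by (rule order_trans[OF _ less_imp_le[OF \<nu>(2)]], simp add: T_def)+
        ultimately have im: "\<bar>Im a\<bar> \<ge> y" "\<bar>Im b\<bar> \<ge> y" unfolding y_def by blast+
        have \<Phi>_bound: "norm (\<Phi> f h i \<theta>) \<le> Q f" if "i \<le> m" for i \<theta>
        proof -
          have "h ** rotation \<theta> \<in> K" by (simp add: K_def orthogonal_matrix_mul ho orthogonal_rotation)
          then have "norm (\<Phi> f h i \<theta>) \<le> qs i f" using qs(2)[OF f] by (simp add: \<Phi>_def)
          also have "\<dots> \<le> Q f"
            unfolding Q_def using that continuous_seminorm_nonneg[OF qs(1) f] by (intro member_le_sum) auto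
          finally show ?thesis .
        qed
        then have \<Psi>_bound: "norm (\<Psi> f h i \<theta>) \<le> Q f" if "i \<le> m" for i \<theta>
          using that by (simp add: \<Psi>_def norm_mult norm_power)
        show ?thesis
          by (intro add_mono uniform_decayD[OF decay] re ab y im \<Phi>[OF f hGL] \<Psi>[OF f hGL]) (simp_all add: \<Phi>_bound \<Psi>_bound)
      qed
      also have "\<dots> = 2 * C * Q f / y ^ m" by simp
      also have "\<dots> \<le> 2 * C * Q f / y ^ N"
        using y m(2) C continuous_seminorm_nonneg[OF Q f]
        by (intro divide_left_mono power_increasing mult_nonneg_nonneg) auto
      also have "\<dots> = q f * (1 + \<bar>Im \<nu>\<bar>) powi (- int N)"
      proof -
        have "2 * C * u / (w / v) = 2 * C * v * u * inverse w" for u v w :: real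
          by (simp add: divide_inverse mult_ac)
        then show ?thesis
          unfolding q_def y_def power_divide power_int_minus power_int_of_nat by simp
      qed
      finally show ?thesis .
    qed
    have "Linf_norm O_corner (B_op \<xi>\<^sub>1 \<xi>\<^sub>2 \<eta> \<mu>\<^sub>1 \<mu>\<^sub>2 \<nu> f) \<le> ereal (q f * (1 + \<bar>Im \<nu>\<bar>) powi (- int N))"
      unfolding Linf_norm_def using bound by (intro SUP_least) simp
    with no_pole show ?thesis by blast
  qed
  show ?thesis
    using q main unfolding continuous_seminorm_def prin_topology_def V_def by blast
qed

end
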